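(* Let $n\ge1$, $\beta>0$, $\alpha\in\mathbf R$, and let $a,b$ be nonzero real numbers with $a^2/b^2\le1$. Let $\rho(x,t)=\rho_2(bx,bt)$, where $\rho_2$ is the nonisotropic Minkowski functional of the Euclidean unit ball, and let $T$ be the associated convolution operator $Tf=f*K_{\alpha,\beta}$ on the Heisenberg group $\mathbf H_a^n$. Then $T$ extends to a bounded operator from $L^2(\mathbf H_a^n)$ to itself whenever $\alpha\le(n+\tfrac12)\beta$.
   Context: For $a\in\mathbf R\setminus\{0\}$ and $n\ge1$, the Heisenberg group $\mathbf H_a^n$ is $\mathbf R^{2n+1}=\{(x,t):x\in\mathbf R^{2n},t\in\mathbf R\}$ with group law $$(x,t)\cdot(y,s)=(x+y,\;s+t-2a\,x^{\mathrm t}Jy),\qquad J=\begin{pmatrix}0&I_n\\-I_n&0\end{pmatrix},$$ so that $(x,t)^{-1}=(-x,-t)$. $L^2(\mathbf H_a^n)$ is taken with respect to Lebesgue measure $dx\,dt$. The group convolution is $f*K(x,t)=\int K\bigl((y,s)^{-1}\cdot(x,t)\bigr)f(y,s)\,dy\,ds$. The function $\rho_2$ is defined by: $\rho_2(x,t)=1$ if and only if $|x|^2+t^2=1$, extended by homogeneity $\rho_2(\delta x,\delta^2t)=\delta\rho_2(x,t)$ for $\delta>0$, with $\rho_2(0,0)=0$. Given $\rho$, $K_{\alpha,\beta}$ is the distribution on $\mathbf H_a^n$ that agrees for $(x,t)\neq(0,0)$ with the function $$K_{\alpha,\beta}(x,t)=\rho(x,t)^{-2n-2-\alpha}e^{i\rho(x,t)^{-\beta}}\chi(\rho(x,t)),$$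 where $\chi$ is smooth and compactly supported in a small neighborhood of the origin (contained in $[-1,1]$). The distribution is understood as the limit, in the sense of distributions, of $\sum_{j=0}^{N}\vartheta(2^j\rho)K_{\alpha,\beta}$ as $N\to\infty$, where $\vartheta\in C_0^\infty(\mathbf R)$ is supported in $[\frac12,2]$ and $\sum_{j=0}^\infty\vartheta(2^jr)=1$ for $0<r\le1$. The operator $T$ is initially defined by $Tf=f*K_{\alpha,\beta}$ for $f\in C_0^\infty$. *)

theory Defs
  imports "HOL-Analysis.Analysis"
begin

section \<open>The Heisenberg group\<close>

text \<open>
  Points of \<open>\<real>\<^sup>2\<^sup>n \<times> \<real>\<close> with \<open>n = CARD('n)\<close>; the library's norm and inner product on
  \<open>(real^'n) \<times> (real^'n)\<close> are the Euclidean ones of \<open>\<real>\<^sup>2\<^sup>n\<close>.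
\<close>

type_synonym 'n heis = "((real^'n) \<times> (real^'n)) \<times> real"

definition sympl_J :: "(real^'n::finite) \<times> (real^'n) \<Rightarrow> (real^'n) \<times> (real^'n)" where
  "sympl_J y = (snd y, - fst y)"

definition heis_mult :: "real \<Rightarrow> 'n::finite heis \<Rightarrow> 'n heis \<Rightarrow> 'n heis" where
  "heis_mult a p q =
     (fst p + fst q, snd q + snd p - 2 * a * (fst p \<bullet> sympl_J (fst q)))"

definition heis_inv :: "'n::finite heis \<Rightarrow> 'n heis" where
  "heis_inv p = (- fst p, - snd p)"

lemma inner_sympl_J_self [simp]: "x \<bullet> sympl_J x = 0"
  by (simp add: sympl_J_def inner_prod_def inner_commute)

lemma heis_mult_inv_right: "heis_mult a p (heis_inv p) = 0"
proof -
  have "fst p \<bullet> sympl_J (- fst p) = 0"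
    by (simp add: sympl_J_def inner_prod_def inner_commute)
  then show ?thesis by (simp add: heis_mult_def heis_inv_def prod_eq_iff)
qed

lemma heis_mult_inv_left: "heis_mult a (heis_inv p) p = 0"
  by (simp add: heis_mult_def heis_inv_def prod_eq_iff)


section \<open>Smooth functions and test functions\<close>

text \<open>
  \<open>Ck k f\<close> requires continuity, or differentiability everywhere with all directional derivatives
  of class \<open>k - 1\<close>; on a Euclidean space this is the usual class \<open>C\<^sup>k\<close> for \<open>k = 0\<close>, and the
  intersection over all \<open>k\<close> is \<open>C\<^sup>\<infinity>\<close>.
\<close>

primrec Ck :: "nat \<Rightarrow> ('a::euclidean_space \<Rightarrow> complex) \<Rightarrow> bool" where
  "Ck 0 f \<longleftrightarrow> continuous_on UNIV f"
| "Ck (Suc k) f \<longleftrightarrow>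
     (\<forall>x. f differentiable (at x)) \<and> (\<forall>v. Ck k (\<lambda>x. frechet_derivative f (at x) v))"

definition smooth :: "('a::euclidean_space \<Rightarrow> complex) \<Rightarrow> bool" where
  "smooth f \<longleftrightarrow> (\<forall>k. Ck k f)"

definition fsupport :: "('a::topological_space \<Rightarrow> complex) \<Rightarrow> 'a set" where
  "fsupport f = closure {x. f x \<noteq> 0}"

definition test_function :: "('a::euclidean_space \<Rightarrow> complex) \<Rightarrow> bool" where
  "test_function f \<longleftrightarrow> smooth f \<and> compact (fsupport f)"


section \<open>The nonisotropic Minkowski functional of the Euclidean unit ball\<close>

definition rho2 :: "'n::finite heis \<Rightarrow> real" where
  "rho2 p = (if p = 0 then 0 else
     (THE r. 0 < r \<and> (norm ((1 / r) *\<^sub>R fst p))\<^sup>2 + ((1 / r\<^sup>2) * snd p)\<^sup>2 = 1))"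

lemma rho2_ex1:
  fixes p :: "'n::finite heis"
  assumes "p \<noteq> 0"
  shows "\<exists>!r. 0 < r \<and> (norm ((1 / r) *\<^sub>R fst p))\<^sup>2 + ((1 / r\<^sup>2) * snd p)\<^sup>2 = 1"
proof -
  define A where "A = (norm (fst p))\<^sup>2"
  define B where "B = (snd p)\<^sup>2"
  have AB: "A \<ge> 0" "B \<ge> 0" "A > 0 \<or> B > 0"
    using assms by (auto simp: A_def B_def prod_eq_iff)
  have eq: "(norm ((1 / r) *\<^sub>R fst p))\<^sup>2 + ((1 / r\<^sup>2) * snd p)\<^sup>2 = A / r\<^sup>2 + B / (r\<^sup>2)\<^sup>2"
    if "r > 0" for r
    by (simp add: A_def B_def power_divide)
  have eq1: "A / s + B / s\<^sup>2 = 1 \<longleftrightarrow> s\<^sup>2 = A * s + B" if "s > 0" for s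
  proof -
    have "A / s + B / s\<^sup>2 = (A * s + B) / s\<^sup>2"
      using that by (simp add: field_simps power2_eq_square)
    then show ?thesis using that by (auto simp: divide_eq_1_iff)
  qed
  define s where "s = (A + sqrt (A\<^sup>2 + 4 * B)) / 2"
  have s_pos: "s > 0"
  proof -
    have "A\<^sup>2 + 4 * B > 0"
      using AB by (metis add_nonneg_pos add_pos_nonneg mult_nonneg_nonneg mult_pos_pos
          zero_le_numeral zero_le_power2 zero_less_numeral zero_less_power)
    then have "sqrt (A\<^sup>2 + 4 * B) > 0" by simp
    then show ?thesis using AB(1) by (simp add: s_def add_nonneg_pos)
  qed
  have "(sqrt (A\<^sup>2 + 4 * B))\<^sup>2 = A\<^sup>2 + 4 * B" using AB by simp
  then have s_eq: "s\<^sup>2 = A * s + B"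
    by (simp add: s_def power2_eq_square field_simps)
  have uniq: "u = v" if "u > 0" "v > 0" "u\<^sup>2 = A * u + B" "v\<^sup>2 = A * v + B" for u v
  proof (rule ccontr)
    assume "u \<noteq> v"
    have "(u - v) * (u + v - A) = 0"
      using that(3,4) by (simp add: algebra_simps power2_eq_square)
    with \<open>u \<noteq> v\<close> have "A = u + v" by simp
    then have "u * v + B = 0" using that(3) by (simp add: algebra_simps power2_eq_square)
    moreover have "u * v > 0" using that by simp
    ultimately show False using AB by simp
  qed
  show ?thesis
  proof (rule ex1I[of _ "sqrt s"])
    show "0 < sqrt s \<and> (norm ((1 / sqrt s) *\<^sub>R fst p))\<^sup>2 + ((1 / (sqrt s)\<^sup>2) * snd p)\<^sup>2 = 1"
      using s_pos s_eq eq[of "sqrt s"] eq1[of s] by simp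
  next
    fix r assume r: "0 < r \<and> (norm ((1 / r) *\<^sub>R fst p))\<^sup>2 + ((1 / r\<^sup>2) * snd p)\<^sup>2 = 1"
    then have "(r\<^sup>2)\<^sup>2 = A * r\<^sup>2 + B" using eq[of r] eq1[of "r\<^sup>2"] zero_less_power[of r 2] by metis
    then have "r\<^sup>2 = s" using uniq[of "r\<^sup>2" s] r s_pos s_eq by simp
    then show "r = sqrt s" using r by (auto intro: real_sqrt_unique[symmetric])
  qed
qed

lemma rho2_zero [simp]: "rho2 0 = 0"
  by (simp add: rho2_def)

lemma rho2_eqI:
  fixes p :: "'n::finite heis"
  assumes "0 < r" "(norm ((1 / r) *\<^sub>R fst p))\<^sup>2 + ((1 / r\<^sup>2) * snd p)\<^sup>2 = 1"
  shows "rho2 p = r"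
proof -
  have "p \<noteq> 0" using assms by auto
  then show ?thesis
    unfolding rho2_def using the1_equality[OF rho2_ex1[of p]] assms by simp
qed

lemma rho2_props:
  fixes p :: "'n::finite heis"
  assumes "p \<noteq> 0"
  shows "0 < rho2 p"
    and "(norm ((1 / rho2 p) *\<^sub>R fst p))\<^sup>2 + ((1 / (rho2 p)\<^sup>2) * snd p)\<^sup>2 = 1"
  using theI'[OF rho2_ex1[OF assms]] assms by (auto simp: rho2_def)

text \<open>The two properties that characterise the functional.\<close>

lemma rho2_eq_1_iff:
  fixes p :: "'n::finite heis"
  shows "rho2 p = 1 \<longleftrightarrow> (norm (fst p))\<^sup>2 + (snd p)\<^sup>2 = 1"
proof
  assume *: "rho2 p = 1"
  then have "p \<noteq> 0" by auto
  from rho2_props(2)[OF this] * show "(norm (fst p))\<^sup>2 + (snd p)\<^sup>2 = 1" by simp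
next
  assume "(norm (fst p))\<^sup>2 + (snd p)\<^sup>2 = 1"
  then show "rho2 p = 1" by (intro rho2_eqI) auto
qed

lemma rho2_dilate:
  fixes x :: "(real^'n::finite) \<times> (real^'n)"
  assumes "d > 0"
  shows "rho2 (d *\<^sub>R x, d\<^sup>2 * t) = d * rho2 (x, t)"
proof (cases "(x, t) = 0")
  case True
  then have "x = 0" "t = 0" by (simp_all add: zero_prod_def)
  then show ?thesis by (simp flip: zero_prod_def)
next
  case False
  note p = rho2_props[OF False]
  show ?thesis
  proof (rule rho2_eqI)
    show "0 < d * rho2 (x, t)" using assms p by simp
    have "(1 / (d * rho2 (x, t))) *\<^sub>R d *\<^sub>R x = (1 / rho2 (x, t)) *\<^sub>R x"
      using assms by simp
    moreover have "1 / (d * rho2 (x, t))\<^sup>2 * (d\<^sup>2 * t) = 1 / (rho2 (x, t))\<^sup>2 * t"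
      using assms by (simp add: power_mult_distrib)
    ultimately show "(norm ((1 / (d * rho2 (x, t))) *\<^sub>R fst (d *\<^sub>R x, d\<^sup>2 * t)))\<^sup>2
        + (1 / (d * rho2 (x, t))\<^sup>2 * snd (d *\<^sub>R x, d\<^sup>2 * t))\<^sup>2 = 1"
      unfolding fst_conv snd_conv using p(2) by (metis fst_conv snd_conv)
  qed
qed


section \<open>The kernel and the convolution operator\<close>

text \<open>
  The cutoff is written \<open>\<psi>\<close>, since \<open>\<chi>\<close> is the binder of the library's finite vectors.
  At the origin \<open>kernel_fun\<close> has a junk value, which is irrelevant for the integrals.
\<close>

definition kernel_fun ::
    "('n::finite heis \<Rightarrow> real) \<Rightarrow> (real \<Rightarrow> complex) \<Rightarrow> real \<Rightarrow> real \<Rightarrow> 'n heis \<Rightarrow> complex" where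
  "kernel_fun \<rho> \<psi> \<alpha> \<beta> z =
     complex_of_real (\<rho> z powr (- 2 * real CARD('n) - 2 - \<alpha>))
       * exp (\<i> * complex_of_real (\<rho> z powr (- \<beta>))) * \<psi> (\<rho> z)"

definition kernel_trunc ::
    "('n::finite heis \<Rightarrow> real) \<Rightarrow> (real \<Rightarrow> complex) \<Rightarrow> (real \<Rightarrow> complex)
      \<Rightarrow> real \<Rightarrow> real \<Rightarrow> nat \<Rightarrow> 'n heis \<Rightarrow> complex" where
  "kernel_trunc \<rho> \<psi> \<theta> \<alpha> \<beta> N z = (\<Sum>j\<le>N. \<theta> (2 ^ j * \<rho> z)) * kernel_fun \<rho> \<psi> \<alpha> \<beta> z"

text \<open>Distributions are represented by their action on functions.\<close>

definition fun_distr :: "('n::finite heis \<Rightarrow> complex) \<Rightarrow> ('n heis \<Rightarrow> complex) \<Rightarrow> complex" where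
  "fun_distr K \<phi> = (LINT z|lborel. K z * \<phi> z)"

definition kernel_distr ::
    "('n::finite heis \<Rightarrow> real) \<Rightarrow> (real \<Rightarrow> complex) \<Rightarrow> (real \<Rightarrow> complex)
      \<Rightarrow> real \<Rightarrow> real \<Rightarrow> ('n heis \<Rightarrow> complex) \<Rightarrow> complex" where
  "kernel_distr \<rho> \<psi> \<theta> \<alpha> \<beta> \<phi> = lim (\<lambda>N. fun_distr (kernel_trunc \<rho> \<psi> \<theta> \<alpha> \<beta> N) \<phi>)"

text \<open>
  Convolution of a function with a distribution \<open>u\<close>: the substitution \<open>z = q\<^sup>-\<^sup>1 \<cdot> p\<close> in
  \<open>\<integral> K (q\<^sup>-\<^sup>1 \<cdot> p) * f q dq\<close> preserves Lebesgue measure and gives \<open>\<integral> K z * f (p \<cdot> z\<^sup>-\<^sup>1) dz\<close>.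
  The lemma \<open>heis_conv_fun_distr\<close> below justifies this.
\<close>

definition heis_conv ::
    "real \<Rightarrow> ('n::finite heis \<Rightarrow> complex) \<Rightarrow> (('n heis \<Rightarrow> complex) \<Rightarrow> complex)
      \<Rightarrow> 'n heis \<Rightarrow> complex" where
  "heis_conv a f u p = u (\<lambda>z. f (heis_mult a p (heis_inv z)))"

lemma lborel_distr_reflect:
  "distr lborel borel (\<lambda>x. c - x) = (lborel :: 'a::euclidean_space measure)"
proof -
  have "(lborel :: 'a measure) = density (distr lborel borel (\<lambda>x. c + (-1) *\<^sub>R x)) (\<lambda>_. \<bar>- 1 :: real\<bar> ^ DIM('a))"
    by (rule lborel_affine) simp
  then show ?thesis by (simp add: density_1)
qed

lemma nn_integral_reflect:
  fixes f :: "'a::euclidean_space \<Rightarrow> ennreal"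
  assumes [measurable]: "f \<in> borel_measurable borel"
  shows "(\<integral>\<^sup>+x. f (c - x) \<partial>lborel) = (\<integral>\<^sup>+x. f x \<partial>lborel)"
proof -
  have "(\<integral>\<^sup>+x. f x \<partial>lborel) = (\<integral>\<^sup>+x. f x \<partial>distr lborel borel (\<lambda>x. c - x))"
    by (simp add: lborel_distr_reflect)
  also have "\<dots> = (\<integral>\<^sup>+x. f (c - x) \<partial>lborel)"
    by (subst nn_integral_distr) auto
  finally show ?thesis ..
qed

lemma borel_measurable_shear:
  fixes g :: "'a::euclidean_space \<Rightarrow> real"
  assumes [measurable]: "g \<in> borel_measurable borel"
  shows "(\<lambda>z. (c - fst z, g (fst z) - snd z)) \<in> borel_measurable (borel :: ('a \<times> real) measure)"
proof -
  have [measurable]: "fst \<in> borel_measurable (borel :: ('a \<times> real) measure)"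
    "snd \<in> borel_measurable (borel :: ('a \<times> real) measure)"
    by (auto intro!: borel_measurable_continuous_onI continuous_intros)
  show ?thesis by (intro borel_measurable_Pair) measurable
qed

lemma lborel_distr_shear:
  fixes g :: "'a::euclidean_space \<Rightarrow> real"
  assumes [measurable]: "g \<in> borel_measurable borel"
  shows "distr lborel borel (\<lambda>z. (c - fst z, g (fst z) - snd z)) = (lborel :: ('a \<times> real) measure)"
proof (rule measure_eqI)
  fix A :: "('a \<times> real) set"
  assume *: "A \<in> sets (distr lborel borel (\<lambda>z. (c - fst z, g (fst z) - snd z)))"
  then have A [measurable]: "A \<in> sets borel" by simp
  have A' [measurable]: "A \<in> sets (borel \<Otimes>\<^sub>M borel)"
    using A by (metis borel_prod)
  have [measurable]: "(\<lambda>z::'a \<times> real. (c - fst z, g (fst z) - snd z)) \<in> borel_measurable borel"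
    by (rule borel_measurable_shear) fact
  have "emeasure (distr lborel borel (\<lambda>z. (c - fst z, g (fst z) - snd z))) A =
      (\<integral>\<^sup>+z. indicator A z \<partial>distr lborel borel (\<lambda>z. (c - fst z, g (fst z) - snd z)))"
    by (rule nn_integral_indicator[symmetric, OF *])
  also have "\<dots> = (\<integral>\<^sup>+z. indicator A (c - fst z, g (fst z) - snd z) \<partial>(lborel :: ('a \<times> real) measure))"
    using A by (subst nn_integral_distr) (auto simp: borel_prod)
  also have "\<dots> = (\<integral>\<^sup>+z. indicator A (c - fst z, g (fst z) - snd z) \<partial>(lborel \<Otimes>\<^sub>M lborel))"
    by (simp add: lborel_prod)
  also have "\<dots> = (\<integral>\<^sup>+x. \<integral>\<^sup>+t. indicator A (c - x, g x - t) \<partial>lborel \<partial>lborel)"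
    by (subst lborel.nn_integral_fst[symmetric]) auto
  also have "\<dots> = (\<integral>\<^sup>+x. \<integral>\<^sup>+t. indicator A (c - x, t) \<partial>lborel \<partial>lborel)"
    by (intro nn_integral_cong nn_integral_reflect) measurable
  also have "\<dots> = (\<integral>\<^sup>+x. \<integral>\<^sup>+t. indicator A (x, t) \<partial>lborel \<partial>lborel)"
    by (rule nn_integral_reflect) measurable
  also have "\<dots> = (\<integral>\<^sup>+z. indicator A z \<partial>(lborel \<Otimes>\<^sub>M lborel))"
    by (subst lborel.nn_integral_fst[symmetric]) auto
  also have "\<dots> = emeasure lborel A"
    using A by (simp add: lborel_prod borel_prod)
  finally show "emeasure (distr lborel borel (\<lambda>z. (c - fst z, g (fst z) - snd z))) A
    = emeasure lborel A" .
qed simp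

lemma heis_conv_fun_distr:
  fixes K f :: "'n::finite heis \<Rightarrow> complex"
  assumes [measurable]: "K \<in> borel_measurable borel" "f \<in> borel_measurable borel"
  shows "heis_conv a f (fun_distr K) p
       = (LINT q|lborel. K (heis_mult a (heis_inv q) p) * f q)"
proof -
  define T where "T = (\<lambda>q::'n heis. heis_mult a (heis_inv q) p)"
  define g where "g = (\<lambda>x. snd p + 2 * a * (x \<bullet> sympl_J (fst p)))"
  have T_eq: "T = (\<lambda>z. (fst p - fst z, g (fst z) - snd z))"
    by (auto simp: T_def g_def heis_mult_def heis_inv_def fun_eq_iff)
  have [measurable]: "g \<in> borel_measurable borel"
    unfolding g_def by measurable
  have distr: "distr lborel borel T = lborel"
    unfolding T_eq by (rule lborel_distr_shear) measurable
  have J: "sympl_J (x - y) = sympl_J x - sympl_J y" "x \<bullet> sympl_J y = - (y \<bullet> sympl_J x)"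
    for x y :: "(real^'n) \<times> (real^'n)"
    by (auto simp: sympl_J_def inner_prod_def inner_commute)
  have inv: "heis_mult a p (heis_inv (T q)) = q" for q
    using J(2)[of "fst p" "fst q"]
    by (simp add: T_def heis_mult_def heis_inv_def prod_eq_iff J(1) inner_diff_right algebra_simps)
  have [measurable]: "T \<in> borel_measurable borel"
    unfolding T_eq by (rule borel_measurable_shear) measurable
  have [measurable]: "(\<lambda>z. heis_mult a p (heis_inv z)) \<in> borel_measurable borel"
    unfolding heis_mult_def heis_inv_def sympl_J_def
    by (intro borel_measurable_continuous_onI continuous_intros)
  have "heis_conv a f (fun_distr K) p
      = (LINT z|distr lborel borel T. K z * f (heis_mult a p (heis_inv z)))"
    by (simp add: heis_conv_def fun_distr_def distr)
  also have "\<dots> = (LINT q|lborel. K (T q) * f (heis_mult a p (heis_inv (T q))))"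
    by (subst integral_distr) auto
  finally show ?thesis by (simp add: inv) (simp add: T_def)
qed

definition sing_op ::
    "real \<Rightarrow> ('n::finite heis \<Rightarrow> real) \<Rightarrow> (real \<Rightarrow> complex) \<Rightarrow> (real \<Rightarrow> complex)
      \<Rightarrow> real \<Rightarrow> real \<Rightarrow> ('n heis \<Rightarrow> complex) \<Rightarrow> ('n heis \<Rightarrow> complex)" where
  "sing_op a \<rho> \<psi> \<theta> \<alpha> \<beta> f = heis_conv a f (kernel_distr \<rho> \<psi> \<theta> \<alpha> \<beta>)"


section \<open>Bounded operators on \<open>L\<^sup>2\<close>\<close>

text \<open>
  Elements of \<open>L\<^sup>2\<close> are represented by functions, and identities between them hold almost
  everywhere. Additivity together with the norm bound makes an operator respect equality almost
  everywhere.
\<close>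

definition L2 :: "('a::euclidean_space \<Rightarrow> complex) set" where
  "L2 = {f. f \<in> borel_measurable lborel \<and> integrable lborel (\<lambda>p. (cmod (f p))\<^sup>2)}"

definition L2_norm :: "('a::euclidean_space \<Rightarrow> complex) \<Rightarrow> real" where
  "L2_norm f = sqrt (LINT p|lborel. (cmod (f p))\<^sup>2)"

definition bounded_L2_operator ::
    "(('a::euclidean_space \<Rightarrow> complex) \<Rightarrow> ('a \<Rightarrow> complex)) \<Rightarrow> bool" where
  "bounded_L2_operator S \<longleftrightarrow>
     (\<forall>f\<in>L2. S f \<in> L2) \<and>
     (\<forall>f\<in>L2. \<forall>g\<in>L2. AE p in lborel. S (\<lambda>q. f q + g q) p = S f p + S g p) \<and>
     (\<forall>c. \<forall>f\<in>L2. AE p in lborel. S (\<lambda>q. c * f q) p = c * S f p) \<and>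
     (\<exists>C. \<forall>f\<in>L2. L2_norm (S f) \<le> C * L2_norm f)"

definition extends_to_bounded_L2_operator ::
    "(('a::euclidean_space \<Rightarrow> complex) \<Rightarrow> ('a \<Rightarrow> complex)) \<Rightarrow> bool" where
  "extends_to_bounded_L2_operator T \<longleftrightarrow>
     (\<exists>S. bounded_L2_operator S \<and>
        (\<forall>f. test_function f \<longrightarrow> (AE p in lborel. S f p = T f p)))"

end

theory Submission
  imports Defs
begin

text \<open>
  The kernel is split dyadically and the pieces \<open>T\<^sub>j f = f * K\<^sub>j\<close> are shown to be almost orthogonal.
  After a parabolic rescaling, \<open>T\<^sub>j\<^sup>* T\<^sub>k\<close> with \<open>k \<le> j\<close> has as its kernel, up to a power of \<open>2\<close>,
  an oscillatory integral over a fixed annulus in \<open>z\<close> with parameter \<open>\<Lambda> = 2 powr (j * \<beta>)\<close> and phase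
  \<open>\<mu> powr \<beta> * \<Phi> (u \<cdot> \<delta>\<^sub>\<mu> z) - \<Phi> z\<close>, where \<open>\<Phi> = \<rho> powr (- \<beta>)\<close> and \<open>\<mu> = 2 powr (k - j)\<close>.

  For \<open>j = k\<close>, left translations commute with the left-invariant vector fields, so the gradient of the
  phase in that frame is \<open>V (u \<cdot> z) - V z\<close>, where \<open>V\<close> is the gradient of \<open>\<Phi>\<close>. The hypothesis
  \<open>a\<^sup>2 \<le> b\<^sup>2\<close> makes \<open>V\<close> an injective immersion; hence the gradient is at least a multiple of
  \<open>\<bar>u\<bar>\<close>, and integration by parts gives decay in \<open>\<Lambda> * \<bar>u\<bar>\<close>. Integrating in \<open>u\<close> gains
  \<open>\<Lambda> powr (- (2 * n + 1))\<close>, which beats the loss \<open>2 powr (2 * j * \<alpha>)\<close> exactly when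
  \<open>\<alpha> \<le> (n + 1/2) * \<beta>\<close>. For \<open>j - k\<close> large the first term of the phase is a small perturbation, the
  gradient is bounded below, and the decay in \<open>\<Lambda>\<close> is of arbitrary order. The finitely many remaining
  diagonals are controlled by the main one through the Cauchy-Schwarz inequality.
\<close>

section \<open>Smooth functions on open sets\<close>

text \<open>The diagonal phase vanishes identically at \<open>u = 0\<close>, so its gradient has no
  fixed lower bound. What saves the integration by parts is that all \<open>z\<close>-derivatives
  are O(\<open>norm u\<close>) as well: the phase is nondegenerate relative to its own size.
  Nonstationary phase is therefore proved for families with a scale \<open>r p\<close>, with decay
  in \<open>l * r p\<close>. Uniformity in the scales and in \<open>u\<close> comes from treating
  all parameters as extra coordinates: phase and amplitude are jointly smooth, also at the limiting
  parameter value 0, and the relevant set of parameters is compact. The horizontal part of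
  \<open>frame_grad\<close> is a scaled rotation of the horizontal coordinate. Its norm and the
  central component are thus the only data that matter, and injectivity of the map and of its
  derivative become inequalities in a few real variables; \<open>a\<^sup>2 \<le> b\<^sup>2\<close>
  enters there, as \<open>4 * a\<^sup>2 / b\<^sup>2 \<le> 4\<close>. At the endpoint the bound for a
  single piece has no decay in \<open>j\<close>, so the triangle inequality cannot sum the pieces
  and the interaction of different scales has to be used.\<close>

abbreviation dderiv :: "('a::real_normed_vector \<Rightarrow> 'b::real_normed_vector) \<Rightarrow> 'a \<Rightarrow> 'a \<Rightarrow> 'b" where
  "dderiv f v x \<equiv> frechet_derivative f (at x) v"

text \<open>The version of \<open>Ck\<close> relative to an open set and for values in any normed
  space: the phase is smooth only away from the origin, and \<open>frame_grad\<close> is vector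
  valued.\<close>

primrec Ck_on :: "nat \<Rightarrow> 'a::real_normed_vector set \<Rightarrow> ('a \<Rightarrow> 'b::real_normed_vector) \<Rightarrow> bool" where
  "Ck_on 0 S f \<longleftrightarrow> continuous_on S f"
| "Ck_on (Suc k) S f \<longleftrightarrow> (\<forall>x\<in>S. f differentiable (at x)) \<and> (\<forall>v. Ck_on k S (dderiv f v))"

definition smooth_on :: "'a::real_normed_vector set \<Rightarrow> ('a \<Rightarrow> 'b::real_normed_vector) \<Rightarrow> bool" where
  "smooth_on S f \<longleftrightarrow> (\<forall>k. Ck_on k S f)"

lemma frechet_derivative_cong_open:
  assumes "open S" "x \<in> S" "\<And>y. y \<in> S \<Longrightarrow> f y = g y"
  shows "frechet_derivative f (at x) = frechet_derivative g (at x)"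
proof -
  have "(f has_derivative D) (at x) \<longleftrightarrow> (g has_derivative D) (at x)" for D
    using has_derivative_transform_within_open[OF _ assms(1,2), of f D UNIV g]
      has_derivative_transform_within_open[OF _ assms(1,2), of g D UNIV f] assms(3) by auto
  then show ?thesis unfolding frechet_derivative_def by simp
qed

lemma differentiable_cong_open:
  assumes "open S" "x \<in> S" "\<And>y. y \<in> S \<Longrightarrow> f y = g y" "f differentiable (at x)"
  shows "g differentiable (at x)"
  using has_derivative_transform_within_open[OF _ assms(1,2), of f _ UNIV g] assms(3,4)
  unfolding differentiable_def by metis

lemma Ck_on_cong:
  assumes "open S" "\<And>x. x \<in> S \<Longrightarrow> f x = g x"
  shows "Ck_on k S f \<longleftrightarrow> Ck_on k S g"
  using assms(2)
proof (induction k arbitrary: f g)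
  case 0
  then show ?case by (simp cong: continuous_on_cong)
next
  case (Suc k)
  have "dderiv f v x = dderiv g v x" if "x \<in> S" for x v
    using frechet_derivative_cong_open[OF assms(1) that Suc.prems] by simp
  then have "Ck_on k S (dderiv f v) \<longleftrightarrow> Ck_on k S (dderiv g v)" for v
    by (rule Suc.IH)
  moreover have "(\<forall>x\<in>S. f differentiable (at x)) \<longleftrightarrow> (\<forall>x\<in>S. g differentiable (at x))"
    using differentiable_cong_open[OF assms(1), of _ f g] differentiable_cong_open[OF assms(1), of _ g f]
      Suc.prems by auto
  ultimately show ?case by simp
qed

lemma Ck_on_Suc_imp: "Ck_on (Suc k) S f \<Longrightarrow> Ck_on k S f"
proof (induction k arbitrary: f)
  case 0
  then show ?case
    by (auto intro!: continuous_at_imp_continuous_on differentiable_imp_continuous_within)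
next
  case (Suc k)
  then show ?case by (metis Ck_on.simps(2))
qed

lemma Ck_on_const: "Ck_on k S (\<lambda>x. c)"
  by (induction k arbitrary: c) (auto simp: frechet_derivative_const)

lemma has_dderiv: "f differentiable (at x) \<Longrightarrow> (f has_derivative (\<lambda>v. dderiv f v x)) (at x)"
  using frechet_derivative_works by auto

lemma dderiv_eq: "(f has_derivative D) (at x) \<Longrightarrow> dderiv f v x = D v"
  using frechet_derivative_at by metis

lemma Ck_on_bounded_linear:
  assumes "open S" "bounded_linear L" "Ck_on k S f"
  shows "Ck_on k S (\<lambda>x. L (f x))"
  using assms(3)
proof (induction k arbitrary: f)
  case 0
  then show ?case using assms by (auto intro: bounded_linear.continuous_on)
next
  case (Suc k)
  have d: "((\<lambda>x. L (f x)) has_derivative (\<lambda>v. L (dderiv f v x))) (at x)" if "x \<in> S" for x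
    using Suc.prems that by (auto intro!: bounded_linear.has_derivative[OF assms(2)] has_dderiv)
  have "Ck_on k S (dderiv (\<lambda>x. L (f x)) v)" for v
    using Suc by (subst Ck_on_cong[OF assms(1) dderiv_eq[OF d]]) auto
  then show ?case using d by (auto simp: differentiable_def)
qed

lemma Ck_on_add:
  assumes "open S" "Ck_on k S f" "Ck_on k S g"
  shows "Ck_on k S (\<lambda>x. f x + g x)"
  using assms(2,3)
proof (induction k arbitrary: f g)
  case 0
  then show ?case by (auto intro: continuous_intros)
next
  case (Suc k)
  have d: "((\<lambda>x. f x + g x) has_derivative (\<lambda>v. dderiv f v x + dderiv g v x)) (at x)" if "x \<in> S" for x
    using Suc.prems that by (auto intro!: has_derivative_add has_dderiv)
  have "Ck_on k S (dderiv (\<lambda>x. f x + g x) v)" for v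
    using Suc by (subst Ck_on_cong[OF assms(1) dderiv_eq[OF d]]) auto
  then show ?case using d by (auto simp: differentiable_def)
qed

lemma Ck_on_sum:
  assumes "open S" "\<And>i. i \<in> I \<Longrightarrow> Ck_on k S (f i)"
  shows "Ck_on k S (\<lambda>x. \<Sum>i\<in>I. f i x)"
  using assms(2)
  by (induction I rule: infinite_finite_induct) (auto intro!: Ck_on_const Ck_on_add[OF assms(1)])

lemma Ck_on_bilinear:
  assumes "open S" "bounded_bilinear B" "Ck_on k S f" "Ck_on k S g"
  shows "Ck_on k S (\<lambda>x. B (f x) (g x))"
  using assms(3,4)
proof (induction k arbitrary: f g)
  case 0
  then show ?case using bounded_bilinear.continuous_on[OF assms(2)] by auto
next
  case (Suc k)
  have d: "((\<lambda>x. B (f x) (g x)) has_derivative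
      (\<lambda>v. B (f x) (dderiv g v x) + B (dderiv f v x) (g x))) (at x)" if "x \<in> S" for x
    using Suc.prems that by (auto intro!: bounded_bilinear.FDERIV[OF assms(2)] has_dderiv)
  have "Ck_on k S (dderiv (\<lambda>x. B (f x) (g x)) v)" for v
    using Suc.prems Ck_on_Suc_imp[OF Suc.prems(1)] Ck_on_Suc_imp[OF Suc.prems(2)]
    by (subst Ck_on_cong[OF assms(1) dderiv_eq[OF d]]) (auto intro!: Suc.IH Ck_on_add[OF assms(1)])
  then show ?case using d by (auto simp: differentiable_def)
qed

text \<open>The chain rule in coordinates. The direction \<open>dderiv g v x\<close> moves with
  \<open>x\<close>, whereas \<open>Ck_on\<close> speaks of fixed directions; expanding it in the
  basis turns the derivative into a sum of products to which the induction in
  \<open>Ck_on_compose\<close> applies.\<close>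

lemma dderiv_compose:
  fixes g :: "'a::real_normed_vector \<Rightarrow> 'b::euclidean_space"
  assumes "f differentiable (at (g x))" "g differentiable (at x)"
  shows "((\<lambda>x. f (g x)) has_derivative (\<lambda>v. \<Sum>b\<in>Basis. (dderiv g v x \<bullet> b) *\<^sub>R dderiv f b (g x))) (at x)"
proof -
  have f: "(f has_derivative (\<lambda>v. dderiv f v (g x))) (at (g x))" using assms has_dderiv by auto
  have "dderiv f w (g x) = (\<Sum>b\<in>Basis. (w \<bullet> b) *\<^sub>R dderiv f b (g x))" for w
  proof -
    have "linear (\<lambda>v. dderiv f v (g x))" using f has_derivative_linear by blast
    then have "dderiv f (\<Sum>b\<in>Basis. (w \<bullet> b) *\<^sub>R b) (g x) = (\<Sum>b\<in>Basis. (w \<bullet> b) *\<^sub>R dderiv f b (g x))"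
      by (simp add: linear_sum linear_scale)
    then show ?thesis by (simp add: euclidean_representation)
  qed
  then have "(\<lambda>v. dderiv f (dderiv g v x) (g x)) = (\<lambda>v. \<Sum>b\<in>Basis. (dderiv g v x \<bullet> b) *\<^sub>R dderiv f b (g x))"
    by (rule ext)
  with has_derivative_compose[OF has_dderiv[OF assms(2)] f] show ?thesis
    by metis
qed

lemma Ck_on_compose:
  fixes g :: "'a::real_normed_vector \<Rightarrow> 'b::euclidean_space"
  assumes "open S" "open T" "Ck_on k T f" "Ck_on k S g" "g ` S \<subseteq> T"
  shows "Ck_on k S (\<lambda>x. f (g x))"
  using assms(3)
proof (insert assms(4), induction k arbitrary: f)
  case 0
  then show ?case using continuous_on_compose2[OF _ _ assms(5)] by auto
next
  case (Suc k)
  have d: "((\<lambda>x. f (g x)) has_derivative (\<lambda>v. \<Sum>b\<in>Basis. (dderiv g v x \<bullet> b) *\<^sub>R dderiv f b (g x))) (at x)"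
    if "x \<in> S" for x
    using Suc.prems that assms(5) by (intro dderiv_compose) auto
  have "Ck_on k S (\<lambda>x. dderiv f b (g x))" for b
    using Suc.prems Ck_on_Suc_imp[OF Suc.prems(1)] by (intro Suc.IH) auto
  moreover have "Ck_on k S (\<lambda>x. dderiv g v x \<bullet> b)" for v b
    by (rule Ck_on_bounded_linear[OF assms(1) bounded_linear_inner_left]) (use Suc.prems in auto)
  ultimately have "Ck_on k S (\<lambda>x. \<Sum>b\<in>Basis. (dderiv g v x \<bullet> b) *\<^sub>R dderiv f b (g x))" for v
    by (auto intro!: Ck_on_sum[OF assms(1)] Ck_on_bilinear[OF assms(1) bounded_bilinear_scaleR])
  then have "Ck_on k S (dderiv (\<lambda>x. f (g x)) v)" for v
    by (subst Ck_on_cong[OF assms(1) dderiv_eq[OF d]])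
  then show ?case using d by (auto simp: differentiable_def)
qed

lemma Ck_iff_Ck_on: "Ck k f \<longleftrightarrow> Ck_on k UNIV f"
  by (induction k arbitrary: f) auto

lemma smooth_iff_smooth_on: "smooth f \<longleftrightarrow> smooth_on UNIV f"
  by (simp add: smooth_def smooth_on_def Ck_iff_Ck_on)

lemma smooth_on_continuous: "smooth_on S f \<Longrightarrow> continuous_on S f"
  unfolding smooth_on_def by (metis Ck_on.simps(1))

lemma smooth_on_differentiable: "smooth_on S f \<Longrightarrow> x \<in> S \<Longrightarrow> f differentiable (at x)"
  unfolding smooth_on_def by (metis Ck_on.simps(2))

lemma smooth_on_dderiv: "smooth_on S f \<Longrightarrow> smooth_on S (dderiv f v)"
  unfolding smooth_on_def by (metis Ck_on.simps(2))

lemma smooth_on_const: "smooth_on S (\<lambda>x. c)"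
  by (simp add: smooth_on_def Ck_on_const)

lemma smooth_on_bounded_linear:
  assumes "open S" "bounded_linear L" "smooth_on S f"
  shows "smooth_on S (\<lambda>x. L (f x))"
  using Ck_on_bounded_linear[OF assms(1,2)] assms(3) by (simp add: smooth_on_def)

lemma smooth_on_id: "smooth_on S (\<lambda>x. x)"
proof -
  have "Ck_on k S (\<lambda>x. x)" for k
    by (cases k) (auto simp: frechet_derivative_ident Ck_on_const)
  then show ?thesis by (simp add: smooth_on_def)
qed

lemma smooth_on_add:
  "open S \<Longrightarrow> smooth_on S f \<Longrightarrow> smooth_on S g \<Longrightarrow> smooth_on S (\<lambda>x. f x + g x)"
  by (auto simp: smooth_on_def intro: Ck_on_add)

lemma smooth_on_bilinear:
  assumes "open S" "bounded_bilinear B" "smooth_on S f" "smooth_on S g"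
  shows "smooth_on S (\<lambda>x. B (f x) (g x))"
  using Ck_on_bilinear[OF assms(1,2)] assms(3,4) by (simp add: smooth_on_def)

lemmas smooth_on_mult = smooth_on_bilinear[OF _ bounded_bilinear_mult]
lemmas smooth_on_scaleR = smooth_on_bilinear[OF _ bounded_bilinear_scaleR]
lemmas smooth_on_inner = smooth_on_bilinear[OF _ bounded_bilinear_inner]

lemma smooth_on_uminus: "open S \<Longrightarrow> smooth_on S f \<Longrightarrow> smooth_on S (\<lambda>x. - f x)"
  by (rule smooth_on_bounded_linear[OF _ bounded_linear_minus[OF bounded_linear_ident]])

lemma smooth_on_diff:
  "open S \<Longrightarrow> smooth_on S f \<Longrightarrow> smooth_on S g \<Longrightarrow> smooth_on S (\<lambda>x. f x - g x)"
  using smooth_on_add[OF _ _ smooth_on_uminus, of S f g] by simp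

lemma smooth_on_power:
  fixes f :: "_ \<Rightarrow> 'b::real_normed_algebra_1"
  shows "open S \<Longrightarrow> smooth_on S f \<Longrightarrow> smooth_on S (\<lambda>x. f x ^ n)"
  by (induction n) (auto intro: smooth_on_const smooth_on_mult)

lemma smooth_on_Pair:
  assumes "open S" "smooth_on S f" "smooth_on S g"
  shows "smooth_on S (\<lambda>x. (f x, g x))"
proof -
  have "bounded_linear (\<lambda>x::'b. (x, 0::'c))" "bounded_linear (\<lambda>x::'c. (0::'b, x))"
    by (auto intro!: bounded_linear_Pair bounded_linear_ident bounded_linear_zero)
  from smooth_on_add[OF assms(1) smooth_on_bounded_linear[OF assms(1) this(1) assms(2)]
      smooth_on_bounded_linear[OF assms(1) this(2) assms(3)]]
  show ?thesis by simp
qed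

lemmas smooth_on_fst = smooth_on_bounded_linear[OF _ bounded_linear_fst]
lemmas smooth_on_snd = smooth_on_bounded_linear[OF _ bounded_linear_snd]
lemmas smooth_on_of_real = smooth_on_bounded_linear[OF _ bounded_linear_of_real]
lemmas smooth_on_cnj = smooth_on_bounded_linear[OF _ bounded_linear_cnj]

lemma smooth_on_compose:
  fixes g :: "'a::real_normed_vector \<Rightarrow> 'b::euclidean_space"
  assumes "open S" "open T" "smooth_on T f" "smooth_on S g" "g ` S \<subseteq> T"
  shows "smooth_on S (\<lambda>x. f (g x))"
  using Ck_on_compose[OF assms(1,2) _ _ assms(5), of _ f] assms(3,4) by (simp add: smooth_on_def)

lemma smooth_on_powr_real: "smooth_on {0<..} (\<lambda>x::real. x powr c)"
proof -
  have "Ck_on k {0<..} (\<lambda>x::real. x powr c)" for k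
  proof (induction k arbitrary: c)
    case 0
    then show ?case by (auto intro!: continuous_intros)
  next
    case (Suc k)
    have d: "((\<lambda>x. x powr c) has_derivative (\<lambda>v. (c * x powr (c - 1)) * v)) (at x)" if "x > 0" for x :: real
      using has_real_derivative_powr[OF that, of c] by (simp add: has_field_derivative_def)
    have "Ck_on k {0<..} (dderiv (\<lambda>x::real. x powr c) v)" for v
    proof -
      have "Ck_on k {0<..} (\<lambda>x::real. c * x powr (c - 1) * v)"
        by (intro Ck_on_bilinear[OF _ bounded_bilinear_mult] Ck_on_const Suc.IH) auto
      then show ?thesis
        by (subst Ck_on_cong[OF open_greaterThan dderiv_eq[OF d]]) auto
    qed
    then show ?case using d by (auto simp: differentiable_def)
  qed
  then show ?thesis by (simp add: smooth_on_def)
qed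

lemma smooth_on_powr:
  fixes f :: "_ \<Rightarrow> real"
  assumes "open S" "smooth_on S f" "\<And>x. x \<in> S \<Longrightarrow> f x > 0"
  shows "smooth_on S (\<lambda>x. f x powr c)"
  by (rule smooth_on_compose[OF assms(1) _ smooth_on_powr_real assms(2)]) (use assms in auto)

section \<open>Smoothness of the group operations\<close>

lemma bounded_linear_sympl_J: "bounded_linear sympl_J"
  unfolding sympl_J_def
  by (intro bounded_linear_Pair bounded_linear_snd bounded_linear_minus bounded_linear_fst)

lemmas smooth_on_sympl_J = smooth_on_bounded_linear[OF _ bounded_linear_sympl_J]

lemma smooth_on_heis_mult:
  assumes "open S" "smooth_on S f" "smooth_on S g"
  shows "smooth_on S (\<lambda>x. heis_mult a (f x) (g x))"
  unfolding heis_mult_def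
  by (intro smooth_on_Pair smooth_on_add smooth_on_diff smooth_on_mult smooth_on_inner
      smooth_on_const smooth_on_sympl_J smooth_on_fst smooth_on_snd assms)

lemma smooth_on_heis_inv:
  assumes "open S" "smooth_on S f"
  shows "smooth_on S (\<lambda>x. heis_inv (f x))"
  unfolding heis_inv_def
  by (intro smooth_on_Pair smooth_on_uminus smooth_on_fst smooth_on_snd assms)

section \<open>First-order estimates, compactness and integration by parts\<close>

lemma dderiv_representation:
  fixes f :: "'a::euclidean_space \<Rightarrow> 'b::real_normed_vector"
  assumes "f differentiable (at x)"
  shows "dderiv f v x = (\<Sum>b\<in>Basis. (v \<bullet> b) *\<^sub>R dderiv f b x)"
proof -
  have "linear (\<lambda>v. dderiv f v x)"
    using has_derivative_linear[OF has_dderiv[OF assms]] .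
  then have "dderiv f (\<Sum>b\<in>Basis. (v \<bullet> b) *\<^sub>R b) x = (\<Sum>b\<in>Basis. (v \<bullet> b) *\<^sub>R dderiv f b x)"
    by (simp add: linear_sum linear_scale)
  then show ?thesis by (simp add: euclidean_representation)
qed

text \<open>The mean value inequality for \<open>f\<close> minus its linear part at
  \<open>x\<close>, whose derivative is small near \<open>x\<close> by continuity. Both points vary,
  as a comparison of \<open>f y\<close> with \<open>f z\<close> close to the diagonal
  requires.\<close>

lemma strict_differentiability:
  fixes f :: "'a::euclidean_space \<Rightarrow> 'b::real_normed_vector"
  assumes "open S" "smooth_on S f" "x \<in> S" "\<eta> > 0"
  obtains e where "e > 0" "ball x e \<subseteq> S"
    "\<And>y z. y \<in> ball x e \<Longrightarrow> z \<in> ball x e \<Longrightarrow>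
        norm (f y - f z - dderiv f (y - z) x) \<le> \<eta> * norm (y - z)"
proof -
  define B where "B = (Basis :: 'a set)"
  \<comment> \<open>Dominates the operator norm of the change of the derivative between
    \<open>x\<close> and \<open>y\<close>, and is visibly continuous.\<close>
  define E where "E y = (\<Sum>b\<in>B. norm (dderiv f b y - dderiv f b x))" for y
  have "continuous_on S E"
    unfolding E_def using assms(2)
    by (intro continuous_intros) (auto intro: smooth_on_continuous smooth_on_dderiv)
  then have "open (S \<inter> E -` {..<\<eta>})"
    using assms(1) by (intro continuous_open_preimage) auto
  moreover have "x \<in> S \<inter> E -` {..<\<eta>}" using assms by (simp add: E_def)
  ultimately obtain e where e: "e > 0" "ball x e \<subseteq> S \<inter> E -` {..<\<eta>}"
    using openE by blast
  show ?thesis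
  proof
    show "e > 0" "ball x e \<subseteq> S" using e by auto
    fix y z assume yz: "y \<in> ball x e" "z \<in> ball x e"
    have lin: "bounded_linear (\<lambda>v. dderiv f v x)"
      using has_derivative_bounded_linear[OF has_dderiv[OF smooth_on_differentiable]] assms by blast
    define G where "G y = f y - dderiv f y x" for y
    have dG: "(G has_derivative (\<lambda>v. dderiv f v w - dderiv f v x)) (at w within ball x e)"
      if "w \<in> ball x e" for w
      unfolding G_def using that e assms(2)
      by (intro has_derivative_diff bounded_linear_imp_has_derivative[OF lin] has_derivative_at_withinI[OF has_dderiv])
        (auto intro: smooth_on_differentiable)
    have "norm (G y - G z) \<le> \<eta> * norm (y - z)"
    proof (rule differentiable_bound[OF convex_ball dG _ yz])
      fix w assume w: "w \<in> ball x e"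
      show "onorm (\<lambda>v. dderiv f v w - dderiv f v x) \<le> \<eta>"
      proof (rule onorm_le)
        fix v
        have "dderiv f v w - dderiv f v x = (\<Sum>b\<in>B. (v \<bullet> b) *\<^sub>R (dderiv f b w - dderiv f b x))"
          using w e assms unfolding B_def
          by (subst (1 2) dderiv_representation)
            (auto intro: smooth_on_differentiable simp: sum_subtractf scaleR_diff_right)
        also have "norm \<dots> \<le> (\<Sum>b\<in>B. norm v * norm (dderiv f b w - dderiv f b x))"
          by (intro sum_norm_le) (auto simp: B_def Basis_le_norm intro!: mult_right_mono)
        also have "\<dots> = E w * norm v" by (simp add: E_def sum_distrib_left mult.commute)
        also have "\<dots> \<le> \<eta> * norm v" using w e by (intro mult_right_mono) auto
        finally show "norm (dderiv f v w - dderiv f v x) \<le> \<eta> * norm v" .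
      qed
    qed
    moreover have "G y - G z = f y - f z - dderiv f (y - z) x"
      using linear_diff[OF bounded_linear.linear[OF lin], of y z] by (simp add: G_def)
    ultimately show "norm (f y - f z - dderiv f (y - z) x) \<le> \<eta> * norm (y - z)" by simp
  qed
qed

lemma smooth_on_locally_Lipschitz:
  fixes f :: "'a::euclidean_space \<Rightarrow> 'b::real_normed_vector"
  assumes "open S" "smooth_on S f" "x \<in> S"
  obtains e L where "e > 0" "ball x e \<subseteq> S" "L \<ge> 0"
    "\<And>y z. y \<in> ball x e \<Longrightarrow> z \<in> ball x e \<Longrightarrow> norm (f y - f z) \<le> L * norm (y - z)"
proof -
  obtain e where e: "e > 0" "ball x e \<subseteq> S"
    "\<And>y z. y \<in> ball x e \<Longrightarrow> z \<in> ball x e \<Longrightarrow>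
        norm (f y - f z - dderiv f (y - z) x) \<le> 1 * norm (y - z)"
    using strict_differentiability[OF assms zero_less_one] by metis
  have lin: "bounded_linear (\<lambda>v. dderiv f v x)"
    using has_derivative_bounded_linear[OF has_dderiv[OF smooth_on_differentiable]] assms by blast
  show ?thesis
  proof
    show "e > 0" "ball x e \<subseteq> S" by fact+
    show "onorm (\<lambda>v. dderiv f v x) + 1 \<ge> 0" using onorm_pos_le[OF lin] by simp
    fix y z assume "y \<in> ball x e" "z \<in> ball x e"
    then show "norm (f y - f z) \<le> (onorm (\<lambda>v. dderiv f v x) + 1) * norm (y - z)"
      using e(3)[of y z] onorm[OF lin, of "y - z"] norm_triangle_ineq2[of "f y - f z" "dderiv f (y - z) x"]
      by (simp add: algebra_simps)
  qed
qed

text \<open>Passage to a finite subcover. The weight \<open>w\<close> may vanish on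
  \<open>C\<close>, so maximising \<open>f / w\<close> is not an option; this happens on the
  diagonal and at \<open>u = 0\<close>, where the lemma is applied.\<close>

lemma compact_local_bound:
  fixes f w :: "'a::topological_space \<Rightarrow> real"
  assumes "compact C" "\<And>x. x \<in> C \<Longrightarrow> w x \<ge> 0"
    and loc: "\<And>x. x \<in> C \<Longrightarrow> \<exists>U B. open U \<and> x \<in> U \<and> (\<forall>y\<in>U \<inter> C. f y \<le> B * w y)"
  obtains B where "B > 0" "\<And>x. x \<in> C \<Longrightarrow> f x \<le> B * w x"
proof -
  obtain U B where UB: "\<And>x. x \<in> C \<Longrightarrow> open (U x) \<and> x \<in> U x \<and> (\<forall>y\<in>U x \<inter> C. f y \<le> B x * w y)"
    using loc by metis
  have "C \<subseteq> (\<Union>x\<in>C. U x)" using UB by auto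
  then obtain D where D: "D \<subseteq> C" "finite D" "C \<subseteq> (\<Union>x\<in>D. U x)"
    using compactE_image[OF assms(1), of C U] UB by metis
  show ?thesis
  proof
    show "1 + (\<Sum>x\<in>D. \<bar>B x\<bar>) > 0" by (simp add: add_pos_nonneg sum_nonneg)
    fix y assume y: "y \<in> C"
    then obtain x where x: "x \<in> D" "y \<in> U x" using D by auto
    then have "f y \<le> B x * w y" using UB D y by auto
    also have "\<dots> \<le> (1 + (\<Sum>x\<in>D. \<bar>B x\<bar>)) * w y"
      using assms(2)[OF y] member_le_sum[OF x(1), of "\<lambda>x. \<bar>B x\<bar>"] D by (intro mult_right_mono) auto
    finally show "f y \<le> (1 + (\<Sum>x\<in>D. \<bar>B x\<bar>)) * w y" .
  qed
qed

text \<open>The difference quotients of \<open>y\<close> have integral zero by translation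
  invariance, and they converge dominatedly to \<open>y'\<close>. Continuity of \<open>y'\<close> is
  asked on \<open>K\<close> only, since the functions inserted later are defined by cases on a
  compact set.\<close>

lemma integral_dderiv_eq_0:
  fixes y :: "'a::euclidean_space \<Rightarrow> complex"
  assumes K: "compact K"
    and d: "\<And>z. \<exists>D. (y has_derivative D) (at z) \<and> D b = y' z"
    and y0: "\<And>z. z \<notin> K \<Longrightarrow> y z = 0" "\<And>z. z \<notin> K \<Longrightarrow> y' z = 0"
    and cont: "continuous_on K y'"
  shows "(LINT z|lborel. y' z) = 0"
proof -
  have cy: "continuous_on UNIV y"
    using d has_derivative_continuous by (metis continuous_at_imp_continuous_on)
  then have [measurable]: "y \<in> borel_measurable borel"
    by (simp add: borel_measurable_continuous_onI)
  have iy: "integrable lborel y"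
    using borel_integrable_compact[OF K continuous_on_subset[OF cy]]
    by (rule Bochner_Integration.integrable_cong[THEN iffD1, rotated -1]) (auto simp: y0 indicator_def)
  have int_y': "integrable lborel y'"
    using borel_integrable_compact[OF K cont]
    by (rule Bochner_Integration.integrable_cong[THEN iffD1, rotated -1]) (auto simp: y0 indicator_def)
  obtain M where M: "M \<ge> 0" "\<And>z. norm (y' z) \<le> M"
  proof -
    have "bounded (y' ` K)" by (intro compact_imp_bounded compact_continuous_image cont K)
    then obtain M where "M > 0" "\<And>z. z \<in> K \<Longrightarrow> norm (y' z) \<le> M" unfolding bounded_pos by auto
    then have "norm (y' z) \<le> M" for z using y0(2)[of z] by (cases "z \<in> K") auto
    with \<open>M > 0\<close> show ?thesis by (intro that[of M]) auto
  qed
  have line: "((\<lambda>t. y (z + t *\<^sub>R b)) has_derivative (\<lambda>h. h *\<^sub>R y' (z + t *\<^sub>R b))) (at t)" for z t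
  proof -
    obtain D where D: "(y has_derivative D) (at (z + t *\<^sub>R b))" "D b = y' (z + t *\<^sub>R b)" using d by blast
    have "((\<lambda>t. z + t *\<^sub>R b) has_derivative (\<lambda>h. h *\<^sub>R b)) (at t)"
      by (auto intro!: derivative_eq_intros)
    from has_derivative_compose[OF this D(1)]
    show ?thesis using linear_scale[OF has_derivative_linear[OF D(1)]] D(2) by simp
  qed
  have lip: "norm (y (z + t *\<^sub>R b) - y z) \<le> M * t" if "t \<ge> 0" for z t
  proof -
    have "norm (y (z + t *\<^sub>R b) - y (z + 0 *\<^sub>R b)) \<le> M * norm (t - 0)"
      by (rule differentiable_bound[where S = UNIV and f = "\<lambda>t. y (z + t *\<^sub>R b)"
            and f' = "\<lambda>t h. h *\<^sub>R y' (z + t *\<^sub>R b)"])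
        (use line M in \<open>auto intro!: onorm_le simp: mult.commute[of M] mult_left_mono\<close>)
    then show ?thesis using that by simp
  qed
  define s where "s n z = of_nat (Suc n) * (y (z + (1 / Suc n) *\<^sub>R b) - y z)" for n z
  have transl: "(LINT z|lborel. y (z + c)) = (LINT z|lborel. y z)"
    "integrable lborel (\<lambda>z. y (z + c))" for c
  proof -
    have e: "(LINT z|distr lborel borel ((+) c). y z) = (LINT z|lborel. y (c + z))"
      by (rule integral_distr) auto
    have "integrable (distr lborel borel ((+) c)) y \<longleftrightarrow> integrable lborel (\<lambda>z. y (c + z))"
      by (rule integrable_distr_eq) auto
    with e iy show "(LINT z|lborel. y (z + c)) = (LINT z|lborel. y z)"
      "integrable lborel (\<lambda>z. y (z + c))" by (simp_all add: lborel_distr_plus add.commute)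
  qed
  have s0: "(LINT z|lborel. s n z) = 0" for n
    unfolding s_def using transl iy by (simp add: Bochner_Integration.integral_diff)
  obtain R where R: "\<And>z. z \<in> K \<Longrightarrow> norm z \<le> R"
    using compact_imp_bounded[OF K] unfolding bounded_iff by auto
  \<comment> \<open>The steps have length at most \<open>norm b\<close>, so every quotient vanishes
    outside this ball; the height is the Lipschitz constant from \<open>lip\<close>.\<close>
  define w where "w z = M * indicator (cball 0 (R + norm b)) z" for z :: 'a
  have "(\<lambda>n. LINT z|lborel. s n z) \<longlonglongrightarrow> (LINT z|lborel. y' z)"
  proof (rule integral_dominated_convergence[where w = w])
    show "y' \<in> borel_measurable lborel" using int_y' by simp
    show "s n \<in> borel_measurable lborel" for n unfolding s_def by simp
    have "emeasure lborel (cball (0::'a) (R + norm b)) < \<infinity>" by (rule emeasure_lborel_cball_finite)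
    then show "integrable lborel w" unfolding w_def by (intro integrable_mult_right) auto
    show "AE z in lborel. (\<lambda>n. s n z) \<longlonglongrightarrow> y' z"
    proof (rule AE_I2)
      fix z
      have "((\<lambda>t. y (z + t *\<^sub>R b)) has_vector_derivative y' z) (at 0)"
        using line[of z 0] by (simp add: has_vector_derivative_def)
      then have "((\<lambda>t. norm (y (z + t *\<^sub>R b) - y z - t *\<^sub>R y' z) / norm t) \<longlongrightarrow> 0) (at 0)"
        unfolding has_vector_derivative_def has_derivative_at by simp
      moreover have "\<forall>\<^sub>F t in at 0. norm (y (z + t *\<^sub>R b) - y z - t *\<^sub>R y' z) / norm t
          = norm ((y (z + t *\<^sub>R b) - y z) /\<^sub>R t - y' z)"
      proof (rule eventually_at_filter[THEN iffD2, OF always_eventually], intro allI impI)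
        fix t :: real assume "t \<noteq> 0"
        then have "(y (z + t *\<^sub>R b) - y z) /\<^sub>R t - y' z = (y (z + t *\<^sub>R b) - y z - t *\<^sub>R y' z) /\<^sub>R t"
          by (simp add: scaleR_diff_right)
        then show "norm (y (z + t *\<^sub>R b) - y z - t *\<^sub>R y' z) / norm t
          = norm ((y (z + t *\<^sub>R b) - y z) /\<^sub>R t - y' z)" by (simp add: divide_inverse mult.commute)
      qed
      ultimately have "((\<lambda>t. norm ((y (z + t *\<^sub>R b) - y z) /\<^sub>R t - y' z)) \<longlongrightarrow> 0) (at 0)"
        by (rule Lim_transform_eventually)
      then have "((\<lambda>t. (y (z + t *\<^sub>R b) - y z) /\<^sub>R t) \<longlongrightarrow> y' z) (at 0)"
        by (simp add: tendsto_norm_zero_iff LIM_zero_iff)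
      moreover have "filterlim (\<lambda>n. 1 / real (Suc n)) (at 0) sequentially"
        using LIMSEQ_inverse_real_of_nat by (simp add: filterlim_at inverse_eq_divide)
      ultimately have "(\<lambda>n. (y (z + (1 / real (Suc n)) *\<^sub>R b) - y z) /\<^sub>R (1 / real (Suc n))) \<longlonglongrightarrow> y' z"
        by (rule filterlim_compose)
      then show "(\<lambda>n. s n z) \<longlonglongrightarrow> y' z" by (simp add: s_def scaleR_conv_of_real)
    qed
    show "AE z in lborel. norm (s n z) \<le> w z" for n
    proof (rule AE_I2)
      fix z
      let ?t = "1 / real (Suc n)"
      show "norm (s n z) \<le> w z"
      proof (cases "z \<in> cball 0 (R + norm b)")
        case True
        have "norm (s n z) = real (Suc n) * norm (y (z + ?t *\<^sub>R b) - y z)"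
          unfolding s_def norm_mult norm_of_nat ..
        also have "\<dots> \<le> real (Suc n) * (M * ?t)" by (intro mult_left_mono lip) auto
        also have "\<dots> = M" by simp
        finally show ?thesis using True by (simp add: w_def)
      next
        case False
        then have n: "norm z > R + norm b" by auto
        have "norm (?t *\<^sub>R b) \<le> norm b" using mult_right_mono[of ?t 1 "norm b"] by simp
        then have "norm (z + ?t *\<^sub>R b) > R" using n norm_triangle_ineq4[of "z + ?t *\<^sub>R b" "?t *\<^sub>R b"] by simp
        moreover have "norm z > R" using n norm_ge_zero[of b] by linarith
        ultimately have "z \<notin> K" "z + ?t *\<^sub>R b \<notin> K" using R by force+
        then show ?thesis using y0(1) False by (simp add: s_def w_def)
      qed
    qed
  qed
  with s0 show ?thesis by (simp add: LIMSEQ_const_iff)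
qed

section \<open>Nonstationary phase\<close>

text \<open>Two sets per parameter: derivatives need the open set \<open>S p\<close>, while uniform
  bounds can be expected only on the compact set \<open>K p\<close>, which will contain the support
  of the amplitude.\<close>

locale family =
  fixes P :: "'p set" and S K :: "'p \<Rightarrow> 'a::euclidean_space set"
  assumes open_S: "p \<in> P \<Longrightarrow> open (S p)"
    and K_subset: "p \<in> P \<Longrightarrow> K p \<subseteq> S p"
    and compact_K: "p \<in> P \<Longrightarrow> compact (K p)"
begin

definition scale_bounded :: "('p \<Rightarrow> real) \<Rightarrow> ('p \<Rightarrow> 'a \<Rightarrow> 'b::real_normed_vector) \<Rightarrow> bool" where
  "scale_bounded r f \<longleftrightarrow> (\<exists>C. \<forall>p\<in>P. \<forall>z\<in>K p. norm (f p z) \<le> C * r p)"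

text \<open>All derivatives of order at most \<open>k\<close> of \<open>f p\<close> are \<open>O (r p)\<close> on \<open>K p\<close>, uniformly in \<open>p\<close>.\<close>

primrec scale_Ck :: "nat \<Rightarrow> ('p \<Rightarrow> real) \<Rightarrow> ('p \<Rightarrow> 'a \<Rightarrow> 'b::real_normed_vector) \<Rightarrow> bool" where
  "scale_Ck 0 r f \<longleftrightarrow> (\<forall>p\<in>P. continuous_on (S p) (f p)) \<and> scale_bounded r f"
| "scale_Ck (Suc k) r f \<longleftrightarrow> (\<forall>p\<in>P. \<forall>z\<in>S p. f p differentiable (at z)) \<and> scale_bounded r f
     \<and> (\<forall>b\<in>Basis. scale_Ck k r (\<lambda>p. dderiv (f p) b))"

lemma scale_Ck_bound: "scale_Ck k r f \<Longrightarrow> scale_bounded r f"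
  by (cases k) auto

lemma scale_Ck_continuous:
  assumes "scale_Ck k r f" "p \<in> P"
  shows "continuous_on (S p) (f p)"
  using assms by (cases k)
    (auto intro!: continuous_at_imp_continuous_on differentiable_imp_continuous_within)

lemma scale_Ck_differentiable: "scale_Ck (Suc k) r f \<Longrightarrow> p \<in> P \<Longrightarrow> z \<in> S p \<Longrightarrow> f p differentiable (at z)"
  by simp

lemma scale_Ck_dderiv: "scale_Ck (Suc k) r f \<Longrightarrow> b \<in> Basis \<Longrightarrow> scale_Ck k r (\<lambda>p. dderiv (f p) b)"
  by simp

lemma scale_Ck_Suc_imp: "scale_Ck (Suc k) r f \<Longrightarrow> scale_Ck k r f"
proof (induction k arbitrary: f)
  case 0
  then have "continuous_on (S p) (f p)" if "p \<in> P" for p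
    using scale_Ck_continuous that by blast
  with 0 show ?case by simp
next
  case (Suc k)
  have "scale_Ck k r (\<lambda>p. dderiv (f p) b)" if "b \<in> Basis" for b
    using Suc.prems that by (intro Suc.IH) simp
  with Suc.prems show ?case by simp
qed

lemma scale_bounded_cong:
  assumes "\<And>p z. p \<in> P \<Longrightarrow> z \<in> S p \<Longrightarrow> f p z = g p z" "\<And>p. p \<in> P \<Longrightarrow> r p = r' p"
  shows "scale_bounded r f \<longleftrightarrow> scale_bounded r' g"
  unfolding scale_bounded_def using assms K_subset by (metis (no_types, lifting) subsetD)

lemma scale_Ck_cong:
  assumes "\<And>p z. p \<in> P \<Longrightarrow> z \<in> S p \<Longrightarrow> f p z = g p z" "\<And>p. p \<in> P \<Longrightarrow> r p = r' p"
  shows "scale_Ck k r f \<longleftrightarrow> scale_Ck k r' g"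
  using assms(1)
proof (induction k arbitrary: f g)
  case 0
  have "continuous_on (S p) (f p) \<longleftrightarrow> continuous_on (S p) (g p)" if "p \<in> P" for p
    using 0 that by (intro continuous_on_cong) auto
  with scale_bounded_cong[OF 0 assms(2)] show ?case by simp
next
  case (Suc k)
  have "dderiv (f p) v z = dderiv (g p) v z" if "p \<in> P" "z \<in> S p" for p v z
    using frechet_derivative_cong_open[OF open_S that(2) Suc.prems] that by simp
  then have "scale_Ck k r (\<lambda>p. dderiv (f p) v) \<longleftrightarrow> scale_Ck k r' (\<lambda>p. dderiv (g p) v)" for v
    by (rule Suc.IH)
  moreover have "f p differentiable (at z) \<longleftrightarrow> g p differentiable (at z)" if "p \<in> P" "z \<in> S p" for p z
    using differentiable_cong_open[OF open_S that(2), of "f p" "g p"]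
      differentiable_cong_open[OF open_S that(2), of "g p" "f p"] Suc.prems that by auto
  ultimately show ?case using scale_bounded_cong[OF Suc.prems assms(2)] by simp
qed

lemma scale_bounded_add:
  assumes "scale_bounded r f" "scale_bounded r g"
  shows "scale_bounded r (\<lambda>p z. f p z + g p z)"
proof -
  obtain C D where "\<And>p z. p \<in> P \<Longrightarrow> z \<in> K p \<Longrightarrow> norm (f p z) \<le> C * r p"
    "\<And>p z. p \<in> P \<Longrightarrow> z \<in> K p \<Longrightarrow> norm (g p z) \<le> D * r p"
    using assms unfolding scale_bounded_def by metis
  then show ?thesis unfolding scale_bounded_def
    by (intro exI[of _ "C + D"]) (auto simp: distrib_right intro!: norm_triangle_mono)
qed

lemma scale_bounded_bilinear:
  assumes "bounded_bilinear B" "scale_bounded r f" "scale_bounded s g" "\<And>p. p \<in> P \<Longrightarrow> r p * s p = w p"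
  shows "scale_bounded w (\<lambda>p z. B (f p z) (g p z))"
proof -
  obtain C D where C: "\<And>p z. p \<in> P \<Longrightarrow> z \<in> K p \<Longrightarrow> norm (f p z) \<le> C * r p"
    "\<And>p z. p \<in> P \<Longrightarrow> z \<in> K p \<Longrightarrow> norm (g p z) \<le> D * s p"
    using assms unfolding scale_bounded_def by metis
  obtain M where M: "M > 0" "\<And>a b. norm (B a b) \<le> norm a * norm b * M"
    using bounded_bilinear.pos_bounded[OF assms(1)] by metis
  have "norm (B (f p z) (g p z)) \<le> (C * D * M) * w p" if "p \<in> P" "z \<in> K p" for p z
  proof -
    have "norm (f p z) * norm (g p z) \<le> (C * r p) * (D * s p)"
      using C[OF that] norm_ge_zero order_trans by (intro mult_mono) (auto intro: order_trans[OF norm_ge_zero])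
    then have "norm (f p z) * norm (g p z) * M \<le> (C * r p) * (D * s p) * M"
      using M by (intro mult_right_mono) auto
    also have "\<dots> = (C * D * M) * w p" using assms(4)[OF that(1)] by (simp add: algebra_simps)
    finally show ?thesis using M(2) order_trans by blast
  qed
  then show ?thesis unfolding scale_bounded_def by blast
qed

lemma scale_Ck_add: "scale_Ck k r f \<Longrightarrow> scale_Ck k r g \<Longrightarrow> scale_Ck k r (\<lambda>p z. f p z + g p z)"
proof (induction k arbitrary: f g)
  case 0
  then show ?case by (auto intro!: continuous_intros scale_bounded_add)
next
  case (Suc k)
  have d: "((\<lambda>z. f p z + g p z) has_derivative (\<lambda>v. dderiv (f p) v z + dderiv (g p) v z)) (at z)"
    if "p \<in> P" "z \<in> S p" for p z
    using Suc.prems that by (auto intro!: has_derivative_add has_dderiv)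
  have "scale_Ck k r (\<lambda>p. dderiv (\<lambda>z. f p z + g p z) b)" if "b \<in> Basis" for b
    using Suc that by (subst scale_Ck_cong[OF dderiv_eq[OF d] refl]) auto
  then show ?case using d scale_bounded_add[OF scale_Ck_bound scale_Ck_bound, OF Suc.prems] by (auto simp: differentiable_def)
qed

lemma scale_Ck_bilinear:
  assumes "bounded_bilinear B" "scale_Ck k r f" "scale_Ck k s g" "\<And>p. p \<in> P \<Longrightarrow> r p * s p = w p"
  shows "scale_Ck k w (\<lambda>p z. B (f p z) (g p z))"
  using assms(2,3)
proof (induction k arbitrary: f g)
  case 0
  have "continuous_on (S p) (\<lambda>z. B (f p z) (g p z))" if "p \<in> P" for p
    by (rule bounded_bilinear.continuous_on[OF assms(1)]) (use 0 that in auto)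
  moreover have "scale_bounded w (\<lambda>p z. B (f p z) (g p z))"
    by (rule scale_bounded_bilinear[OF assms(1) _ _ assms(4)]) (use 0 in auto)
  ultimately show ?case by simp
next
  case (Suc k)
  have d: "((\<lambda>z. B (f p z) (g p z)) has_derivative
      (\<lambda>v. B (f p z) (dderiv (g p) v z) + B (dderiv (f p) v z) (g p z))) (at z)"
    if "p \<in> P" "z \<in> S p" for p z
    using Suc.prems that by (auto intro!: bounded_bilinear.FDERIV[OF assms(1)] has_dderiv)
  have "scale_Ck k w (\<lambda>p. dderiv (\<lambda>z. B (f p z) (g p z)) b)" if "b \<in> Basis" for b
  proof (subst scale_Ck_cong[OF dderiv_eq[OF d] refl])
    show "scale_Ck k w (\<lambda>p z. B (f p z) (dderiv (g p) b z) + B (dderiv (f p) b z) (g p z))"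
      using Suc.prems that scale_Ck_Suc_imp[OF Suc.prems(1)] scale_Ck_Suc_imp[OF Suc.prems(2)]
      by (intro scale_Ck_add Suc.IH) auto
  qed
  then show ?case
    using d scale_bounded_bilinear[OF assms(1) scale_Ck_bound[OF Suc.prems(1)] scale_Ck_bound[OF Suc.prems(2)] assms(4)]
    by (auto simp: differentiable_def)
qed

lemma scale_Ck_const: "scale_Ck k (\<lambda>_. 1) (\<lambda>p z. c)"
proof (induction k arbitrary: c)
  case 0
  then show ?case by (auto simp: scale_bounded_def)
next
  case (Suc k)
  then show ?case by (auto simp: scale_bounded_def frechet_derivative_const)
qed

lemma scale_Ck_sum:
  assumes "finite I" "I \<noteq> {}" "\<And>i. i \<in> I \<Longrightarrow> scale_Ck k r (f i)"
  shows "scale_Ck k r (\<lambda>p z. \<Sum>i\<in>I. f i p z)"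
  using assms by (induction I rule: finite_ne_induct) (auto intro!: scale_Ck_add)

end

text \<open>The gradient is bounded below at the same scale \<open>r p\<close> that bounds it and
  its derivatives above. Divided by \<open>r p\<close>, the phases are uniformly nondegenerate, so
  the effective large parameter is \<open>l * r p\<close>.\<close>

locale phase = family P S K for P :: "'p set" and S K :: "'p \<Rightarrow> 'a::euclidean_space set" +
  fixes F :: "'p \<Rightarrow> 'a \<Rightarrow> real" and g :: "'p \<Rightarrow> 'a \<Rightarrow> complex" and r :: "'p \<Rightarrow> real" and c V :: real
  assumes F_differentiable: "p \<in> P \<Longrightarrow> z \<in> S p \<Longrightarrow> F p differentiable (at z)"
    and scale_Ck_grad: "b \<in> Basis \<Longrightarrow> scale_Ck k r (\<lambda>p. dderiv (F p) b)"
    and scale_Ck_g: "scale_Ck k (\<lambda>_. 1) g"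
    and g_eq_0: "p \<in> P \<Longrightarrow> z \<notin> K p \<Longrightarrow> g p z = 0"
    and r_pos: "p \<in> P \<Longrightarrow> r p > 0"
    and c_pos: "c > 0"
    and grad_lower: "p \<in> P \<Longrightarrow> z \<in> K p \<Longrightarrow> c * (r p)\<^sup>2 \<le> (\<Sum>b\<in>Basis. (dderiv (F p) b z)\<^sup>2)"
    and volume: "p \<in> P \<Longrightarrow> measure lborel (K p) \<le> V"
begin

definition R :: "'p \<Rightarrow> 'a \<Rightarrow> real" where
  "R p z = (\<Sum>b\<in>Basis. (dderiv (F p) b z)\<^sup>2)"

text \<open>
  Integrating by parts \<open>N\<close> times along \<open>\<nabla>F / R\<close>, \<open>R = \<bar>\<nabla>F\<bar>\<^sup>2\<close>, turns the amplitude into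
  \<open>h N / R ^ (2 * N)\<close>: clearing denominators keeps \<open>h N\<close> polynomial in the derivatives of \<open>F\<close>
  and \<open>g\<close>, so that its size can be read off from its homogeneity in \<open>r\<close>.
\<close>

primrec h :: "nat \<Rightarrow> 'p \<Rightarrow> 'a \<Rightarrow> complex" where
  "h 0 = g"
| "h (Suc N) = (\<lambda>p z. \<Sum>b\<in>Basis. R p z *\<^sub>R dderiv (\<lambda>z. dderiv (F p) b z *\<^sub>R h N p z) b z
      + ((- (2 * real N + 1)) *\<^sub>R (dderiv (R p) b z * dderiv (F p) b z)) *\<^sub>R h N p z)"

lemma scale_Ck_R: "scale_Ck k (\<lambda>p. (r p)\<^sup>2) R"
  unfolding R_def power2_eq_square
  by (intro scale_Ck_sum scale_Ck_bilinear[OF bounded_bilinear_mult scale_Ck_grad scale_Ck_grad]) auto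

text \<open>Counting degrees: every step of the recursion contributes \<open>R\<close> or a
  derivative of it, of degree 2 in \<open>r\<close>, and a derivative of \<open>F\<close>, of degree
  1. Against the degree \<open>4 * N\<close> of \<open>R ^ (2 * N)\<close> this leaves
  \<open>r\<close> to the power \<open>- N\<close>.\<close>

lemma scale_Ck_h: "scale_Ck k (\<lambda>p. r p ^ (3 * N)) (h N)"
proof (induction N arbitrary: k)
  case 0
  then show ?case using scale_Ck_g by simp
next
  case (Suc N)
  have 1: "scale_Ck k (\<lambda>p. r p ^ (3 * N + 1)) (\<lambda>p. dderiv (\<lambda>z. dderiv (F p) b z *\<^sub>R h N p z) b)"
    if b: "b \<in> Basis" for b
    by (intro scale_Ck_dderiv scale_Ck_bilinear[OF bounded_bilinear_scaleR scale_Ck_grad Suc.IH] b) simp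
  have 2: "scale_Ck k (\<lambda>p. (r p)\<^sup>2) (\<lambda>p. dderiv (R p) b)" if b: "b \<in> Basis" for b
    by (intro scale_Ck_dderiv scale_Ck_R b)
  have 3: "scale_Ck k (\<lambda>p. r p ^ 3) (\<lambda>p z. (- (2 * real N + 1)) *\<^sub>R (dderiv (R p) b z * dderiv (F p) b z))"
    if b: "b \<in> Basis" for b
    by (intro scale_Ck_bilinear[OF bounded_bilinear_scaleR scale_Ck_const
          scale_Ck_bilinear[OF bounded_bilinear_mult 2[OF b] scale_Ck_grad[OF b]]])
      (auto simp: power3_eq_cube power2_eq_square)
  show ?case unfolding h.simps
    by (intro scale_Ck_sum scale_Ck_add scale_Ck_bilinear[OF bounded_bilinear_scaleR scale_Ck_R 1]
        scale_Ck_bilinear[OF bounded_bilinear_scaleR 3 Suc.IH])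
      (auto simp: power_add power2_eq_square power3_eq_cube)
qed

text \<open>This makes the functions that are cut off at \<open>K p\<close> differentiable across
  its boundary.\<close>

lemma h_eq_0:
  assumes "p \<in> P" "z \<in> S p - K p"
  shows "h N p z = 0"
  using assms(2)
proof (induction N arbitrary: z)
  case 0
  then show ?case using assms g_eq_0 by auto
next
  case (Suc N)
  have o: "open (S p - K p)" using open_S compact_K assms by (simp add: compact_imp_closed open_Diff)
  have "dderiv (\<lambda>z. dderiv (F p) b z *\<^sub>R h N p z) b z = 0" for b
    using frechet_derivative_cong_open[OF o Suc.prems, of "\<lambda>z. dderiv (F p) b z *\<^sub>R h N p z" "\<lambda>z. 0"] Suc.IH
    by (simp add: frechet_derivative_const)
  then show ?case using Suc by simp
qed

lemma R_pos: "p \<in> P \<Longrightarrow> z \<in> K p \<Longrightarrow> R p z > 0"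
  using grad_lower[of p z] r_pos[of p] c_pos by (auto simp: R_def intro: less_le_trans[rotated])

text \<open>Cut off by hand at \<open>K p\<close>, because \<open>R\<close> is known to be positive
  only there.\<close>

definition Y :: "real \<Rightarrow> nat \<Rightarrow> 'p \<Rightarrow> 'a \<Rightarrow> complex" where
  "Y l N p z = (if z \<in> K p then inverse (R p z ^ (2 * N)) *\<^sub>R (cis (l * F p z) * h N p z) else 0)"

lemma F_continuous: "p \<in> P \<Longrightarrow> continuous_on (S p) (F p)"
  by (auto intro!: continuous_at_imp_continuous_on differentiable_imp_continuous_within F_differentiable)

lemma Y_continuous:
  assumes "p \<in> P"
  shows "continuous_on (K p) (Y l N p)"
proof -
  have "continuous_on (K p) (\<lambda>z. inverse (R p z ^ (2 * N)) *\<^sub>R (cis (l * F p z) * h N p z))"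
    using R_pos[OF assms]
    by (intro continuous_intros continuous_on_subset[OF F_continuous[OF assms] K_subset[OF assms]]
        continuous_on_subset[OF scale_Ck_continuous[OF scale_Ck_R assms] K_subset[OF assms]]
        continuous_on_subset[OF scale_Ck_continuous[OF scale_Ck_h assms] K_subset[OF assms]]) fastforce
  then show ?thesis by (rule continuous_on_eq) (auto simp: Y_def)
qed

lemma integrable_compact_support:
  fixes f :: "'a \<Rightarrow> complex"
  assumes "compact C" "continuous_on C f" "\<And>z. z \<notin> C \<Longrightarrow> f z = 0"
  shows "integrable lborel f"
  using borel_integrable_compact[OF assms(1,2)]
  by (rule Bochner_Integration.integrable_cong[THEN iffD1, rotated -1]) (auto simp: assms indicator_def)

lemma Y_integrable: "p \<in> P \<Longrightarrow> integrable lborel (Y l N p)"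
  by (rule integrable_compact_support[OF compact_K Y_continuous]) (auto simp: Y_def)

text \<open>The divergence of the vector field
  \<open>cis (l * F) * h N * \<nabla>F / R ^ (2 * N + 1)\<close> integrates to zero. The derivative
  of the exponential produces \<open>\<i> * l * R\<close>, which cancels one power of
  \<open>R\<close> and gives back \<open>Y l N\<close>; the other terms, over the common denominator
  \<open>R ^ (2 * N + 2)\<close>, form \<open>Y l (Suc N)\<close>.\<close>

lemma integral_Y_Suc:
  assumes p: "p \<in> P"
  shows "of_real l * \<i> * (LINT z|lborel. Y l N p z) = - (LINT z|lborel. Y l (Suc N) p z)"
proof -
  define q where "q b z = dderiv (F p) b z *\<^sub>R h N p z" for b z
  define m where "m = Suc (2 * N)"
  define f where "f b z = inverse (R p z ^ m) *\<^sub>R (cis (l * F p z) * q b z)" for b z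
  define y where "y b z = (if z \<in> K p then f b z else 0)" for b z
  define f' where "f' b z = inverse (R p z ^ m) *\<^sub>R
       ((l * dderiv (F p) b z) *\<^sub>R (\<i> * cis (l * F p z)) * q b z + cis (l * F p z) * dderiv (q b) b z)
     - (real m * dderiv (R p) b z * inverse (R p z ^ Suc m)) *\<^sub>R (cis (l * F p z) * q b z)" for b z
  define y' where "y' b z = (if z \<in> K p then f' b z else 0)" for b z
  have R_dif: "R p differentiable (at z)" if "z \<in> S p" for z
    using scale_Ck_differentiable[OF scale_Ck_R p that] .
  have scale_Ck_q: "scale_Ck k (\<lambda>p. r p * r p ^ (3 * N)) (\<lambda>p z. dderiv (F p) b z *\<^sub>R h N p z)" if "b \<in> Basis" for b k
    by (intro scale_Ck_bilinear[OF bounded_bilinear_scaleR scale_Ck_grad scale_Ck_h] that) simp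
  have q_dif: "q b differentiable (at z)" if "z \<in> S p" "b \<in> Basis" for z b
    using scale_Ck_differentiable[OF scale_Ck_q p that(1), of b] that unfolding q_def by simp
  have cR: "continuous_on (S p) (R p)" using scale_Ck_continuous[OF scale_Ck_R p] .
  \<comment> \<open>On this neighbourhood of \<open>K p\<close> the quotient \<open>f b\<close> is
    differentiable, and it equals its cutoff \<open>y b\<close> because \<open>h N\<close> vanishes
    off \<open>K p\<close>.\<close>
  define U where "U = S p \<inter> R p -` {0<..}"
  have U: "open U" unfolding U_def by (rule continuous_open_preimage[OF cR open_S[OF p]]) simp
  have KU: "K p \<subseteq> U" using K_subset R_pos p by (auto simp: U_def)
  have f_deriv: "\<exists>D. (f b has_derivative D) (at z) \<and> D b = f' b z" if z: "z \<in> U" and b: "b \<in> Basis" for b z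
  proof -
    have zS: "z \<in> S p" and Rz: "R p z \<noteq> 0" using z by (auto simp: U_def)
    note dR = has_dderiv[OF R_dif[OF zS]] and dq = has_dderiv[OF q_dif[OF zS b]]
      and dF = has_dderiv[OF F_differentiable[OF p zS]]
    have "(f b has_derivative (\<lambda>v. inverse (R p z ^ m) *\<^sub>R
          (cis (l * F p z) * dderiv (q b) v z + ((l * dderiv (F p) v z) *\<^sub>R (\<i> * cis (l * F p z))) * q b z)
        + (- (inverse (R p z ^ m) * (real m * R p z ^ (m - 1) * dderiv (R p) v z) * inverse (R p z ^ m)))
            *\<^sub>R (cis (l * F p z) * q b z))) (at z)"
    proof -
      have pow: "((\<lambda>z. R p z ^ m) has_derivative (\<lambda>v. real m * R p z ^ (m - 1) * dderiv (R p) v z)) (at z)"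
        by (rule has_derivative_eq_rhs[OF has_derivative_power[OF dR]]) (auto simp: mult_ac)
      have "R p z ^ m \<noteq> 0" using Rz by simp
      have inv: "((\<lambda>z. inverse (R p z ^ m)) has_derivative
          (\<lambda>v. - (inverse (R p z ^ m) * (real m * R p z ^ (m - 1) * dderiv (R p) v z) * inverse (R p z ^ m)))) (at z)"
        using \<open>R p z ^ m \<noteq> 0\<close> by (rule Deriv.has_derivative_inverse[OF _ pow])
      have e: "((\<lambda>z. cis (l * F p z)) has_derivative
          (\<lambda>v. (l * dderiv (F p) v z) *\<^sub>R (\<i> * cis (l * F p z)))) (at z)"
        by (rule has_derivative_cis[OF has_derivative_mult_right[OF dF]])
      have prod: "((\<lambda>z. cis (l * F p z) * q b z) has_derivative
          (\<lambda>v. cis (l * F p z) * dderiv (q b) v z + ((l * dderiv (F p) v z) *\<^sub>R (\<i> * cis (l * F p z))) * q b z)) (at z)"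
        by (rule has_derivative_mult[OF e dq])
      have "f b = (\<lambda>z. inverse (R p z ^ m) *\<^sub>R (cis (l * F p z) * q b z))"
        by (simp add: f_def fun_eq_iff)
      then show ?thesis using has_derivative_scaleR[OF inv prod] by simp
    qed
    moreover have "inverse (R p z ^ m) * (real m * R p z ^ (m - 1) * dderiv (R p) b z) * inverse (R p z ^ m)
        = real m * dderiv (R p) b z * inverse (R p z ^ Suc m)"
    proof -
      have "R p z ^ m = R p z * R p z ^ (m - 1)" by (simp add: m_def)
      then show ?thesis using Rz by simp
    qed
    then have "inverse (R p z ^ m) *\<^sub>R
          (cis (l * F p z) * dderiv (q b) b z + ((l * dderiv (F p) b z) *\<^sub>R (\<i> * cis (l * F p z))) * q b z)
        + (- (inverse (R p z ^ m) * (real m * R p z ^ (m - 1) * dderiv (R p) b z) * inverse (R p z ^ m)))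
            *\<^sub>R (cis (l * F p z) * q b z) = f' b z"
      unfolding f'_def by (simp only: add.commute scaleR_minus_left diff_conv_add_uminus)
    ultimately show ?thesis by blast
  qed
  have y_eq: "y b z = f b z" if "z \<in> U" for b z
    using h_eq_0[OF p, of z N] that by (auto simp: y_def f_def q_def U_def)
  have dy: "\<exists>D. (y b has_derivative D) (at z) \<and> D b = y' b z" if b: "b \<in> Basis" for b z
  proof (cases "z \<in> K p")
    case True
    then have zU: "z \<in> U" using KU by auto
    obtain D where D: "(f b has_derivative D) (at z)" "D b = f' b z" using f_deriv[OF zU b] by blast
    have "(y b has_derivative D) (at z)"
      by (rule has_derivative_transform_within_open[OF D(1) U zU]) (simp add: y_eq)
    with D True show ?thesis by (auto simp: y'_def)
  next
    case False
    have "open (- K p)" using compact_K[OF p] by (simp add: compact_imp_closed open_Compl)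
    then have "(y b has_derivative (\<lambda>v. 0)) (at z)"
      using False by (intro has_derivative_transform_within_open[OF has_derivative_const[of 0]])
        (auto simp: y_def)
    with False show ?thesis by (auto simp: y'_def)
  qed
  have cont_sub: "continuous_on (K p) w" if "continuous_on (S p) w" for w :: "'a \<Rightarrow> 'x::real_normed_vector"
    using continuous_on_subset[OF that K_subset[OF p]] .
  have cont: "continuous_on (K p) (y' b)" if b: "b \<in> Basis" for b
  proof -
    have "continuous_on (K p) (f' b)"
      unfolding f'_def
      by (intro continuous_intros cont_sub[OF F_continuous[OF p]] cont_sub[OF cR]
          cont_sub[OF scale_Ck_continuous[OF scale_Ck_q[OF b] p, folded q_def]]
          cont_sub[OF scale_Ck_continuous[OF scale_Ck_dderiv[OF scale_Ck_q[OF b] b] p, folded q_def]]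
          cont_sub[OF scale_Ck_continuous[OF scale_Ck_grad[OF b] p]]
          cont_sub[OF scale_Ck_continuous[OF scale_Ck_dderiv[OF scale_Ck_R b] p]])
        (use R_pos[OF p] in fastforce)+
    then show ?thesis by (rule continuous_on_eq) (auto simp: y'_def)
  qed
  have y'_int: "integrable lborel (y' b)" if "b \<in> Basis" for b
    by (rule integrable_compact_support[OF compact_K[OF p] cont[OF that]]) (auto simp: y'_def)
  have "0 = (\<Sum>b\<in>Basis. LINT z|lborel. y' b z)"
    using integral_dderiv_eq_0[OF compact_K[OF p] dy _ _ cont] by (simp add: y_def y'_def)
  also have "\<dots> = (LINT z|lborel. (\<Sum>b\<in>Basis. y' b z))"
    by (rule Bochner_Integration.integral_sum[symmetric]) (rule y'_int)
  also have "(\<lambda>z. \<Sum>b\<in>Basis. y' b z) = (\<lambda>z. of_real l * \<i> * Y l N p z + Y l (Suc N) p z)"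
  proof
    fix z
    show "(\<Sum>b\<in>Basis. y' b z) = of_real l * \<i> * Y l N p z + Y l (Suc N) p z"
    proof (cases "z \<in> K p")
      case True
      let ?e = "cis (l * F p z)"
      have R0: "R p z \<noteq> 0" using R_pos[OF p True] by simp
      have b: "y' b z = (inverse (R p z ^ m) * (dderiv (F p) b z)\<^sup>2) *\<^sub>R (of_real l * \<i> * ?e * h N p z)
         + inverse (R p z ^ Suc m) *\<^sub>R (?e * (R p z *\<^sub>R dderiv (q b) b z
             + ((- (2 * real N + 1)) *\<^sub>R (dderiv (R p) b z * dderiv (F p) b z)) *\<^sub>R h N p z))" for b
        using True R0 unfolding y'_def f'_def
        by (simp add: q_def[of b z] m_def scaleR_conv_of_real power2_eq_square field_simps)
      have "(\<Sum>b\<in>Basis. y' b z) = (inverse (R p z ^ m) * R p z) *\<^sub>R (of_real l * \<i> * ?e * h N p z)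
          + inverse (R p z ^ Suc m) *\<^sub>R (?e * h (Suc N) p z)"
      proof -
        have 1: "(\<Sum>b\<in>Basis. (inverse (R p z ^ m) * (dderiv (F p) b z)\<^sup>2) *\<^sub>R (of_real l * \<i> * ?e * h N p z))
            = (inverse (R p z ^ m) * R p z) *\<^sub>R (of_real l * \<i> * ?e * h N p z)"
          by (simp add: R_def[of p z] sum_distrib_left flip: scaleR_sum_left)
        have 2: "(\<Sum>b\<in>Basis. inverse (R p z ^ Suc m) *\<^sub>R (?e * (R p z *\<^sub>R dderiv (q b) b z
               + ((- (2 * real N + 1)) *\<^sub>R (dderiv (R p) b z * dderiv (F p) b z)) *\<^sub>R h N p z)))
            = inverse (R p z ^ Suc m) *\<^sub>R (?e * h (Suc N) p z)"
          unfolding h.simps q_def by (simp only: sum_distrib_left scaleR_sum_right)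
        show ?thesis unfolding b sum.distrib 1 2 ..
      qed
      also have "inverse (R p z ^ m) * R p z = inverse (R p z ^ (2 * N))" using R0 by (simp add: m_def)
      finally show ?thesis using True by (simp add: Y_def m_def scaleR_conv_of_real mult_ac)
    qed (simp add: y'_def Y_def)
  qed
  also have "(LINT z|lborel. of_real l * \<i> * Y l N p z + Y l (Suc N) p z)
      = of_real l * \<i> * (LINT z|lborel. Y l N p z) + (LINT z|lborel. Y l (Suc N) p z)"
    using Y_integrable[OF p] by simp
  finally show ?thesis by (simp add: eq_neg_iff_add_eq_0)
qed

lemma norm_integral_Y:
  assumes p: "p \<in> P" and l: "l > 0"
  shows "norm (LINT z|lborel. Y l 0 p z) = norm (LINT z|lborel. Y l N p z) / l ^ N"
proof (induction N)
  case (Suc N)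
  have "norm (of_real l * \<i> * (LINT z|lborel. Y l N p z)) = norm (LINT z|lborel. Y l (Suc N) p z)"
    unfolding integral_Y_Suc[OF p] by simp
  with Suc l show ?case by (simp add: norm_mult field_simps)
qed simp

theorem nonstationary_phase:
  obtains C where "C > 0"
    "\<And>p l. p \<in> P \<Longrightarrow> l > 0 \<Longrightarrow> norm (LINT z|lborel. g p z * cis (l * F p z)) \<le> C / (l * r p) ^ N"
proof -
  obtain C where C: "\<And>p z. p \<in> P \<Longrightarrow> z \<in> K p \<Longrightarrow> norm (h N p z) \<le> C * r p ^ (3 * N)"
    using scale_Ck_bound[OF scale_Ck_h[of 0]] unfolding scale_bounded_def by metis
  define C' where "C' = \<bar>C\<bar> / c ^ (2 * N)"
  have C': "C' \<ge> 0" using c_pos by (simp add: C'_def)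
  have Yb: "norm (Y l N p z) \<le> C' / r p ^ N * indicator (K p) z" if p: "p \<in> P" for p z l
  proof (cases "z \<in> K p")
    case True
    have r: "r p > 0" using r_pos p by simp
    have "(c * (r p)\<^sup>2) ^ (2 * N) \<le> R p z ^ (2 * N)"
      using grad_lower[OF p True] c_pos by (intro power_mono) (auto simp: R_def)
    then have "inverse (R p z ^ (2 * N)) \<le> inverse ((c * (r p)\<^sup>2) ^ (2 * N))"
      using c_pos r by (intro le_imp_inverse_le) auto
    moreover have "norm (h N p z) \<le> \<bar>C\<bar> * r p ^ (3 * N)"
      by (rule order_trans[OF C[OF p True]]) (use r in \<open>auto intro!: mult_right_mono\<close>)
    ultimately have "inverse (R p z ^ (2 * N)) * norm (h N p z)
        \<le> inverse ((c * (r p)\<^sup>2) ^ (2 * N)) * (\<bar>C\<bar> * r p ^ (3 * N))"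
      using c_pos by (intro mult_mono) auto
    also have "\<dots> = C' / r p ^ N"
    proof -
      have "(r p)\<^sup>2 ^ (2 * N) = r p ^ (3 * N) * r p ^ N" by (simp flip: power_mult power_add)
      then show ?thesis using r c_pos by (simp add: C'_def power_mult_distrib field_simps)
    qed
    finally show ?thesis using True R_pos[OF p True] by (simp add: Y_def norm_mult)
  qed (simp add: Y_def)
  show ?thesis
  proof
    show "C' * \<bar>V\<bar> + 1 > 0" using C' by (simp add: add_nonneg_pos)
    fix p and l :: real assume p: "p \<in> P" and l: "l > 0"
    have r: "r p > 0" using r_pos p by simp
    have Y0: "g p z * cis (l * F p z) = Y l 0 p z" for z using g_eq_0[OF p] by (simp add: Y_def)
    have fin: "emeasure lborel (K p) < \<infinity>" "K p \<in> sets lborel"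
      using compact_K[OF p] emeasure_compact_finite by (auto intro: compact_imp_closed borel_closed)
    have "norm (LINT z|lborel. Y l N p z) \<le> (LINT z|lborel. C' / r p ^ N * indicator (K p) z)"
      by (rule Bochner_Integration.integral_norm_bound_integral[OF Y_integrable[OF p] _ Yb[OF p]])
        (use fin in auto)
    also have "\<dots> = C' / r p ^ N * measure lborel (K p)" using fin by simp
    also have "\<dots> \<le> C' / r p ^ N * (\<bar>V\<bar>)"
      using volume[OF p] C' r by (intro mult_left_mono) auto
    also have "\<dots> \<le> (C' * \<bar>V\<bar> + 1) / r p ^ N" using r by (simp add: field_simps)
    finally have "norm (LINT z|lborel. Y l N p z) / l ^ N \<le> (C' * \<bar>V\<bar> + 1) / r p ^ N / l ^ N"
      using l by (intro divide_right_mono) auto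
    then show "norm (LINT z|lborel. g p z * cis (l * F p z)) \<le> (C' * \<bar>V\<bar> + 1) / (l * r p) ^ N"
      unfolding Y0 norm_integral_Y[OF p l, of N] by (simp add: power_mult_distrib mult.commute)
  qed
qed

end

section \<open>Invariant measure and square-integrable functions\<close>

lemma sympl_J_add: "sympl_J (x + y) = sympl_J x + sympl_J y"
  and sympl_J_uminus: "sympl_J (- x) = - sympl_J x"
  by (simp_all add: sympl_J_def)

lemma heis_mult_assoc: "heis_mult a (heis_mult a p q) r = heis_mult a p (heis_mult a q r)"
  by (simp add: heis_mult_def sympl_J_add inner_add_left inner_add_right algebra_simps)

lemma heis_mult_0_left [simp]: "heis_mult a 0 p = p"
  and heis_mult_0_right [simp]: "heis_mult a p 0 = p"
  by (simp_all add: heis_mult_def sympl_J_def prod_eq_iff inner_prod_def)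

lemma heis_inv_inv [simp]: "heis_inv (heis_inv p) = p"
  by (simp add: heis_inv_def)

lemma heis_inv_mult: "heis_inv (heis_mult a p q) = heis_mult a (heis_inv q) (heis_inv p)"
proof -
  have "fst p \<bullet> sympl_J (fst q) = - (fst q \<bullet> sympl_J (fst p))"
    by (simp add: sympl_J_def inner_prod_def inner_commute)
  then show ?thesis
    by (simp add: heis_mult_def heis_inv_def sympl_J_uminus algebra_simps)
qed

lemma continuous_on_sympl_J [continuous_intros]:
  "continuous_on S f \<Longrightarrow> continuous_on S (\<lambda>x. sympl_J (f x))"
  unfolding sympl_J_def by (intro continuous_intros)

lemma continuous_on_heis_mult [continuous_intros]:
  "continuous_on S f \<Longrightarrow> continuous_on S g \<Longrightarrow> continuous_on S (\<lambda>x. heis_mult a (f x) (g x))"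
  unfolding heis_mult_def by (intro continuous_intros)

lemma continuous_on_heis_inv [continuous_intros]:
  "continuous_on S f \<Longrightarrow> continuous_on S (\<lambda>x. heis_inv (f x))"
  unfolding heis_inv_def by (intro continuous_intros)

lemma measurable_heis_mult [measurable (raw)]:
  fixes f g :: "_ \<Rightarrow> 'n::finite heis"
  assumes "f \<in> borel_measurable M" "g \<in> borel_measurable M"
  shows "(\<lambda>x. heis_mult a (f x) (g x)) \<in> borel_measurable M"
  by (rule borel_measurable_continuous_Pair[OF assms]) (intro continuous_intros)

lemma measurable_heis_inv [measurable (raw)]:
  fixes f :: "_ \<Rightarrow> 'n::finite heis"
  assumes "f \<in> borel_measurable M"
  shows "(\<lambda>x. heis_inv (f x)) \<in> borel_measurable M"
  by (rule borel_measurable_continuous_on[OF _ assms]) (intro continuous_intros)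

text \<open>In coordinates the map reflects \<open>x\<close> and, for fixed \<open>x\<close>,
  reflects \<open>t\<close> about a point depending on \<open>x\<close>; this is a case of
  \<open>lborel_distr_shear\<close>.\<close>

lemma distr_mult_inv: "distr lborel borel (\<lambda>z. heis_mult a u (heis_inv z)) = lborel"
proof -
  have e: "(\<lambda>z. heis_mult a u (heis_inv z))
      = (\<lambda>z. (fst u - fst z, (\<lambda>x. snd u + 2 * a * (fst u \<bullet> sympl_J x)) (fst z) - snd z))"
    by (auto simp: heis_mult_def heis_inv_def sympl_J_uminus fun_eq_iff algebra_simps)
  show ?thesis unfolding e
    by (rule lborel_distr_shear) (intro borel_measurable_continuous_onI continuous_intros)
qed

lemma distr_inv_mult: "distr lborel borel (\<lambda>z. heis_mult a (heis_inv z) w) = lborel"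
proof -
  have e: "(\<lambda>z. heis_mult a (heis_inv z) w)
      = (\<lambda>z. (fst w - fst z, (\<lambda>x. snd w + 2 * a * (x \<bullet> sympl_J (fst w))) (fst z) - snd z))"
    by (auto simp: heis_mult_def heis_inv_def fun_eq_iff algebra_simps)
  show ?thesis unfolding e
    by (rule lborel_distr_shear) (intro borel_measurable_continuous_onI continuous_intros)
qed

text \<open>The inverse does not depend on \<open>a\<close>, so the instance with
  \<open>a = 0\<close> and \<open>u = 0\<close> suffices.\<close>

lemma distr_inv: "distr lborel borel heis_inv = (lborel :: 'n::finite heis measure)"
  using distr_mult_inv[of 0 0] by simp

lemma distr_right: "distr lborel borel (\<lambda>z. heis_mult a z w) = lborel"
proof -
  have "distr (distr lborel borel heis_inv) borel (\<lambda>z. heis_mult a (heis_inv z) w)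
      = distr lborel borel ((\<lambda>z. heis_mult a (heis_inv z) w) \<circ> heis_inv)"
    by (rule distr_distr) simp_all
  then show ?thesis by (simp add: distr_inv distr_inv_mult comp_def)
qed

lemma nn_integral_preserving:
  fixes f :: "'a::euclidean_space \<Rightarrow> ennreal"
  assumes "distr lborel borel T = lborel" "T \<in> borel_measurable borel" "f \<in> borel_measurable borel"
  shows "(\<integral>\<^sup>+z. f (T z) \<partial>lborel) = (\<integral>\<^sup>+z. f z \<partial>lborel)"
  using nn_integral_distr[of T lborel borel f] assms by simp

lemma integral_preserving:
  fixes f :: "'a::euclidean_space \<Rightarrow> complex"
  assumes "distr lborel borel T = lborel" "T \<in> borel_measurable borel" "f \<in> borel_measurable borel"
  shows "(LINT z|lborel. f (T z)) = (LINT z|lborel. f z)"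
  using integral_distr[of T lborel borel f] assms by simp

section \<open>Inner product and norm of square-integrable functions\<close>

definition ip :: "('a::euclidean_space \<Rightarrow> complex) \<Rightarrow> ('a \<Rightarrow> complex) \<Rightarrow> complex" where
  "ip f g = (LINT p|lborel. f p * cnj (g p))"

lemma L2_measurable [measurable_dest]: "f \<in> L2 \<Longrightarrow> f \<in> borel_measurable borel"
  by (simp add: L2_def)

lemma nn_integral_L2: "f \<in> L2 \<Longrightarrow> (\<integral>\<^sup>+p. ennreal ((cmod (f p))\<^sup>2) \<partial>lborel) = ennreal ((L2_norm f)\<^sup>2)"
  by (simp add: L2_def L2_norm_def nn_integral_eq_integral)

lemma L2_normI:
  assumes [measurable]: "f \<in> borel_measurable borel"
    and b: "(\<integral>\<^sup>+p. ennreal ((cmod (f p))\<^sup>2) \<partial>lborel) \<le> ennreal (c\<^sup>2)" and "c \<ge> 0"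
  shows "f \<in> L2" "L2_norm f \<le> c"
proof -
  have "(\<integral>\<^sup>+p. ennreal ((cmod (f p))\<^sup>2) \<partial>lborel) < \<infinity>" using b by (rule le_less_trans) simp
  then have "integrable lborel (\<lambda>p. (cmod (f p))\<^sup>2)" by (intro integrableI_bounded) simp_all
  then show 1: "f \<in> L2" by (simp add: L2_def)
  have "(L2_norm f)\<^sup>2 \<le> c\<^sup>2" using b nn_integral_L2[OF 1] by simp
  then show "L2_norm f \<le> c" using \<open>c \<ge> 0\<close> by (rule power2_le_imp_le)
qed

lemma L2_norm_nonneg [simp]: "L2_norm f \<ge> 0"
  by (simp add: L2_norm_def)

lemma nn_integral_Cauchy_Schwarz:
  fixes f g :: "'a::euclidean_space \<Rightarrow> complex"
  assumes "f \<in> L2" "g \<in> L2"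
  shows "(\<integral>\<^sup>+p. ennreal (cmod (f p) * cmod (g p)) \<partial>lborel) \<le> ennreal (L2_norm f * L2_norm g)"
proof -
  have [measurable]: "f \<in> borel_measurable borel" "g \<in> borel_measurable borel"
    using assms by (auto dest: L2_measurable)
  have "(\<integral>\<^sup>+p. ennreal (cmod (f p)) * ennreal (cmod (g p)) \<partial>lborel)\<^sup>2
     \<le> (\<integral>\<^sup>+p. ennreal (cmod (f p)) ^ 2 \<partial>lborel) * (\<integral>\<^sup>+p. ennreal (cmod (g p)) ^ 2 \<partial>lborel)"
    by (rule Cauchy_Schwarz_nn_integral) simp_all
  also have "\<dots> = ennreal ((L2_norm f * L2_norm g)\<^sup>2)"
    using nn_integral_L2[OF assms(1)] nn_integral_L2[OF assms(2)]
    by (simp add: ennreal_power ennreal_mult power_mult_distrib)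
  finally have *: "(\<integral>\<^sup>+p. ennreal (cmod (f p) * cmod (g p)) \<partial>lborel)\<^sup>2 \<le> ennreal ((L2_norm f * L2_norm g)\<^sup>2)"
    by (simp add: ennreal_mult)
  show ?thesis
  proof (cases "\<integral>\<^sup>+p. ennreal (cmod (f p) * cmod (g p)) \<partial>lborel" rule: ennreal_cases)
    case (real r)
    then have "r\<^sup>2 \<le> (L2_norm f * L2_norm g)\<^sup>2" using * by (simp add: ennreal_power)
    then have "r \<le> L2_norm f * L2_norm g" by (rule power2_le_imp_le) (simp add: L2_norm_def)
    with real show ?thesis by (simp add: ennreal_leI)
  next
    case top
    with * show ?thesis by (simp add: top_unique power2_eq_square)
  qed
qed

lemma L2_prod_integrable:
  assumes "f \<in> L2" "g \<in> L2"
  shows "integrable lborel (\<lambda>p. f p * g p)"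
proof -
  have [measurable]: "f \<in> borel_measurable borel" "g \<in> borel_measurable borel"
    using assms by (auto dest: L2_measurable)
  show ?thesis using nn_integral_Cauchy_Schwarz[OF assms]
    by (intro integrableI_bounded) (auto simp: norm_mult intro: le_less_trans)
qed

lemma L2_cnj: "f \<in> L2 \<Longrightarrow> (\<lambda>p. cnj (f p)) \<in> L2"
  using borel_measurable_continuous_on[OF continuous_on_cnj[OF continuous_on_id], of f lborel]
  by (auto simp: L2_def)

lemma L2_norm_cnj [simp]: "L2_norm (\<lambda>p. cnj (f p)) = L2_norm f"
  by (simp add: L2_norm_def)

lemma ip_integrable: "f \<in> L2 \<Longrightarrow> g \<in> L2 \<Longrightarrow> integrable lborel (\<lambda>p. f p * cnj (g p))"
  by (intro L2_prod_integrable L2_cnj)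

lemma norm_ip_le:
  assumes "f \<in> L2" "g \<in> L2"
  shows "cmod (ip f g) \<le> L2_norm f * L2_norm g"
proof -
  have "ennreal (cmod (ip f g)) \<le> (\<integral>\<^sup>+p. ennreal (cmod (f p * cnj (g p))) \<partial>lborel)"
    unfolding ip_def by (rule integral_norm_bound_ennreal[OF ip_integrable[OF assms]])
  also have "\<dots> \<le> ennreal (L2_norm f * L2_norm g)" using nn_integral_Cauchy_Schwarz[OF assms] by (simp add: norm_mult)
  finally show ?thesis by simp
qed

lemma ip_self: "ip f f = of_real ((L2_norm f)\<^sup>2)"
proof -
  have "ip f f = (LINT p|lborel. of_real ((cmod (f p))\<^sup>2))"
    unfolding ip_def by (simp only: complex_norm_square)
  also have "\<dots> = of_real (LINT p|lborel. (cmod (f p))\<^sup>2)" by (rule integral_complex_of_real)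
  finally show ?thesis by (simp add: L2_norm_def)
qed

lemma L2_add:
  assumes "f \<in> L2" "g \<in> L2"
  shows "(\<lambda>p. f p + g p) \<in> L2"
proof -
  have [measurable]: "f \<in> borel_measurable borel" "g \<in> borel_measurable borel"
    using assms by (auto dest: L2_measurable)
  have "integrable lborel (\<lambda>p. (cmod (f p + g p))\<^sup>2)"
  proof (rule Bochner_Integration.integrable_bound)
    show "integrable lborel (\<lambda>p. 2 * ((cmod (f p))\<^sup>2 + (cmod (g p))\<^sup>2))" using assms by (auto simp: L2_def)
    have "(cmod (f p + g p))\<^sup>2 \<le> 2 * ((cmod (f p))\<^sup>2 + (cmod (g p))\<^sup>2)" for p
    proof -
      have "(cmod (f p + g p))\<^sup>2 \<le> (cmod (f p) + cmod (g p))\<^sup>2"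
        by (intro power_mono norm_triangle_ineq) simp
      also have "\<dots> \<le> 2 * ((cmod (f p))\<^sup>2 + (cmod (g p))\<^sup>2)"
        using sum_squares_bound[of "cmod (f p)" "cmod (g p)"] by (simp add: power2_sum)
      finally show ?thesis .
    qed
    then show "AE p in lborel. norm ((cmod (f p + g p))\<^sup>2) \<le> norm (2 * ((cmod (f p))\<^sup>2 + (cmod (g p))\<^sup>2))"
      by (simp add: abs_of_nonneg)
  qed simp
  then show ?thesis by (simp add: L2_def)
qed

lemma L2_scale: "f \<in> L2 \<Longrightarrow> (\<lambda>p. c * f p) \<in> L2"
  by (auto simp: L2_def norm_mult power_mult_distrib)

lemma L2_norm_scale: "L2_norm (\<lambda>p. c * f p) = cmod c * L2_norm f"
  by (simp add: L2_norm_def norm_mult power_mult_distrib real_sqrt_mult)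

lemma L2_diff: "f \<in> L2 \<Longrightarrow> g \<in> L2 \<Longrightarrow> (\<lambda>p. f p - g p) \<in> L2"
  using L2_add[OF _ L2_scale[of g "-1"], of f] by simp

lemma L2_zero: "(\<lambda>p. 0) \<in> L2"
  by (simp add: L2_def)

lemma L2_sum: "(\<And>i. i \<in> I \<Longrightarrow> f i \<in> L2) \<Longrightarrow> (\<lambda>p. \<Sum>i\<in>I. f i p) \<in> L2"
  by (induction I rule: infinite_finite_induct) (auto intro: L2_add L2_zero)

lemma ip_sum_left:
  assumes "\<And>i. i \<in> I \<Longrightarrow> f i \<in> L2" "g \<in> L2"
  shows "ip (\<lambda>p. \<Sum>i\<in>I. f i p) g = (\<Sum>i\<in>I. ip (f i) g)"
  unfolding ip_def sum_distrib_right
  by (rule Bochner_Integration.integral_sum) (rule ip_integrable[OF assms])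

lemma ip_commute: "ip g f = cnj (ip f g)"
  using Bochner_Integration.integral_cnj[of lborel "\<lambda>p. f p * cnj (g p)"] by (simp add: ip_def mult.commute)

lemma ip_sum_right:
  assumes "\<And>i. i \<in> I \<Longrightarrow> f i \<in> L2" "g \<in> L2"
  shows "ip g (\<lambda>p. \<Sum>i\<in>I. f i p) = (\<Sum>i\<in>I. ip g (f i))"
proof -
  have "ip g (\<lambda>p. \<Sum>i\<in>I. f i p) = cnj (\<Sum>i\<in>I. ip (f i) g)"
    by (subst ip_commute) (simp only: ip_sum_left[OF assms])
  also have "\<dots> = (\<Sum>i\<in>I. ip g (f i))"
    by (simp add: ip_commute[of g])
  finally show ?thesis .
qed

lemma L2_norm_sum_le:
  assumes "finite J" "\<And>j. j \<in> J \<Longrightarrow> h j \<in> L2"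
  shows "(L2_norm (\<lambda>p. \<Sum>j\<in>J. h j p))\<^sup>2 \<le> (\<Sum>j\<in>J. \<Sum>k\<in>J. cmod (ip (h j) (h k)))"
proof -
  have "of_real ((L2_norm (\<lambda>p. \<Sum>j\<in>J. h j p))\<^sup>2) = (\<Sum>j\<in>J. \<Sum>k\<in>J. ip (h j) (h k))"
    unfolding ip_self[symmetric] using assms by (simp add: ip_sum_left ip_sum_right L2_sum)
  then have "(L2_norm (\<lambda>p. \<Sum>j\<in>J. h j p))\<^sup>2 = cmod (\<Sum>j\<in>J. \<Sum>k\<in>J. ip (h j) (h k))"
    by (metis abs_of_nonneg norm_of_real zero_le_power2)
  also have "\<dots> \<le> (\<Sum>j\<in>J. \<Sum>k\<in>J. cmod (ip (h j) (h k)))"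
    by (intro sum_norm_le order_trans[OF norm_sum] order_refl)
  finally show ?thesis .
qed

lemma L2_norm_triangle:
  assumes "f \<in> L2" "g \<in> L2"
  shows "L2_norm (\<lambda>p. f p + g p) \<le> L2_norm f + L2_norm g"
proof -
  define h where "h j = (if j = (0::nat) then f else g)" for j
  have "(L2_norm (\<lambda>p. \<Sum>j\<in>{0,1}. h j p))\<^sup>2 \<le> (\<Sum>j\<in>{0,1}. \<Sum>k\<in>{0,1}. cmod (ip (h j) (h k)))"
    by (rule L2_norm_sum_le) (use assms in \<open>auto simp: h_def\<close>)
  then have "(L2_norm (\<lambda>p. f p + g p))\<^sup>2 \<le> (L2_norm f + L2_norm g)\<^sup>2"
    using norm_ip_le[OF assms] norm_ip_le[OF assms(2,1)]
    by (simp add: h_def ip_self norm_power power2_sum mult.commute[of "L2_norm g"] mult.assoc)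
  then show ?thesis by (rule power2_le_imp_le) simp
qed

section \<open>Limits in L2\<close>

lemma L2_norm_minus_commute: "L2_norm (\<lambda>p. f p - g p) = L2_norm (\<lambda>p. g p - f p)"
  by (simp add: L2_norm_def norm_minus_commute)

lemma L2_norm_0_iff:
  assumes "f \<in> L2" "L2_norm f = 0"
  shows "AE p in lborel. f p = 0"
proof -
  have "(LINT p|lborel. (cmod (f p))\<^sup>2) = 0" using assms by (simp add: L2_norm_def)
  then have "AE p in lborel. (cmod (f p))\<^sup>2 = 0"
    using assms by (subst (asm) integral_nonneg_eq_0_iff_AE) (auto simp: L2_def)
  then show ?thesis by simp
qed

text \<open>Fatou's lemma for the squares. It serves both completeness and the comparison of L2
  limits with pointwise limits.\<close>

lemma L2_Fatou:
  fixes F :: "nat \<Rightarrow> 'a::euclidean_space \<Rightarrow> complex"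
  assumes "\<And>n. F n \<in> L2" "AE p in lborel. (\<lambda>n. F n p) \<longlonglongrightarrow> g p"
    and g [measurable]: "g \<in> borel_measurable borel"
    and b: "\<forall>\<^sub>F n in sequentially. L2_norm (F n) \<le> c" and "c \<ge> 0"
  shows "g \<in> L2" "L2_norm g \<le> c"
proof -
  have [measurable]: "F n \<in> borel_measurable borel" for n using assms(1) by (rule L2_measurable)
  have "(\<integral>\<^sup>+p. ennreal ((cmod (g p))\<^sup>2) \<partial>lborel) = (\<integral>\<^sup>+p. liminf (\<lambda>n. ennreal ((cmod (F n p))\<^sup>2)) \<partial>lborel)"
  proof (rule nn_integral_cong_AE)
    show "AE p in lborel. ennreal ((cmod (g p))\<^sup>2) = liminf (\<lambda>n. ennreal ((cmod (F n p))\<^sup>2))"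
      using assms(2)
    proof eventually_elim
      case (elim p)
      then have "(\<lambda>n. ennreal ((cmod (F n p))\<^sup>2)) \<longlonglongrightarrow> ennreal ((cmod (g p))\<^sup>2)"
        by (intro tendsto_ennrealI tendsto_intros)
      then show ?case by (rule lim_imp_Liminf[symmetric, rotated]) simp
    qed
  qed
  also have "\<dots> \<le> liminf (\<lambda>n. \<integral>\<^sup>+p. ennreal ((cmod (F n p))\<^sup>2) \<partial>lborel)"
    by (rule nn_integral_liminf) simp
  also have "\<dots> \<le> ennreal (c\<^sup>2)"
  proof (rule Liminf_le)
    show "\<forall>\<^sub>F n in sequentially. (\<integral>\<^sup>+p. ennreal ((cmod (F n p))\<^sup>2) \<partial>lborel) \<le> ennreal (c\<^sup>2)"
      using b by eventually_elim (use assms(1) in \<open>auto simp: nn_integral_L2 intro!: ennreal_leI power_mono\<close>)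
  qed simp
  finally have "(\<integral>\<^sup>+p. ennreal ((cmod (g p))\<^sup>2) \<partial>lborel) \<le> ennreal (c\<^sup>2)" .
  from L2_normI[OF g this \<open>c \<ge> 0\<close>] show "g \<in> L2" "L2_norm g \<le> c" .
qed

text \<open>Riesz-Fischer. Along a subsequence the differences \<open>d k\<close> have norm below
  \<open>(1/2) ^ k\<close>, so the sum of \<open>2 ^ k * (cmod (d k p))\<^sup>2\<close> has finite
  integral; its finiteness at almost every \<open>p\<close> forces absolute convergence of the
  telescoping series.\<close>

lemma L2_complete:
  fixes F :: "nat \<Rightarrow> 'a::euclidean_space \<Rightarrow> complex"
  assumes F: "\<And>n. F n \<in> L2"
    and Cauchy: "\<And>e. e > 0 \<Longrightarrow> \<exists>N. \<forall>m\<ge>N. \<forall>n\<ge>N. L2_norm (\<lambda>p. F m p - F n p) < e"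
  obtains g where "g \<in> L2" "(\<lambda>n. L2_norm (\<lambda>p. F n p - g p)) \<longlonglongrightarrow> 0"
proof -
  have [measurable]: "F n \<in> borel_measurable borel" for n using F by (rule L2_measurable)
  have "\<exists>N. \<forall>k. \<forall>m\<ge>N k. \<forall>n\<ge>N k. L2_norm (\<lambda>p. F m p - F n p) < (1/2) ^ k"
    using Cauchy[of "(1/2) ^ k" for k] by (intro choice) simp
  then obtain N where N: "\<And>k m n. m \<ge> N k \<Longrightarrow> n \<ge> N k \<Longrightarrow> L2_norm (\<lambda>p. F m p - F n p) < (1/2) ^ k"
    by metis
  \<comment> \<open>Summing the thresholds makes the indices nondecreasing while keeping
    \<open>r k \<ge> N k\<close>.\<close>
  define r where "r k = (\<Sum>i\<le>k. N i)" for k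
  have r: "r k \<ge> N k" "r (Suc k) \<ge> r k" for k
    by (auto simp: r_def intro: member_le_sum)
  then have rN: "r (Suc k) \<ge> N k" for k using le_trans by blast
  define d where "d k p = F (r (Suc k)) p - F (r k) p" for k p
  have d: "d k \<in> L2" "L2_norm (d k) < (1/2) ^ k" for k
    unfolding d_def using N[OF rN r(1)] F by (auto intro: L2_diff)
  have [measurable]: "d k \<in> borel_measurable borel" for k using d by (auto dest: L2_measurable)
  have "(\<integral>\<^sup>+p. (\<Sum>k. ennreal (2 ^ k * (cmod (d k p))\<^sup>2)) \<partial>lborel)
      = (\<Sum>k. \<integral>\<^sup>+p. ennreal (2 ^ k * (cmod (d k p))\<^sup>2) \<partial>lborel)"
    by (rule nn_integral_suminf) simp
  also have "\<dots> \<le> (\<Sum>k. ennreal ((1/2) ^ k))"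
  proof (rule suminf_le)
    fix k
    have "(\<integral>\<^sup>+p. ennreal (2 ^ k * (cmod (d k p))\<^sup>2) \<partial>lborel)
        = ennreal (2 ^ k) * (\<integral>\<^sup>+p. ennreal ((cmod (d k p))\<^sup>2) \<partial>lborel)"
      by (subst nn_integral_cmult[symmetric]) (simp_all add: ennreal_mult)
    also have "\<dots> = ennreal (2 ^ k * (L2_norm (d k))\<^sup>2)"
      by (simp add: nn_integral_L2[OF d(1)] ennreal_mult)
    also have "\<dots> \<le> ennreal ((1/2) ^ k)"
    proof (rule ennreal_leI)
      have "(L2_norm (d k))\<^sup>2 \<le> ((1/2) ^ k)\<^sup>2" using d(2)[of k] by (intro power_mono) auto
      then have "2 ^ k * (L2_norm (d k))\<^sup>2 \<le> 2 ^ k * ((1/2) ^ k)\<^sup>2" by simp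
      also have "\<dots> = (1/2) ^ k" by (simp add: power2_eq_square power_divide)
      finally show "2 ^ k * (L2_norm (d k))\<^sup>2 \<le> (1/2) ^ k" .
    qed
    finally show "(\<integral>\<^sup>+p. ennreal (2 ^ k * (cmod (d k p))\<^sup>2) \<partial>lborel) \<le> ennreal ((1/2) ^ k)" .
  qed auto
  also have "\<dots> = ennreal (\<Sum>k. (1/2) ^ k)"
    by (rule suminf_ennreal2) (auto intro: summable_geometric)
  also have "\<dots> < \<infinity>" by simp
  finally have "AE p in lborel. (\<Sum>k. ennreal (2 ^ k * (cmod (d k p))\<^sup>2)) \<noteq> \<infinity>"
    by (intro nn_integral_PInf_AE) auto
  then have AE_conv: "AE p in lborel. convergent (\<lambda>k. F (r k) p)"
  proof eventually_elim
    case (elim p)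
    then have s: "summable (\<lambda>k. 2 ^ k * (cmod (d k p))\<^sup>2)"
      by (intro summable_suminf_not_top) auto
    have "summable (\<lambda>k. cmod (d k p))"
    proof (rule summable_comparison_test')
      show "summable (\<lambda>k. 2 ^ k * (cmod (d k p))\<^sup>2 + (1/2) ^ k)"
        by (intro summable_add s summable_geometric) simp
      fix k :: nat
      \<comment> \<open>Expanding this square and dividing by \<open>2 ^ k\<close> bounds
        \<open>2 * cmod (d k p)\<close> by the weighted square plus \<open>(1/2) ^ k\<close>, both
        of which are summable.\<close>
      have "0 \<le> (2 ^ k * cmod (d k p) - 1)\<^sup>2" by simp
      then have "2 * (2 ^ k * cmod (d k p)) \<le> (2 ^ k * cmod (d k p))\<^sup>2 + 1"
        by (simp add: power2_diff)
      then have "(1/2) ^ k * (2 * (2 ^ k * cmod (d k p))) \<le> (1/2) ^ k * ((2 ^ k * cmod (d k p))\<^sup>2 + 1)"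
        by (intro mult_left_mono) auto
      also have "(1/2) ^ k * (2 * (2 ^ k * cmod (d k p))) = 2 * cmod (d k p)" by (simp add: power_divide)
      also have "(1/2) ^ k * ((2 ^ k * cmod (d k p))\<^sup>2 + 1) = 2 ^ k * (cmod (d k p))\<^sup>2 + (1/2) ^ k"
        by (simp add: power_divide power_mult_distrib distrib_left power2_eq_square)
      finally show "norm (cmod (d k p)) \<le> 2 ^ k * (cmod (d k p))\<^sup>2 + (1/2) ^ k"
        unfolding real_norm_def abs_norm_cancel using norm_ge_zero[of "d k p"] by linarith
    qed
    then have "summable (\<lambda>k. d k p)" by (rule summable_norm_cancel)
    then have "convergent (\<lambda>n. \<Sum>k<n. d k p)" by (simp add: summable_iff_convergent)
    then have "convergent (\<lambda>n. (\<Sum>k<n. d k p) + F (r 0) p)"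
      by (rule convergent_add[OF _ convergent_const])
    moreover have "(\<Sum>k<n. d k p) + F (r 0) p = F (r n) p" for n
      unfolding d_def sum_lessThan_telescope[of "\<lambda>k. F (r k) p"] by simp
    ultimately show ?case by simp
  qed
  define g where "g p = lim (\<lambda>k. F (r k) p)" for p
  have [measurable]: "g \<in> borel_measurable borel"
    unfolding g_def by (rule borel_measurable_lim_metric) simp
  have g: "AE p in lborel. (\<lambda>k. F (r k) p) \<longlonglongrightarrow> g p"
    using AE_conv by eventually_elim (simp add: g_def convergent_LIMSEQ_iff)
  have close: "(\<lambda>p. F n p - g p) \<in> L2 \<and> L2_norm (\<lambda>p. F n p - g p) \<le> (1/2) ^ k" if n: "n \<ge> N k" for n k
  proof -
    have AE: "AE p in lborel. (\<lambda>m. F n p - F (r m) p) \<longlonglongrightarrow> F n p - g p"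
      using g by eventually_elim (intro tendsto_intros)
    have "L2_norm (\<lambda>p. F n p - F (r m) p) \<le> (1/2) ^ k" if "m \<ge> k" for m
    proof -
      have "r m \<ge> r k" by (rule lift_Suc_mono_le[of r, OF r(2) that])
      then have "r m \<ge> N k" using r(1) le_trans by blast
      from N[OF n this] show ?thesis by simp
    qed
    then have "\<forall>\<^sub>F m in sequentially. L2_norm (\<lambda>p. F n p - F (r m) p) \<le> (1/2) ^ k"
      unfolding eventually_sequentially by blast
    from L2_Fatou[OF L2_diff[OF F F] AE _ this] show ?thesis by simp
  qed
  show ?thesis
  proof
    have "(\<lambda>p. F (N 0) p - (F (N 0) p - g p)) \<in> L2" by (rule L2_diff[OF F conjunct1[OF close[OF order_refl]]])
    then show "g \<in> L2" by simp
    show "(\<lambda>n. L2_norm (\<lambda>p. F n p - g p)) \<longlonglongrightarrow> 0"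
    proof (rule LIMSEQ_I)
      fix e :: real assume "e > 0"
      then obtain k where k: "(1/2) ^ k < e" using real_arch_pow_inv[of e "1/2"] by auto
      then have "norm (L2_norm (\<lambda>p. F n p - g p) - 0) < e" if "n \<ge> N k" for n
        using close[OF that] by simp
      then show "\<exists>no. \<forall>n\<ge>no. norm (L2_norm (\<lambda>p. F n p - g p) - 0) < e" by blast
    qed
  qed
qed

section \<open>Almost orthogonal sums\<close>

text \<open>
  The far terms decay in \<open>j + k\<close> and not merely in \<open>\<bar>j - k\<bar>\<close>, so the power trick of the Cotlar-Stein
  lemma is not needed: far terms sum geometrically, and near terms are bounded by the square function
  of \<open>T\<close>, which is controlled by the Schur test for \<open>Ts\<close>.
\<close>

locale almost_orthogonal =
  fixes T Ts :: "nat \<Rightarrow> ('a::euclidean_space \<Rightarrow> complex) \<Rightarrow> 'a \<Rightarrow> complex"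
    and c :: "nat \<Rightarrow> nat \<Rightarrow> real" and B q :: real and M :: nat
  assumes T_L2: "f \<in> L2 \<Longrightarrow> T j f \<in> L2" and Ts_L2: "f \<in> L2 \<Longrightarrow> Ts j f \<in> L2"
    and adjoint: "f \<in> L2 \<Longrightarrow> g \<in> L2 \<Longrightarrow> ip (T j f) g = ip f (Ts j g)"
    and T_add: "f \<in> L2 \<Longrightarrow> g \<in> L2 \<Longrightarrow> T j (\<lambda>p. f p + g p) p = T j f p + T j g p"
    and T_scale: "f \<in> L2 \<Longrightarrow> T j (\<lambda>p. s * f p) p = s * T j f p"
    and orth: "f \<in> L2 \<Longrightarrow> g \<in> L2 \<Longrightarrow> cmod (ip (T j f) (T k g)) \<le> c j k * (L2_norm f * L2_norm g)"
    and orths: "f \<in> L2 \<Longrightarrow> g \<in> L2 \<Longrightarrow> cmod (ip (Ts j f) (Ts k g)) \<le> c j k * (L2_norm f * L2_norm g)"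
    and c_nonneg: "0 \<le> c j k" and c_near: "c j k \<le> B"
    and c_far: "j + M \<le> k \<or> k + M \<le> j \<Longrightarrow> c j k \<le> B * q ^ (j + k)"
    and c_sym: "c j k = c k j"
    and q: "0 < q" "q < 1"
begin

lemma B_nonneg: "B \<ge> 0"
  using c_nonneg[of 0 0] c_near[of 0 0] by simp

abbreviation near :: "nat \<Rightarrow> nat \<Rightarrow> bool" where "near j k \<equiv> j < k + M \<and> k < j + M"

lemma c_le: "c j k \<le> (if near j k then B else 0) + B * (q ^ j * q ^ k)"
proof -
  have "0 \<le> B * (q ^ j * q ^ k)" using B_nonneg q by simp
  then show ?thesis using c_near[of j k] c_far[of j k] by (auto simp: power_add not_less)
qed

lemma sum_near:
  assumes "finite J" "x \<ge> 0"
  shows "(\<Sum>k\<in>J. if near j k then x else 0) \<le> 2 * real M * (x::real)"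
proof -
  have "(\<Sum>k\<in>J. if near j k then x else 0) = (\<Sum>k\<in>{k\<in>J. near j k}. x)"
    using assms by (intro sum.inter_filter[symmetric])
  also have "\<dots> = real (card {k\<in>J. near j k}) * x" by simp
  also have "\<dots> \<le> real (2 * M) * x"
  proof (intro mult_right_mono of_nat_mono)
    have "card {k\<in>J. near j k} \<le> card {j - M..<j + M}" by (intro card_mono) auto
    then show "card {k\<in>J. near j k} \<le> 2 * M" by simp
  qed fact
  finally show ?thesis by simp
qed

lemma sum_q: "finite J \<Longrightarrow> (\<Sum>k\<in>J. q ^ k) \<le> 1 / (1 - q)"
  using sum_le_suminf[OF summable_geometric, of q J] q suminf_geometric[of q] by simp

text \<open>A bound for the row sums of \<open>c\<close>: at most \<open>2 * M\<close> near indices,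
  plus a geometric series.\<close>

definition D :: real where "D = 2 * real M * B + B / (1 - q)"

lemma D_nonneg: "D \<ge> 0"
  using B_nonneg q by (simp add: D_def)

lemma row_sum:
  assumes J: "finite J"
  shows "(\<Sum>k\<in>J. c j k) \<le> D"
proof -
  have "(\<Sum>k\<in>J. c j k) \<le> (\<Sum>k\<in>J. if near j k then B else 0) + (\<Sum>k\<in>J. B * (q ^ j * q ^ k))"
    unfolding sum.distrib[symmetric] by (intro sum_mono c_le)
  also have "(\<Sum>k\<in>J. B * (q ^ j * q ^ k)) \<le> (\<Sum>k\<in>J. B * q ^ k)"
    using q B_nonneg by (intro sum_mono mult_left_mono mult_left_le_one_le) (auto simp: power_le_one)
  also have "\<dots> = B * (\<Sum>k\<in>J. q ^ k)" by (simp add: sum_distrib_left)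
  also have "\<dots> \<le> B * (1 / (1 - q))" using sum_q[OF J] B_nonneg by (intro mult_left_mono) auto
  also have "(\<Sum>k\<in>J. if near j k then B else 0) \<le> 2 * real M * B" by (rule sum_near[OF J B_nonneg])
  finally show ?thesis by (simp add: D_def)
qed

lemma Schur_sum:
  assumes J: "finite J" and v: "\<And>j. v j \<ge> 0"
  shows "(\<Sum>j\<in>J. \<Sum>k\<in>J. c j k * (v j * v k)) \<le> D * (\<Sum>j\<in>J. (v j)\<^sup>2)"
proof -
  have "(\<Sum>j\<in>J. \<Sum>k\<in>J. c j k * (v j * v k)) \<le> (\<Sum>j\<in>J. \<Sum>k\<in>J. c j k * ((v j)\<^sup>2 / 2 + (v k)\<^sup>2 / 2))"
  proof (intro sum_mono mult_left_mono c_nonneg)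
    fix j k show "v j * v k \<le> (v j)\<^sup>2 / 2 + (v k)\<^sup>2 / 2" using sum_squares_bound[of "v j" "v k"] by simp
  qed
  also have "\<dots> = (\<Sum>j\<in>J. \<Sum>k\<in>J. c j k * ((v j)\<^sup>2 / 2)) + (\<Sum>j\<in>J. \<Sum>k\<in>J. c j k * ((v k)\<^sup>2 / 2))"
    by (simp add: distrib_left sum.distrib)
  also have "(\<Sum>j\<in>J. \<Sum>k\<in>J. c j k * ((v k)\<^sup>2 / 2)) = (\<Sum>k\<in>J. \<Sum>j\<in>J. c k j * ((v k)\<^sup>2 / 2))"
    by (subst sum.swap) (simp only: c_sym)
  also have "(\<Sum>j\<in>J. \<Sum>k\<in>J. c j k * ((v j)\<^sup>2 / 2)) + (\<Sum>k\<in>J. \<Sum>j\<in>J. c k j * ((v k)\<^sup>2 / 2))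
      = (\<Sum>j\<in>J. (\<Sum>k\<in>J. c j k) * (v j)\<^sup>2)"
    by (simp add: sum_distrib_right flip: sum.distrib)
  also have "\<dots> \<le> (\<Sum>j\<in>J. D * (v j)\<^sup>2)" by (intro sum_mono mult_right_mono row_sum J) simp
  finally show ?thesis by (simp add: sum_distrib_left)
qed

text \<open>Duality: \<open>Q\<close> is the inner product of \<open>f\<close> with
  \<open>G\<close>, the sum of all \<open>Ts j (T j f)\<close>. The Schur test bounds the squared
  norm of \<open>G\<close> by \<open>D * Q\<close>, and one factor \<open>Q\<close> cancels.\<close>

lemma square_function:
  assumes f: "f \<in> L2" and J: "finite J"
  shows "(\<Sum>j\<in>J. (L2_norm (T j f))\<^sup>2) \<le> D * (L2_norm f)\<^sup>2"
proof -
  define Q where "Q = (\<Sum>j\<in>J. (L2_norm (T j f))\<^sup>2)"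
  define G where "G p = (\<Sum>j\<in>J. Ts j (T j f) p)" for p
  have Q0: "Q \<ge> 0" by (simp add: Q_def sum_nonneg)
  have TsT: "Ts j (T j f) \<in> L2" for j using f by (intro Ts_L2 T_L2)
  have G: "G \<in> L2" unfolding G_def using TsT by (intro L2_sum)
  have "of_real Q = (\<Sum>j\<in>J. ip f (Ts j (T j f)))"
    unfolding Q_def of_real_sum ip_self[symmetric] using adjoint[OF f T_L2[OF f]] by simp
  also have "\<dots> = ip f G" unfolding G_def by (rule ip_sum_right[OF TsT f, symmetric])
  finally have "Q = cmod (ip f G)" using Q0 by (metis abs_of_nonneg norm_of_real)
  also have "\<dots> \<le> L2_norm f * L2_norm G" by (rule norm_ip_le[OF f G])
  finally have 1: "Q\<^sup>2 \<le> (L2_norm f)\<^sup>2 * (L2_norm G)\<^sup>2"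
    using Q0 power_mono[of Q "L2_norm f * L2_norm G" 2] by (simp add: power_mult_distrib)
  have "(L2_norm G)\<^sup>2 \<le> (\<Sum>j\<in>J. \<Sum>k\<in>J. cmod (ip (Ts j (T j f)) (Ts k (T k f))))"
    unfolding G_def by (rule L2_norm_sum_le[OF J TsT])
  also have "\<dots> \<le> (\<Sum>j\<in>J. \<Sum>k\<in>J. c j k * (L2_norm (T j f) * L2_norm (T k f)))"
    by (intro sum_mono orths T_L2 f)
  also have "\<dots> \<le> D * Q" unfolding Q_def by (rule Schur_sum[OF J]) simp
  finally have "Q\<^sup>2 \<le> (L2_norm f)\<^sup>2 * (D * Q)"
    using 1 mult_left_mono[of "(L2_norm G)\<^sup>2" "D * Q" "(L2_norm f)\<^sup>2"] by simp
  then have "Q * Q \<le> (D * (L2_norm f)\<^sup>2) * Q" by (simp add: power2_eq_square mult_ac)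
  then show ?thesis using Q0 D_nonneg unfolding Q_def[symmetric]
    by (cases "Q = 0") auto
qed

text \<open>The right side is left as two sums over \<open>J\<close>: for arbitrary \<open>J\<close>
  they give the uniform bound, and for tails \<open>{m<..n}\<close> they give the Cauchy
  property.\<close>

lemma sum_norm_bound:
  assumes f: "f \<in> L2" and J: "finite J"
  shows "(L2_norm (\<lambda>p. \<Sum>j\<in>J. T j f p))\<^sup>2
    \<le> 2 * real M * (\<Sum>j\<in>J. (L2_norm (T j f))\<^sup>2) + B * (L2_norm f)\<^sup>2 * (\<Sum>j\<in>J. q ^ j)\<^sup>2"
proof -
  define v where "v j = L2_norm (T j f)" for j
  \<comment> \<open>The conditions \<open>near j k\<close> and \<open>near k j\<close> are
    equivalent; the swapped form lets \<open>sum.swap\<close> identify the second double sum with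
    the first.\<close>
  have ip_le: "cmod (ip (T j f) (T k f)) \<le> (if near j k then (v j)\<^sup>2 / 2 else 0)
      + (if near k j then (v k)\<^sup>2 / 2 else 0) + B * (q ^ j * q ^ k) * (L2_norm f)\<^sup>2" for j k
  proof (cases "near j k")
    case True
    have "cmod (ip (T j f) (T k f)) \<le> v j * v k" unfolding v_def by (intro norm_ip_le T_L2 f)
    also have "\<dots> \<le> (v j)\<^sup>2 / 2 + (v k)\<^sup>2 / 2" using sum_squares_bound[of "v j" "v k"] by simp
    finally show ?thesis using True B_nonneg q
      by (auto intro!: order_trans[OF _ add_increasing2[of "B * (q ^ j * q ^ k) * (L2_norm f)\<^sup>2"]])
  next
    case False
    have "cmod (ip (T j f) (T k f)) \<le> c j k * (L2_norm f * L2_norm f)" by (intro orth f)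
    also have "\<dots> \<le> B * (q ^ j * q ^ k) * (L2_norm f * L2_norm f)"
      using c_far[of j k] False by (intro mult_right_mono) (auto simp: power_add not_less)
    finally show ?thesis using False by (auto simp: power2_eq_square)
  qed
  have "(L2_norm (\<lambda>p. \<Sum>j\<in>J. T j f p))\<^sup>2 \<le> (\<Sum>j\<in>J. \<Sum>k\<in>J. cmod (ip (T j f) (T k f)))"
    by (rule L2_norm_sum_le[OF J T_L2[OF f]])
  also have "\<dots> \<le> (\<Sum>j\<in>J. \<Sum>k\<in>J. (if near j k then (v j)\<^sup>2 / 2 else 0)
      + (if near k j then (v k)\<^sup>2 / 2 else 0) + B * (q ^ j * q ^ k) * (L2_norm f)\<^sup>2)"
    by (intro sum_mono ip_le)
  also have "\<dots> = (\<Sum>j\<in>J. \<Sum>k\<in>J. (if near j k then (v j)\<^sup>2 / 2 else 0))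
      + (\<Sum>j\<in>J. \<Sum>k\<in>J. (if near k j then (v k)\<^sup>2 / 2 else 0))
      + (\<Sum>j\<in>J. \<Sum>k\<in>J. B * (q ^ j * q ^ k) * (L2_norm f)\<^sup>2)"
    by (simp only: sum.distrib)
  also have "(\<Sum>j\<in>J. \<Sum>k\<in>J. (if near k j then (v k)\<^sup>2 / 2 else 0))
      = (\<Sum>j\<in>J. \<Sum>k\<in>J. (if near j k then (v j)\<^sup>2 / 2 else 0))" by (rule sum.swap)
  also have "(\<Sum>j\<in>J. \<Sum>k\<in>J. B * (q ^ j * q ^ k) * (L2_norm f)\<^sup>2) = B * (L2_norm f)\<^sup>2 * (\<Sum>j\<in>J. q ^ j)\<^sup>2"
    by (simp add: power2_eq_square sum_product sum_distrib_left mult_ac)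
  also have "(\<Sum>j\<in>J. \<Sum>k\<in>J. (if near j k then (v j)\<^sup>2 / 2 else 0)) \<le> (\<Sum>j\<in>J. 2 * real M * ((v j)\<^sup>2 / 2))"
    by (intro sum_mono sum_near J) simp
  finally show ?thesis unfolding v_def by (simp add: sum_distrib_left mult.assoc)
qed

lemma uniform_bound:
  obtains C where "C \<ge> 0" "\<And>f J. f \<in> L2 \<Longrightarrow> finite J \<Longrightarrow> L2_norm (\<lambda>p. \<Sum>j\<in>J. T j f p) \<le> C * L2_norm f"
proof
  define E where "E = 2 * real M * D + B * (1 / (1 - q))\<^sup>2"
  have E: "E \<ge> 0" using D_nonneg B_nonneg by (simp add: E_def)
  then show "sqrt E \<ge> 0" by simp
  fix f :: "'a \<Rightarrow> complex" and J :: "nat set" assume f: "f \<in> L2" and J: "finite J"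
  have "(\<Sum>j\<in>J. q ^ j)\<^sup>2 \<le> (1 / (1 - q))\<^sup>2"
    using sum_q[OF J] q by (intro power_mono sum_nonneg) auto
  then have "B * (L2_norm f)\<^sup>2 * (\<Sum>j\<in>J. q ^ j)\<^sup>2 \<le> B * (L2_norm f)\<^sup>2 * (1 / (1 - q))\<^sup>2"
    using B_nonneg by (intro mult_left_mono) auto
  moreover have "2 * real M * (\<Sum>j\<in>J. (L2_norm (T j f))\<^sup>2) \<le> 2 * real M * (D * (L2_norm f)\<^sup>2)"
    by (intro mult_left_mono square_function f J) simp
  ultimately have "(L2_norm (\<lambda>p. \<Sum>j\<in>J. T j f p))\<^sup>2 \<le> E * (L2_norm f)\<^sup>2"
    using sum_norm_bound[OF f J] by (simp add: E_def algebra_simps)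
  also have "\<dots> = (sqrt E * L2_norm f)\<^sup>2" using E by (simp add: power_mult_distrib)
  finally show "L2_norm (\<lambda>p. \<Sum>j\<in>J. T j f p) \<le> sqrt E * L2_norm f"
    by (rule power2_le_imp_le) (use E in simp)
qed

section \<open>The limit operator\<close>

definition S :: "nat \<Rightarrow> ('a \<Rightarrow> complex) \<Rightarrow> 'a \<Rightarrow> complex" where
  "S n f p = (\<Sum>j\<le>n. T j f p)"

lemma S_L2: "f \<in> L2 \<Longrightarrow> S n f \<in> L2"
  unfolding S_def[abs_def] by (intro L2_sum T_L2)

lemma S_Cauchy:
  assumes f: "f \<in> L2" and e: "e > 0"
  shows "\<exists>N. \<forall>m\<ge>N. \<forall>n\<ge>N. L2_norm (\<lambda>p. S m f p - S n f p) < e"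
proof -
  have tail: "\<exists>N. \<forall>m n. N \<le> m \<longrightarrow> m \<le> n \<longrightarrow> sum u {m<..n} < d"
    if u: "\<And>j. u j \<ge> 0" "summable u" and d: "d > 0" for u :: "nat \<Rightarrow> real" and d
  proof -
    obtain N where N: "\<And>m n. m \<ge> N \<Longrightarrow> norm (sum u {m..<n}) < d"
      using u(2) d unfolding summable_Cauchy by metis
    have "sum u {m<..n} < d" if "N \<le> m" for m n
      using N[of "Suc m" "Suc n"] that by (auto simp: atLeastLessThanSuc_atLeastAtMost atLeastSucAtMost_greaterThanAtMost)
    then show ?thesis by blast
  qed
  have s1: "summable (\<lambda>j. (L2_norm (T j f))\<^sup>2)"
    by (rule bounded_imp_summable[where B = "D * (L2_norm f)\<^sup>2"]) (auto intro: square_function f)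
  have s2: "summable (\<lambda>j. q ^ j)" using q by (simp add: summable_geometric)
  \<comment> \<open>Chosen so that \<open>(2 * M + B * (L2_norm f)\<^sup>2) * d < e\<^sup>2\<close>;
    the summand 1 keeps the denominator positive and the inequality strict. The geometric tail is
    compared with \<open>sqrt d\<close> because it enters squared.\<close>
  define d where "d = e\<^sup>2 / (2 * real M + B * (L2_norm f)\<^sup>2 + 1)"
  have den: "2 * real M + B * (L2_norm f)\<^sup>2 + 1 > 0" using B_nonneg by (simp add: add_nonneg_pos)
  then have d: "d > 0" using e by (simp add: d_def)
  obtain N1 where N1: "\<And>m n. N1 \<le> m \<Longrightarrow> m \<le> n \<Longrightarrow> (\<Sum>j\<in>{m<..n}. (L2_norm (T j f))\<^sup>2) < d"
    using tail[OF _ s1 d] by auto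
  obtain N2 where N2: "\<And>m n. N2 \<le> m \<Longrightarrow> m \<le> n \<Longrightarrow> (\<Sum>j\<in>{m<..n}. q ^ j) < sqrt d"
    using tail[OF _ s2, of "sqrt d"] d q by auto
  have main: "L2_norm (\<lambda>p. S n f p - S m f p) < e" if mn: "max N1 N2 \<le> m" "m \<le> n" for m n
  proof -
    have e1: "S n f p - S m f p = (\<Sum>j\<in>{m<..n}. T j f p)" for p
    proof -
      have "{..n} = {..m} \<union> {m<..n}" using mn by auto
      moreover have "(\<Sum>j\<in>{..m} \<union> {m<..n}. T j f p) = (\<Sum>j\<in>{..m}. T j f p) + (\<Sum>j\<in>{m<..n}. T j f p)"
        by (rule sum.union_disjoint) auto
      ultimately show ?thesis unfolding S_def by simp
    qed
    have "(\<Sum>j\<in>{m<..n}. q ^ j)\<^sup>2 \<le> (sqrt d)\<^sup>2"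
      using N2[of m n] mn q by (intro power_mono sum_nonneg) auto
    then have "B * (L2_norm f)\<^sup>2 * (\<Sum>j\<in>{m<..n}. q ^ j)\<^sup>2 \<le> B * (L2_norm f)\<^sup>2 * d"
      using d B_nonneg by (intro mult_left_mono) auto
    moreover have "2 * real M * (\<Sum>j\<in>{m<..n}. (L2_norm (T j f))\<^sup>2) \<le> 2 * real M * d"
      using N1[of m n] mn by (intro mult_left_mono) auto
    ultimately have "(L2_norm (\<lambda>p. \<Sum>j\<in>{m<..n}. T j f p))\<^sup>2 \<le> (2 * real M + B * (L2_norm f)\<^sup>2) * d"
      using sum_norm_bound[OF f, of "{m<..n}"] by (simp add: distrib_right)
    also have "\<dots> < (2 * real M + B * (L2_norm f)\<^sup>2 + 1) * d" using d by (simp add: distrib_right)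
    also have "\<dots> = e\<^sup>2" using den by (simp add: d_def)
    finally show ?thesis unfolding e1 using e by (simp add: power_less_imp_less_base)
  qed
  have "L2_norm (\<lambda>p. S m f p - S n f p) < e" if "m \<ge> max N1 N2" "n \<ge> max N1 N2" for m n
    using main[of m n] main[of n m] that L2_norm_minus_commute[of "S m f" "S n f"] by (cases "m \<le> n") auto
  then show ?thesis by blast
qed

text \<open>An arbitrary representative of the L2 limit is chosen for each \<open>f\<close>
  separately, which is why additivity and scaling can hold only almost everywhere.\<close>

definition L :: "('a \<Rightarrow> complex) \<Rightarrow> 'a \<Rightarrow> complex" where
  "L f = (SOME g. g \<in> L2 \<and> (\<lambda>n. L2_norm (\<lambda>p. S n f p - g p)) \<longlonglongrightarrow> 0)"

lemma L:
  assumes "f \<in> L2"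
  shows L_L2: "L f \<in> L2" and L_lim: "(\<lambda>n. L2_norm (\<lambda>p. S n f p - L f p)) \<longlonglongrightarrow> 0"
proof -
  obtain g where "g \<in> L2 \<and> (\<lambda>n. L2_norm (\<lambda>p. S n f p - g p)) \<longlonglongrightarrow> 0"
    using L2_complete[OF S_L2[OF assms] S_Cauchy[OF assms]] by blast
  from someI[of "\<lambda>g. g \<in> L2 \<and> (\<lambda>n. L2_norm (\<lambda>p. S n f p - g p)) \<longlonglongrightarrow> 0", OF this]
  show "L f \<in> L2" "(\<lambda>n. L2_norm (\<lambda>p. S n f p - L f p)) \<longlonglongrightarrow> 0" unfolding L_def by auto
qed

lemma L2_lim_unique:
  assumes "\<And>n. F n \<in> L2" "g \<in> L2" "h \<in> L2"
    and "(\<lambda>n. L2_norm (\<lambda>p. F n p - g p)) \<longlonglongrightarrow> 0" "(\<lambda>n. L2_norm (\<lambda>p. F n p - h p)) \<longlonglongrightarrow> 0"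
  shows "AE p in lborel. g p = (h p :: complex)"
proof -
  have "L2_norm (\<lambda>p. g p - h p) \<le> L2_norm (\<lambda>p. F n p - g p) + L2_norm (\<lambda>p. F n p - h p)" for n
    using L2_norm_triangle[of "\<lambda>p. g p - F n p" "\<lambda>p. F n p - h p"] assms
    by (simp add: L2_diff L2_norm_minus_commute[of g "F n"])
  moreover have "(\<lambda>n. L2_norm (\<lambda>p. F n p - g p) + L2_norm (\<lambda>p. F n p - h p)) \<longlonglongrightarrow> 0 + 0"
    using assms by (intro tendsto_add)
  ultimately have "L2_norm (\<lambda>p. g p - h p) \<le> 0 + 0"
    by (intro LIMSEQ_le_const) auto
  then have "L2_norm (\<lambda>p. g p - h p) = 0" using L2_norm_nonneg[of "\<lambda>p. g p - h p"] by linarith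
  then show ?thesis using L2_norm_0_iff[of "\<lambda>p. g p - h p"] assms by (simp add: L2_diff)
qed

lemma S_add: "f \<in> L2 \<Longrightarrow> g \<in> L2 \<Longrightarrow> S n (\<lambda>p. f p + g p) p = S n f p + S n g p"
  by (simp add: S_def T_add sum.distrib)

lemma S_scale: "f \<in> L2 \<Longrightarrow> S n (\<lambda>p. s * f p) p = s * S n f p"
  by (simp add: S_def T_scale sum_distrib_left)

lemma bounded_L: "bounded_L2_operator L"
  unfolding bounded_L2_operator_def
proof (intro conjI ballI allI)
  fix f g :: "'a \<Rightarrow> complex" assume f: "f \<in> L2" and g: "g \<in> L2"
  show "L f \<in> L2" by (rule L_L2[OF f])
  note fg = L2_add[OF f g]
  show "AE p in lborel. L (\<lambda>q. f q + g q) p = L f p + L g p"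
  proof (rule L2_lim_unique[OF S_L2[OF fg] L_L2[OF fg] L2_add[OF L_L2[OF f] L_L2[OF g]] L_lim[OF fg]])
    have b: "L2_norm (\<lambda>p. S n (\<lambda>p. f p + g p) p - (L f p + L g p))
        \<le> L2_norm (\<lambda>p. S n f p - L f p) + L2_norm (\<lambda>p. S n g p - L g p)" for n
      using L2_norm_triangle[of "\<lambda>p. S n f p - L f p" "\<lambda>p. S n g p - L g p"] f g
      by (simp add: L2_diff S_L2 L_L2 S_add algebra_simps)
    have "(\<lambda>n. L2_norm (\<lambda>p. S n f p - L f p) + L2_norm (\<lambda>p. S n g p - L g p)) \<longlonglongrightarrow> 0 + 0"
      by (intro tendsto_add L_lim f g)
    then have lim: "(\<lambda>n. L2_norm (\<lambda>p. S n f p - L f p) + L2_norm (\<lambda>p. S n g p - L g p)) \<longlonglongrightarrow> 0"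
      by simp
    show "(\<lambda>n. L2_norm (\<lambda>p. S n (\<lambda>p. f p + g p) p - (L f p + L g p))) \<longlonglongrightarrow> 0"
      by (rule tendsto_sandwich[OF _ _ tendsto_const lim]) (use b in auto)
  qed
  fix s
  note sf = L2_scale[OF f, of s]
  show "AE p in lborel. L (\<lambda>q. s * f q) p = s * L f p"
  proof (rule L2_lim_unique[OF S_L2[OF sf] L_L2[OF sf] L2_scale[OF L_L2[OF f]] L_lim[OF sf]])
    have "L2_norm (\<lambda>p. S n (\<lambda>p. s * f p) p - s * L f p) = cmod s * L2_norm (\<lambda>p. S n f p - L f p)" for n
      using L2_norm_scale[of s "\<lambda>p. S n f p - L f p"] f by (simp add: S_scale right_diff_distrib)
    then show "(\<lambda>n. L2_norm (\<lambda>p. S n (\<lambda>p. s * f p) p - s * L f p)) \<longlonglongrightarrow> 0"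
      using tendsto_mult_left[OF L_lim[OF f], of "cmod s"] by simp
  qed
next
  obtain C where C: "C \<ge> 0" "\<And>f J. f \<in> L2 \<Longrightarrow> finite J \<Longrightarrow> L2_norm (\<lambda>p. \<Sum>j\<in>J. T j f p) \<le> C * L2_norm f"
    using uniform_bound by blast
  show "\<exists>C. \<forall>f\<in>L2. L2_norm (L f) \<le> C * L2_norm f"
  proof (intro exI ballI)
    fix f :: "'a \<Rightarrow> complex" assume f: "f \<in> L2"
    have "L2_norm (S n f) \<le> C * L2_norm f" for n
      using C(2)[OF f, of "{..n}"] by (simp add: S_def[abs_def])
    moreover have "L2_norm (L f) \<le> L2_norm (S n f) + L2_norm (\<lambda>p. S n f p - L f p)" for n
      using L2_norm_triangle[of "S n f" "\<lambda>p. L f p - S n f p"] f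
      by (simp add: L2_diff S_L2 L_L2 L2_norm_minus_commute[of "L f"])
    ultimately have "L2_norm (L f) \<le> C * L2_norm f + L2_norm (\<lambda>p. S n f p - L f p)" for n
      by (meson add_right_mono order_trans)
    moreover have "(\<lambda>n. C * L2_norm f + L2_norm (\<lambda>p. S n f p - L f p)) \<longlonglongrightarrow> C * L2_norm f + 0"
      by (intro tendsto_add tendsto_const L_lim f)
    ultimately have "L2_norm (L f) \<le> C * L2_norm f + 0"
      by (intro LIMSEQ_le_const) auto
    then show "L2_norm (L f) \<le> C * L2_norm f" by simp
  qed
qed

text \<open>The differences \<open>S n f - L f\<close> tend pointwise to \<open>u - L f\<close>
  while their norms tend to zero, so \<open>L2_Fatou\<close> makes \<open>u - L f\<close> vanish
  almost everywhere. This ties the abstract operator to the convolution with a distribution, which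
  is defined pointwise.\<close>

lemma L_eq_pointwise_limit:
  assumes f: "f \<in> L2" and u: "\<And>p. (\<lambda>n. S n f p) \<longlonglongrightarrow> u p"
  shows "AE p in lborel. L f p = u p"
proof -
  have [measurable]: "S n f \<in> borel_measurable borel" for n using S_L2[OF f] by (rule L2_measurable)
  have [measurable]: "L f \<in> borel_measurable borel" using L_L2[OF f] by (rule L2_measurable)
  have [measurable]: "u \<in> borel_measurable borel"
    by (rule borel_measurable_LIMSEQ_metric[of "\<lambda>n. S n f"]) (use u in auto)
  have small: "(\<lambda>p. u p - L f p) \<in> L2 \<and> L2_norm (\<lambda>p. u p - L f p) \<le> e" if e: "e > 0" for e
  proof -
    have "\<forall>\<^sub>F n in sequentially. L2_norm (\<lambda>p. S n f p - L f p) \<le> e"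
      using order_tendstoD(2)[OF L_lim[OF f] e] by (rule eventually_mono) simp
    moreover have "AE p in lborel. (\<lambda>n. S n f p - L f p) \<longlonglongrightarrow> u p - L f p"
      by (intro AE_I2 tendsto_intros u)
    ultimately show ?thesis
      using L2_Fatou[of "\<lambda>n p. S n f p - L f p" "\<lambda>p. u p - L f p" e] e f
      by (simp add: L2_diff S_L2 L_L2)
  qed
  have "L2_norm (\<lambda>p. u p - L f p) \<le> 0" by (rule dense_ge) (use small in blast)
  then have "L2_norm (\<lambda>p. u p - L f p) = 0" using L2_norm_nonneg[of "\<lambda>p. u p - L f p"] by linarith
  then have "AE p in lborel. u p - L f p = 0" using L2_norm_0_iff small[OF zero_less_one] by blast
  then show ?thesis by eventually_elim simp
qed

end

section \<open>Convolution operators\<close>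

lemma measurable_cnj [measurable (raw)]:
  "f \<in> borel_measurable M \<Longrightarrow> (\<lambda>x. cnj (f x)) \<in> borel_measurable M"
  by (rule borel_measurable_continuous_on[OF continuous_on_cnj[OF continuous_on_id]])

definition conv :: "real \<Rightarrow> ('n::finite heis \<Rightarrow> complex) \<Rightarrow> ('n heis \<Rightarrow> complex) \<Rightarrow> 'n heis \<Rightarrow> complex" where
  "conv a K f p = (LINT z|lborel. K z * f (heis_mult a p (heis_inv z)))"

lemma heis_mult_inv_cancel [simp]:
  "heis_mult a (heis_mult a p z) (heis_inv z) = p" "heis_mult a (heis_mult a p (heis_inv z)) z = p"
  by (simp_all add: heis_mult_assoc heis_mult_inv_right heis_mult_inv_left)

lemma norm_integral_le_nn_integral:
  fixes f :: "'a \<Rightarrow> complex"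
  shows "ennreal (cmod (integral\<^sup>L M f)) \<le> (\<integral>\<^sup>+x. ennreal (cmod (f x)) \<partial>M)"
  by (cases "integrable M f") (auto intro: integral_norm_bound_ennreal simp: not_integrable_integral_eq)

lemma L2_preserving:
  assumes T: "distr lborel borel T = lborel" "T \<in> borel_measurable borel" and f: "f \<in> L2"
  shows "(\<lambda>z. f (T z)) \<in> L2" "L2_norm (\<lambda>z. f (T z)) = L2_norm f"
proof -
  have [measurable]: "f \<in> borel_measurable borel" "T \<in> borel_measurable borel"
    using f T by (auto dest: L2_measurable)
  have e: "(\<integral>\<^sup>+z. ennreal ((cmod (f (T z)))\<^sup>2) \<partial>lborel) = ennreal ((L2_norm f)\<^sup>2)"
    using nn_integral_preserving[OF T, of "\<lambda>z. ennreal ((cmod (f z))\<^sup>2)"] by (simp add: nn_integral_L2[OF f])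
  then show 1: "(\<lambda>z. f (T z)) \<in> L2" by (intro L2_normI(1)[of _ "L2_norm f"]) auto
  show "L2_norm (\<lambda>z. f (T z)) = L2_norm f" using e unfolding nn_integral_L2[OF 1] by simp
qed

text \<open>Cauchy-Schwarz after splitting \<open>cmod (K z)\<close> into two square roots, then
  Fubini and right invariance. In this form with nonnegative integrals the inequality can itself
  justify the exchange of integrals in \<open>conv_conv\<close>.\<close>

lemma nn_Young:
  fixes K f :: "'n::finite heis \<Rightarrow> complex"
  assumes [measurable]: "K \<in> borel_measurable borel" "f \<in> borel_measurable borel"
  shows "(\<integral>\<^sup>+p. (\<integral>\<^sup>+z. ennreal (cmod (K z) * cmod (f (heis_mult a p (heis_inv z)))) \<partial>lborel)\<^sup>2 \<partial>lborel)
    \<le> (\<integral>\<^sup>+z. ennreal (cmod (K z)) \<partial>lborel)\<^sup>2 * (\<integral>\<^sup>+p. ennreal ((cmod (f p))\<^sup>2) \<partial>lborel)"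
proof -
  define k where "k = (\<integral>\<^sup>+z. ennreal (cmod (K z)) \<partial>lborel)"
  have CS: "(\<integral>\<^sup>+z. ennreal (cmod (K z) * cmod (f (heis_mult a p (heis_inv z)))) \<partial>lborel)\<^sup>2
     \<le> k * (\<integral>\<^sup>+z. ennreal (cmod (K z) * (cmod (f (heis_mult a p (heis_inv z))))\<^sup>2) \<partial>lborel)" for p
  proof -
    have "(\<integral>\<^sup>+z. ennreal (sqrt (cmod (K z))) * ennreal (sqrt (cmod (K z)) * cmod (f (heis_mult a p (heis_inv z)))) \<partial>lborel)\<^sup>2
      \<le> (\<integral>\<^sup>+z. (ennreal (sqrt (cmod (K z))))\<^sup>2 \<partial>lborel)
        * (\<integral>\<^sup>+z. (ennreal (sqrt (cmod (K z)) * cmod (f (heis_mult a p (heis_inv z)))))\<^sup>2 \<partial>lborel)"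
      by (rule Cauchy_Schwarz_nn_integral) measurable
    then show ?thesis
      by (simp add: ennreal_power power_mult_distrib k_def flip: ennreal_mult mult.assoc)
  qed
  have "(\<integral>\<^sup>+p. (\<integral>\<^sup>+z. ennreal (cmod (K z) * cmod (f (heis_mult a p (heis_inv z)))) \<partial>lborel)\<^sup>2 \<partial>lborel)
      \<le> (\<integral>\<^sup>+p. k * (\<integral>\<^sup>+z. ennreal (cmod (K z) * (cmod (f (heis_mult a p (heis_inv z))))\<^sup>2) \<partial>lborel) \<partial>lborel)"
    by (intro nn_integral_mono CS)
  also have "\<dots> = k * (\<integral>\<^sup>+p. (\<integral>\<^sup>+z. ennreal (cmod (K z) * (cmod (f (heis_mult a p (heis_inv z))))\<^sup>2) \<partial>lborel) \<partial>lborel)"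
    by (rule nn_integral_cmult) measurable
  also have "(\<integral>\<^sup>+p. (\<integral>\<^sup>+z. ennreal (cmod (K z) * (cmod (f (heis_mult a p (heis_inv z))))\<^sup>2) \<partial>lborel) \<partial>lborel)
      = (\<integral>\<^sup>+z. (\<integral>\<^sup>+p. ennreal (cmod (K z) * (cmod (f (heis_mult a p (heis_inv z))))\<^sup>2) \<partial>lborel) \<partial>lborel)"
    by (rule lborel_pair.Fubini') measurable
  also have "\<dots> = (\<integral>\<^sup>+z. ennreal (cmod (K z)) * (\<integral>\<^sup>+p. ennreal ((cmod (f p))\<^sup>2) \<partial>lborel) \<partial>lborel)"
  proof (rule nn_integral_cong)
    fix z :: "'n heis"
    have "(\<integral>\<^sup>+p. ennreal (cmod (K z) * (cmod (f (heis_mult a p (heis_inv z))))\<^sup>2) \<partial>lborel)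
        = ennreal (cmod (K z)) * (\<integral>\<^sup>+p. ennreal ((cmod (f (heis_mult a p (heis_inv z))))\<^sup>2) \<partial>lborel)"
      by (simp add: ennreal_mult nn_integral_cmult)
    also have "(\<integral>\<^sup>+p. ennreal ((cmod (f (heis_mult a p (heis_inv z))))\<^sup>2) \<partial>lborel) = (\<integral>\<^sup>+p. ennreal ((cmod (f p))\<^sup>2) \<partial>lborel)"
      by (rule nn_integral_preserving[OF distr_right, where f = "\<lambda>p. ennreal ((cmod (f p))\<^sup>2)"]) measurable
    finally show "(\<integral>\<^sup>+p. ennreal (cmod (K z) * (cmod (f (heis_mult a p (heis_inv z))))\<^sup>2) \<partial>lborel)
        = ennreal (cmod (K z)) * (\<integral>\<^sup>+p. ennreal ((cmod (f p))\<^sup>2) \<partial>lborel)" .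
  qed
  also have "\<dots> = k * (\<integral>\<^sup>+p. ennreal ((cmod (f p))\<^sup>2) \<partial>lborel)"
    unfolding k_def by (rule nn_integral_multc) measurable
  finally show ?thesis by (simp add: k_def power2_eq_square mult.assoc)
qed

lemma conv_measurable [measurable]:
  fixes K f :: "'n::finite heis \<Rightarrow> complex"
  assumes [measurable]: "K \<in> borel_measurable borel" "f \<in> borel_measurable borel"
  shows "conv a K f \<in> borel_measurable borel"
  unfolding conv_def[abs_def] by (rule lborel.borel_measurable_lebesgue_integral) measurable

lemma Young:
  fixes K f :: "'n::finite heis \<Rightarrow> complex"
  assumes K [measurable]: "K \<in> borel_measurable borel" and f: "f \<in> L2"
    and c: "(\<integral>\<^sup>+z. ennreal (cmod (K z)) \<partial>lborel) \<le> ennreal c" "c \<ge> 0"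
  shows "conv a K f \<in> L2" "L2_norm (conv a K f) \<le> c * L2_norm f"
proof -
  have [measurable]: "f \<in> borel_measurable borel" using f by (rule L2_measurable)
  have "(\<integral>\<^sup>+p. ennreal ((cmod (conv a K f p))\<^sup>2) \<partial>lborel)
     \<le> (\<integral>\<^sup>+p. (\<integral>\<^sup>+z. ennreal (cmod (K z) * cmod (f (heis_mult a p (heis_inv z)))) \<partial>lborel)\<^sup>2 \<partial>lborel)"
  proof (rule nn_integral_mono)
    fix p :: "'n heis"
    have "ennreal (cmod (conv a K f p)) \<le> (\<integral>\<^sup>+z. ennreal (cmod (K z) * cmod (f (heis_mult a p (heis_inv z)))) \<partial>lborel)"
      unfolding conv_def using norm_integral_le_nn_integral[of lborel "\<lambda>z. K z * f (heis_mult a p (heis_inv z))"]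
      by (simp add: norm_mult)
    then have "(ennreal (cmod (conv a K f p)))\<^sup>2 \<le> (\<integral>\<^sup>+z. ennreal (cmod (K z) * cmod (f (heis_mult a p (heis_inv z)))) \<partial>lborel)\<^sup>2"
      by (intro power_mono) auto
    then show "ennreal ((cmod (conv a K f p))\<^sup>2)
      \<le> (\<integral>\<^sup>+z. ennreal (cmod (K z) * cmod (f (heis_mult a p (heis_inv z)))) \<partial>lborel)\<^sup>2"
      by (simp add: ennreal_power)
  qed
  also have "\<dots> \<le> (\<integral>\<^sup>+z. ennreal (cmod (K z)) \<partial>lborel)\<^sup>2 * (\<integral>\<^sup>+p. ennreal ((cmod (f p))\<^sup>2) \<partial>lborel)"
    by (rule nn_Young) measurable
  also have "\<dots> \<le> (ennreal c)\<^sup>2 * (\<integral>\<^sup>+p. ennreal ((cmod (f p))\<^sup>2) \<partial>lborel)"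
    by (intro mult_right_mono power_mono c) auto
  also have "\<dots> = ennreal ((c * L2_norm f)\<^sup>2)"
    using c(2) by (simp add: nn_integral_L2[OF f] ennreal_power ennreal_mult power_mult_distrib)
  finally have "(\<integral>\<^sup>+p. ennreal ((cmod (conv a K f p))\<^sup>2) \<partial>lborel) \<le> ennreal ((c * L2_norm f)\<^sup>2)" .
  from L2_normI[OF _ this] show "conv a K f \<in> L2" "L2_norm (conv a K f) \<le> c * L2_norm f"
    using c(2) by simp_all
qed

lemma integrable_nn_le:
  fixes K :: "'a::euclidean_space \<Rightarrow> complex"
  assumes "integrable lborel K"
  shows "(\<integral>\<^sup>+z. ennreal (cmod (K z)) \<partial>lborel) \<le> ennreal (LINT z|lborel. cmod (K z))"
  using assms by (subst nn_integral_eq_integral) auto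

lemma conv_L2: "integrable lborel K \<Longrightarrow> f \<in> L2 \<Longrightarrow> conv a K f \<in> L2"
  by (rule Young(1)[OF _ _ integrable_nn_le]) (auto dest: borel_measurable_integrable)

text \<open>With \<open>K\<close> in L2 the integral converges at every \<open>p\<close>, so that
  \<open>conv_add\<close> holds pointwise and not just almost everywhere.\<close>

lemma conv_integrable:
  assumes "K \<in> L2" "f \<in> L2"
  shows "integrable lborel (\<lambda>z. K z * f (heis_mult a p (heis_inv z)))"
  by (rule L2_prod_integrable[OF assms(1) L2_preserving(1)[OF distr_mult_inv _ assms(2)]]) measurable

lemma conv_add:
  assumes "K \<in> L2" "f \<in> L2" "g \<in> L2"
  shows "conv a K (\<lambda>p. f p + g p) p = conv a K f p + conv a K g p"
  unfolding conv_def distrib_left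
  by (rule Bochner_Integration.integral_add) (intro conv_integrable assms)+

lemma conv_scale:
  shows "conv a K (\<lambda>p. s * f p) p = s * conv a K f p"
  unfolding conv_def by (subst integral_mult_right_zero[symmetric]) (simp add: mult_ac)

text \<open>Once the integral over \<open>p\<close> is the inner one, a right translation by
  \<open>z\<close> moves the group shift from \<open>f\<close> to \<open>h\<close>; inverting
  \<open>z\<close> then restores the form of a convolution.\<close>

lemma conv_adjoint:
  fixes K f h :: "'n::finite heis \<Rightarrow> complex"
  assumes K: "integrable lborel K" and f: "f \<in> L2" and h: "h \<in> L2"
  shows "ip (conv a K f) h = ip f (conv a (\<lambda>z. cnj (K (heis_inv z))) h)"
proof -
  have [measurable]: "K \<in> borel_measurable borel" "f \<in> borel_measurable borel" "h \<in> borel_measurable borel"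
    using assms by (auto dest: L2_measurable borel_measurable_integrable)
  \<comment> \<open>Stated for general \<open>F\<close> and \<open>G\<close> because the integrals
    are exchanged twice, once with \<open>f\<close> translated and once with \<open>h\<close>
    translated.\<close>
  have int: "integrable (lborel \<Otimes>\<^sub>M lborel) (case_prod (\<lambda>z p. K z * F z p * G z p))"
    if [measurable]: "(\<lambda>(z, p). F z p) \<in> borel_measurable (lborel \<Otimes>\<^sub>M lborel)"
      "(\<lambda>(z, p). G z p) \<in> borel_measurable (lborel \<Otimes>\<^sub>M lborel)"
    and FG: "\<And>z. F z \<in> L2" "\<And>z. G z \<in> L2" "\<And>z. L2_norm (F z) = L2_norm f" "\<And>z. L2_norm (G z) = L2_norm h"
    for F G :: "'n heis \<Rightarrow> 'n heis \<Rightarrow> complex"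
  proof (rule integrableI_bounded)
    show "case_prod (\<lambda>z p. K z * F z p * G z p) \<in> borel_measurable (lborel \<Otimes>\<^sub>M lborel)" by measurable
    have "(\<integral>\<^sup>+x. ennreal (norm (case_prod (\<lambda>z p. K z * F z p * G z p) x)) \<partial>(lborel \<Otimes>\<^sub>M lborel))
        = (\<integral>\<^sup>+z. \<integral>\<^sup>+p. ennreal (cmod (K z * F z p * G z p)) \<partial>lborel \<partial>lborel)"
      by (subst lborel.nn_integral_fst[symmetric]) auto
    also have "\<dots> \<le> (\<integral>\<^sup>+z. ennreal (cmod (K z)) * ennreal (L2_norm f * L2_norm h) \<partial>lborel)"
    proof (rule nn_integral_mono)
      fix z
      have [measurable]: "F z \<in> borel_measurable borel" "G z \<in> borel_measurable borel"
        using FG by (auto dest: L2_measurable)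
      have "(\<integral>\<^sup>+p. ennreal (cmod (K z * F z p * G z p)) \<partial>lborel)
          = ennreal (cmod (K z)) * (\<integral>\<^sup>+p. ennreal (cmod (F z p) * cmod (G z p)) \<partial>lborel)"
        by (subst nn_integral_cmult[symmetric]) (simp_all add: norm_mult mult.assoc flip: ennreal_mult)
      also have "\<dots> \<le> ennreal (cmod (K z)) * ennreal (L2_norm f * L2_norm h)"
        using nn_integral_Cauchy_Schwarz[OF FG(1,2), of z z] FG(3,4) by (intro mult_left_mono) auto
      finally show "(\<integral>\<^sup>+p. ennreal (cmod (K z * F z p * G z p)) \<partial>lborel)
        \<le> ennreal (cmod (K z)) * ennreal (L2_norm f * L2_norm h)" .
    qed
    also have "\<dots> = (\<integral>\<^sup>+z. ennreal (cmod (K z)) \<partial>lborel) * ennreal (L2_norm f * L2_norm h)"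
      by (rule nn_integral_multc) measurable
    also have "\<dots> < \<infinity>" using K by (auto simp: integrable_iff_bounded ennreal_mult_less_top)
    finally show "(\<integral>\<^sup>+x. ennreal (norm (case_prod (\<lambda>z p. K z * F z p * G z p) x)) \<partial>(lborel \<Otimes>\<^sub>M lborel)) < \<infinity>" .
  qed
  have "ip (conv a K f) h = (LINT p|lborel. LINT z|lborel. K z * f (heis_mult a p (heis_inv z)) * cnj (h p))"
    unfolding ip_def conv_def by simp
  also have "\<dots> = (LINT z|lborel. LINT p|lborel. K z * f (heis_mult a p (heis_inv z)) * cnj (h p))"
    by (rule lborel_pair.Fubini_integral, rule int)
      (use L2_preserving[OF distr_right _ f] h in \<open>auto intro: L2_cnj\<close>)
  also have "\<dots> = (LINT z|lborel. LINT p|lborel. K z * f p * cnj (h (heis_mult a p z)))"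
  proof (rule Bochner_Integration.integral_cong[OF refl])
    fix z
    show "(LINT p|lborel. K z * f (heis_mult a p (heis_inv z)) * cnj (h p))
      = (LINT p|lborel. K z * f p * cnj (h (heis_mult a p z)))"
      using integral_preserving[OF distr_right[where a = a and w = z], where f = "\<lambda>p. K z * f (heis_mult a p (heis_inv z)) * cnj (h p)"]
      by simp
  qed
  also have "\<dots> = (LINT p|lborel. LINT z|lborel. K z * f p * cnj (h (heis_mult a p z)))"
    by (rule lborel_pair.Fubini_integral[symmetric], rule int)
      (use L2_preserving[OF distr_right _ L2_cnj[OF h]] f in auto)
  also have "\<dots> = ip f (conv a (\<lambda>z. cnj (K (heis_inv z))) h)"
    unfolding ip_def
  proof (rule Bochner_Integration.integral_cong[OF refl])
    fix p
    have "(LINT z|lborel. K z * f p * cnj (h (heis_mult a p z)))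
        = (LINT z|lborel. K (heis_inv z) * f p * cnj (h (heis_mult a p (heis_inv z))))"
      using integral_preserving[OF distr_inv, of "\<lambda>z. K z * f p * cnj (h (heis_mult a p z))"] by simp
    also have "\<dots> = (LINT z|lborel. f p * cnj (cnj (K (heis_inv z)) * h (heis_mult a p (heis_inv z))))"
      by (simp add: mult_ac)
    also have "\<dots> = f p * cnj (conv a (\<lambda>z. cnj (K (heis_inv z))) h p)"
      unfolding conv_def by (simp only: integral_mult_right_zero Bochner_Integration.integral_cnj)
    finally show "(LINT z|lborel. K z * f p * cnj (h (heis_mult a p z)))
      = f p * cnj (conv a (\<lambda>z. cnj (K (heis_inv z))) h p)" .
  qed
  finally show ?thesis .
qed

text \<open>A right translation of the inner variable by the inverse of \<open>z\<close> exposes the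
  kernel of the composite. Fubini is available at every \<open>p\<close> by Cauchy-Schwarz:
  \<open>K1\<close> is in L2, and so is the convolution of the absolute values, by
  \<open>nn_Young\<close>.\<close>

lemma conv_conv:
  fixes K1 K2 g :: "'n::finite heis \<Rightarrow> complex"
  assumes K1: "K1 \<in> L2" and K2: "integrable lborel K2" and g: "g \<in> L2"
  shows "conv a K1 (conv a K2 g) p = conv a (\<lambda>u. LINT z|lborel. K1 z * K2 (heis_mult a u (heis_inv z))) g p"
proof -
  have [measurable]: "K1 \<in> borel_measurable borel" "K2 \<in> borel_measurable borel" "g \<in> borel_measurable borel"
    using assms by (auto dest: L2_measurable borel_measurable_integrable)
  have shift: "heis_mult a (heis_mult a p (heis_inv z)) (heis_inv (heis_mult a u (heis_inv z)))
      = heis_mult a p (heis_inv u)" for z u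
    by (simp add: heis_inv_mult heis_mult_assoc[of a p])
      (simp add: heis_mult_assoc[symmetric] heis_mult_inv_left)
  define A where "A q = (\<integral>\<^sup>+w. ennreal (cmod (K2 w) * cmod (g (heis_mult a q (heis_inv w)))) \<partial>lborel)" for q
  have [measurable]: "A \<in> borel_measurable borel" unfolding A_def by measurable
  have "(\<integral>\<^sup>+z. ennreal (cmod (K1 z)) * A (heis_mult a p (heis_inv z)) \<partial>lborel)\<^sup>2
      \<le> (\<integral>\<^sup>+z. (ennreal (cmod (K1 z)))\<^sup>2 \<partial>lborel) * (\<integral>\<^sup>+z. (A (heis_mult a p (heis_inv z)))\<^sup>2 \<partial>lborel)"
    by (rule Cauchy_Schwarz_nn_integral) measurable
  also have "(\<integral>\<^sup>+z. (A (heis_mult a p (heis_inv z)))\<^sup>2 \<partial>lborel) = (\<integral>\<^sup>+q. (A q)\<^sup>2 \<partial>lborel)"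
    by (rule nn_integral_preserving[OF distr_mult_inv, where f = "\<lambda>q. (A q)\<^sup>2"]) measurable
  also have "(\<integral>\<^sup>+z. (ennreal (cmod (K1 z)))\<^sup>2 \<partial>lborel) * (\<integral>\<^sup>+q. (A q)\<^sup>2 \<partial>lborel) < \<infinity>"
  proof -
    have "(\<integral>\<^sup>+q. (A q)\<^sup>2 \<partial>lborel)
        \<le> (\<integral>\<^sup>+z. ennreal (cmod (K2 z)) \<partial>lborel)\<^sup>2 * (\<integral>\<^sup>+p. ennreal ((cmod (g p))\<^sup>2) \<partial>lborel)"
      unfolding A_def by (rule nn_Young) measurable
    also have "\<dots> < \<infinity>"
      unfolding nn_integral_L2[OF g] using K2
      by (auto simp: integrable_iff_bounded ennreal_mult_less_top power2_eq_square)
    finally have "(\<integral>\<^sup>+q. (A q)\<^sup>2 \<partial>lborel) < \<infinity>" .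
    moreover have "(\<integral>\<^sup>+z. (ennreal (cmod (K1 z)))\<^sup>2 \<partial>lborel) < \<infinity>"
      using nn_integral_L2[OF K1] by (simp add: ennreal_power)
    ultimately show ?thesis by (auto simp: ennreal_mult_less_top)
  qed
  finally have fin: "(\<integral>\<^sup>+z. ennreal (cmod (K1 z)) * A (heis_mult a p (heis_inv z)) \<partial>lborel) < \<infinity>"
    by (auto simp: power2_eq_square ennreal_mult_less_top)
  have inner: "(\<integral>\<^sup>+u. ennreal (cmod (K2 (heis_mult a u (heis_inv z))) * cmod (g (heis_mult a p (heis_inv u)))) \<partial>lborel)
      = A (heis_mult a p (heis_inv z))" for z
    using nn_integral_preserving[OF distr_right[where a = a and w = "heis_inv z"], where f =
        "\<lambda>w. ennreal (cmod (K2 w) * cmod (g (heis_mult a (heis_mult a p (heis_inv z)) (heis_inv w))))"]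
    unfolding A_def shift by simp
  have int: "integrable (lborel \<Otimes>\<^sub>M lborel)
      (case_prod (\<lambda>z u. K1 z * K2 (heis_mult a u (heis_inv z)) * g (heis_mult a p (heis_inv u))))"
  proof (rule integrableI_bounded)
    show "case_prod (\<lambda>z u. K1 z * K2 (heis_mult a u (heis_inv z)) * g (heis_mult a p (heis_inv u)))
      \<in> borel_measurable (lborel \<Otimes>\<^sub>M lborel)" by measurable
    have "(\<integral>\<^sup>+x. ennreal (norm (case_prod (\<lambda>z u. K1 z * K2 (heis_mult a u (heis_inv z)) * g (heis_mult a p (heis_inv u))) x))
          \<partial>(lborel \<Otimes>\<^sub>M lborel))
        = (\<integral>\<^sup>+z. \<integral>\<^sup>+u. ennreal (cmod (K1 z * K2 (heis_mult a u (heis_inv z)) * g (heis_mult a p (heis_inv u)))) \<partial>lborel \<partial>lborel)"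
      by (subst lborel.nn_integral_fst[symmetric]) auto
    also have "\<dots> = (\<integral>\<^sup>+z. ennreal (cmod (K1 z)) * A (heis_mult a p (heis_inv z)) \<partial>lborel)"
    proof (rule nn_integral_cong)
      fix z
      show "(\<integral>\<^sup>+u. ennreal (cmod (K1 z * K2 (heis_mult a u (heis_inv z)) * g (heis_mult a p (heis_inv u)))) \<partial>lborel)
          = ennreal (cmod (K1 z)) * A (heis_mult a p (heis_inv z))"
        unfolding inner[symmetric]
        by (subst nn_integral_cmult[symmetric]) (simp_all add: norm_mult mult.assoc flip: ennreal_mult)
    qed
    finally show "(\<integral>\<^sup>+x. ennreal (norm (case_prod (\<lambda>z u. K1 z * K2 (heis_mult a u (heis_inv z)) * g (heis_mult a p (heis_inv u))) x))
          \<partial>(lborel \<Otimes>\<^sub>M lborel)) < \<infinity>" using fin by simp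
  qed
  have "conv a K1 (conv a K2 g) p
      = (LINT z|lborel. LINT u|lborel. K1 z * K2 (heis_mult a u (heis_inv z)) * g (heis_mult a p (heis_inv u)))"
    unfolding conv_def[of a K1]
  proof (rule Bochner_Integration.integral_cong[OF refl])
    fix z
    have "conv a K2 g (heis_mult a p (heis_inv z))
        = (LINT u|lborel. K2 (heis_mult a u (heis_inv z)) * g (heis_mult a p (heis_inv u)))"
      using integral_preserving[OF distr_right[where a = a and w = "heis_inv z"], where f =
        "\<lambda>w. K2 w * g (heis_mult a (heis_mult a p (heis_inv z)) (heis_inv w))"]
      unfolding conv_def shift by simp
    then show "K1 z * conv a K2 g (heis_mult a p (heis_inv z))
        = (LINT u|lborel. K1 z * K2 (heis_mult a u (heis_inv z)) * g (heis_mult a p (heis_inv u)))"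
      by (simp add: mult.assoc)
  qed
  also have "\<dots> = (LINT u|lborel. LINT z|lborel. K1 z * K2 (heis_mult a u (heis_inv z)) * g (heis_mult a p (heis_inv u)))"
    by (rule lborel_pair.Fubini_integral[OF int, symmetric])
  finally show ?thesis by (simp add: conv_def)
qed

text \<open>Convolution with \<open>H\<close> followed by the adjoint of convolution with
  \<open>K\<close> is convolution with the correlation of \<open>K\<close> and \<open>H\<close>.
  Young's inequality thus reduces almost orthogonality to L1 bounds for correlations, and the
  integration over \<open>u\<close> arises here.\<close>

lemma ip_conv_conv:
  fixes K H f g :: "'n::finite heis \<Rightarrow> complex"
  assumes K: "integrable lborel K" "K \<in> L2" and H: "integrable lborel H" and f: "f \<in> L2" and g: "g \<in> L2"
    and G: "(\<integral>\<^sup>+u. ennreal (cmod (LINT z|lborel. cnj (K z) * H (heis_mult a u z))) \<partial>lborel) \<le> ennreal c" and "c \<ge> 0"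
  shows "cmod (ip (conv a K f) (conv a H g)) \<le> c * (L2_norm f * L2_norm g)"
proof -
  have [measurable]: "K \<in> borel_measurable borel" "H \<in> borel_measurable borel"
    using assms by (auto dest: borel_measurable_integrable)
  define K' where "K' z = cnj (K (heis_inv z))" for z
  define G where "G u = (LINT z|lborel. cnj (K z) * H (heis_mult a u z))" for u
  have K'_L2: "K' \<in> L2"
    unfolding K'_def[abs_def] by (rule L2_preserving(1)[OF distr_inv _ L2_cnj[OF K(2)]]) measurable
  have G_measurable [measurable]: "G \<in> borel_measurable borel"
    unfolding G_def[abs_def] by (rule lborel.borel_measurable_lebesgue_integral) measurable
  have "(LINT z|lborel. K' z * H (heis_mult a u (heis_inv z))) = G u" for u
    unfolding K'_def G_def using integral_preserving[OF distr_inv, of "\<lambda>z. cnj (K z) * H (heis_mult a u z)"] by simp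
  then have e: "conv a K' (conv a H g) = conv a G g"
    using conv_conv[OF K'_L2 H g, of a] by (simp add: fun_eq_iff)
  have Gg: "conv a G g \<in> L2" "L2_norm (conv a G g) \<le> c * L2_norm g"
    using Young[OF G_measurable g _ \<open>c \<ge> 0\<close>] G unfolding G_def by auto
  have "ip (conv a K f) (conv a H g) = ip f (conv a G g)"
    using conv_adjoint[OF K(1) f conv_L2[OF H g, of a], of a] unfolding K'_def[symmetric] e .
  then have "cmod (ip (conv a K f) (conv a H g)) \<le> L2_norm f * L2_norm (conv a G g)"
    using norm_ip_le[OF f Gg(1)] by simp
  also have "\<dots> \<le> L2_norm f * (c * L2_norm g)" by (intro mult_left_mono Gg) simp
  finally show ?thesis by (simp add: mult_ac)
qed

section \<open>The phase and its left-invariant gradient\<close>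

lemma norm_sympl_J [simp]: "norm (sympl_J x) = norm x"
  by (cases x) (simp add: sympl_J_def norm_Pair add.commute)

lemma inner_sympl_J: "x \<bullet> sympl_J y = - (sympl_J x \<bullet> y)"
  by (simp add: sympl_J_def inner_prod_def inner_commute)

lemma sympl_J_diff: "sympl_J (x - y) = sympl_J x - sympl_J y"
  by (simp add: sympl_J_def)

section \<open>The gauge as the root of a quadratic equation\<close>

definition sq_x :: "real \<Rightarrow> 'n::finite heis \<Rightarrow> real" where
  "sq_x b z = b\<^sup>2 * (fst z \<bullet> fst z)"

text \<open>
  The square of \<open>\<rho>\<close>, as the positive root \<open>s\<close> of \<open>s\<^sup>2 = sq_x * s + b\<^sup>2 * t\<^sup>2\<close>. The square root is written
  with \<open>powr\<close> because \<open>smooth_on_powr\<close> then applies.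
\<close>

definition sq_rho :: "real \<Rightarrow> 'n::finite heis \<Rightarrow> real" where
  "sq_rho b z = (sq_x b z + ((sq_x b z)\<^sup>2 + 4 * b\<^sup>2 * (snd z)\<^sup>2) powr (1/2)) / 2"

context
  fixes b :: real
  assumes b: "b \<noteq> 0"
begin

lemma disc_pos:
  fixes z :: "'n::finite heis"
  assumes "z \<noteq> 0"
  shows "(sq_x b z)\<^sup>2 + 4 * b\<^sup>2 * (snd z)\<^sup>2 > 0"
proof (cases "fst z = 0")
  case True
  then have "snd z \<noteq> 0" using assms by (metis prod.collapse zero_prod_def)
  then have "4 * b\<^sup>2 * (snd z)\<^sup>2 > 0" using b by simp
  then show ?thesis by (rule add_nonneg_pos[rotated]) simp
next
  case False
  then have "sq_x b z > 0" using b by (simp add: sq_x_def)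
  then show ?thesis by (simp add: add_pos_nonneg)
qed

lemma sq_x_nonneg: "sq_x b z \<ge> 0"
  by (simp add: sq_x_def)

lemma sq_rho_eq: "(sq_rho b z)\<^sup>2 = sq_x b z * sq_rho b z + b\<^sup>2 * (snd z)\<^sup>2" for z :: "'n::finite heis"
proof -
  let ?d = "(sq_x b z)\<^sup>2 + 4 * b\<^sup>2 * (snd z)\<^sup>2"
  have "(?d powr (1/2))\<^sup>2 = ?d" by (simp add: powr_half_sqrt)
  then show ?thesis by (simp add: sq_rho_def power2_eq_square field_simps)
qed

lemma sq_rho_pos: "z \<noteq> 0 \<Longrightarrow> sq_rho b z > 0" for z :: "'n::finite heis"
  using disc_pos[of z] sq_x_nonneg[of z] unfolding sq_rho_def by (simp add: add_nonneg_pos)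

lemma disc_eq: "2 * sq_rho b z - sq_x b z = ((sq_x b z)\<^sup>2 + 4 * b\<^sup>2 * (snd z)\<^sup>2) powr (1/2)"
  by (simp add: sq_rho_def add_divide_distrib)

lemma denom_pos: "z \<noteq> 0 \<Longrightarrow> 2 * sq_rho b z - sq_x b z > 0" for z :: "'n::finite heis"
  using disc_pos[of z] unfolding disc_eq by simp

lemma sq_rho_zero: "sq_rho b 0 = 0"
  by (simp add: sq_rho_def sq_x_def)

lemma rho2_eq: "rho2 (b *\<^sub>R fst z, b * snd z) = sqrt (sq_rho b z)" for z :: "'n::finite heis"
proof (cases "z = 0")
  case True
  then show ?thesis by (simp add: sq_rho_zero flip: zero_prod_def)
next
  case False
  let ?s = "sq_rho b z"
  have s: "?s > 0" using sq_rho_pos[OF False] .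
  have "sq_x b z / ?s + b\<^sup>2 * (snd z)\<^sup>2 / ?s\<^sup>2 = (sq_x b z * ?s + b\<^sup>2 * (snd z)\<^sup>2) / ?s\<^sup>2"
    using s by (simp add: field_simps power2_eq_square)
  also have "\<dots> = 1" unfolding sq_rho_eq[symmetric] using s by simp
  finally have 1: "sq_x b z / ?s + b\<^sup>2 * (snd z)\<^sup>2 / ?s\<^sup>2 = 1" .
  show ?thesis
  proof (rule rho2_eqI)
    show "0 < sqrt ?s" using s by simp
    have "(norm ((1 / sqrt ?s) *\<^sub>R fst (b *\<^sub>R fst z, b * snd z)))\<^sup>2 = sq_x b z / ?s"
      using s by (simp add: power_mult_distrib power_divide sq_x_def power2_norm_eq_inner)
    moreover have "(1 / (sqrt ?s)\<^sup>2 * snd (b *\<^sub>R fst z, b * snd z))\<^sup>2 = b\<^sup>2 * (snd z)\<^sup>2 / ?s\<^sup>2"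
      using s by (simp add: power_mult_distrib power_divide)
    ultimately show "(norm ((1 / sqrt ?s) *\<^sub>R fst (b *\<^sub>R fst z, b * snd z)))\<^sup>2
        + (1 / (sqrt ?s)\<^sup>2 * snd (b *\<^sub>R fst z, b * snd z))\<^sup>2 = 1" using 1 by simp
  qed
qed

lemma smooth_on_sq_x: "open S \<Longrightarrow> smooth_on S (sq_x b)"
  unfolding sq_x_def[abs_def]
  by (intro smooth_on_mult smooth_on_const smooth_on_inner smooth_on_fst smooth_on_id)

lemma smooth_on_sq_rho: "smooth_on (- {0}) (sq_rho b)"
proof -
  have o: "open (- {0 :: 'n::finite heis})" by (simp add: open_Compl)
  have eq: "sq_rho b = (\<lambda>z. (1/2) * (sq_x b z + ((sq_x b z)\<^sup>2 + 4 * b\<^sup>2 * (snd z)\<^sup>2) powr (1/2)))"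
    by (simp add: sq_rho_def fun_eq_iff)
  show ?thesis unfolding eq
    by (intro smooth_on_mult smooth_on_add smooth_on_powr smooth_on_power smooth_on_sq_x smooth_on_const
        smooth_on_snd smooth_on_id o) (use disc_pos in auto)
qed

text \<open>The origin is included here, unlike in \<open>smooth_on_sq_rho\<close>; this makes the
  annulus \<open>D\<close> closed.\<close>

lemma continuous_on_sq_rho: "continuous_on S (sq_rho b)"
proof -
  have e: "sq_rho b = (\<lambda>z. (sq_x b z + sqrt ((sq_x b z)\<^sup>2 + 4 * b\<^sup>2 * (snd z)\<^sup>2)) / 2)"
    by (simp add: sq_rho_def powr_half_sqrt fun_eq_iff)
  show ?thesis unfolding e sq_x_def by (intro continuous_intros) auto
qed

lemma sq_x_deriv: "(sq_x b has_derivative (\<lambda>h. 2 * b\<^sup>2 * (fst z \<bullet> fst h))) (at z)" for z :: "'n::finite heis"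
  unfolding sq_x_def[abs_def]
  by (rule has_derivative_eq_rhs, (rule derivative_intros)+) (auto simp: inner_commute algebra_simps)

lemma sq_rho_differentiable: "z \<noteq> 0 \<Longrightarrow> sq_rho b differentiable (at z)"
  by (rule smooth_on_differentiable[OF smooth_on_sq_rho]) simp

text \<open>Implicit differentiation of \<open>sq_rho_eq\<close>. The factor on the left is the
  square root of the discriminant, by \<open>disc_eq\<close>.\<close>

lemma sq_rho_dderiv:
  fixes z :: "'n::finite heis"
  assumes z: "z \<noteq> 0"
  shows "(2 * sq_rho b z - sq_x b z) * dderiv (sq_rho b) h z
      = 2 * b\<^sup>2 * (sq_rho b z * (fst z \<bullet> fst h) + snd z * snd h)"
proof -
  note dr = has_dderiv[OF sq_rho_differentiable[OF z]]
  have "((\<lambda>z. (sq_rho b z)\<^sup>2) has_derivative (\<lambda>h. 2 * sq_rho b z * dderiv (sq_rho b) h z)) (at z)"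
    by (rule has_derivative_eq_rhs[OF has_derivative_power[OF dr]]) auto
  moreover have "((\<lambda>z. sq_x b z * sq_rho b z + b\<^sup>2 * (snd z)\<^sup>2) has_derivative
     (\<lambda>h. sq_x b z * dderiv (sq_rho b) h z + 2 * b\<^sup>2 * (fst z \<bullet> fst h) * sq_rho b z + b\<^sup>2 * (2 * snd z * snd h))) (at z)"
    by (rule has_derivative_eq_rhs,
        rule has_derivative_add[OF has_derivative_mult[OF sq_x_deriv dr]
          has_derivative_mult_right[OF has_derivative_power[OF has_derivative_snd[OF has_derivative_ident]]]])
      auto
  ultimately have "2 * sq_rho b z * dderiv (sq_rho b) h z
     = sq_x b z * dderiv (sq_rho b) h z + 2 * b\<^sup>2 * (fst z \<bullet> fst h) * sq_rho b z + b\<^sup>2 * (2 * snd z * snd h)"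
    using has_derivative_unique unfolding sq_rho_eq by (metis (no_types, lifting))
  then show ?thesis by (simp add: algebra_simps)
qed

end

section \<open>Scalar inequalities behind the injectivity\<close>

text \<open>
  The determinant of the linear system that the logarithmic derivatives of
  \<open>sq_rho\<close> and \<open>grad_coeff\<close> satisfy in a direction annihilated by the derivative of \<open>frame_grad\<close>,
  with \<open>w = b\<^sup>2 * t\<^sup>2 / sq_rho\<^sup>2\<close> and \<open>c = 4 * a\<^sup>2 / b\<^sup>2\<close>.
\<close>

lemma determinant_neg:
  fixes w c k :: real
  assumes w: "0 \<le> w" "w \<le> 1" and c: "0 \<le> c" "c \<le> 4" and k: "1 \<le> k"
  shows "(1 - w) * (3 - w + c * w + c * w\<^sup>2) - (2 + 2 * c * w\<^sup>2) * (1 - w + k * (1 + w)) < 0"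
proof -
  \<comment> \<open>The determinant decreases in \<open>k\<close>, so \<open>k = 1\<close> is the
    worst case.\<close>
  have "(2 + 2 * c * w\<^sup>2) * (1 - w + 1 * (1 + w)) \<le> (2 + 2 * c * w\<^sup>2) * (1 - w + k * (1 + w))"
    using w c k by (intro mult_left_mono add_left_mono mult_right_mono) auto
  moreover have "(1 - w) * (3 - w + c * w + c * w\<^sup>2) - (2 + 2 * c * w\<^sup>2) * (1 - w + 1 * (1 + w))
      = -1 - 4 * w + w\<^sup>2 + c * (w * (1 - 4 * w - w\<^sup>2))"
    by (simp add: algebra_simps power2_eq_square)
  moreover have "-1 - 4 * w + w\<^sup>2 + c * (w * (1 - 4 * w - w\<^sup>2)) < 0"
  \<comment> \<open>The factor of \<open>c\<close> changes sign. Where it is nonnegative,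
    \<open>c\<close> is replaced by 4 and the expression is at most \<open>w\<^sup>2 - 1\<close>;
    elsewhere the term with \<open>c\<close> only helps.\<close>
  proof (cases "1 - 4 * w - w\<^sup>2 \<ge> 0")
    case True
    then have "c * (w * (1 - 4 * w - w\<^sup>2)) \<le> 4 * (w * (1 - 4 * w - w\<^sup>2))"
      using w c by (intro mult_right_mono) auto
    also have "\<dots> \<le> 4 * (w * 1)"
    proof -
      have "1 - 4 * w - w\<^sup>2 \<le> 1" using w zero_le_power2[of w] by linarith
      then show ?thesis using w by (intro mult_left_mono) auto
    qed
    finally have 4: "c * (w * (1 - 4 * w - w\<^sup>2)) \<le> 4 * w" by simp
    moreover have "w\<^sup>2 < 1"
    proof -
      have "w\<^sup>2 \<le> 1 - 4 * w" using True by simp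
      moreover have "w = 0 \<or> w > 0" using w by auto
      ultimately show ?thesis by auto
    qed
    ultimately show ?thesis using 4 by linarith
  next
    case False
    then have "c * (w * (1 - 4 * w - w\<^sup>2)) \<le> 0"
      using w c by (intro mult_nonneg_nonpos) auto
    moreover have "w\<^sup>2 \<le> w" using w by (simp add: power2_eq_square mult_left_le_one_le)
    ultimately show ?thesis using w by simp
  qed
  ultimately show ?thesis by linarith
qed

text \<open>Both factors decrease. For the quotient, cross-multiplication leaves
  \<open>v - u\<close> times an expression which \<open>u\<^sup>2 + v\<^sup>2 \<ge> 2 * y\<close>
  and \<open>c \<le> 4\<close> bound below by \<open>1 - y + 4 * y\<^sup>2\<close>, where
  \<open>y = u * v\<close>.\<close>

lemma ratio_strict_decreasing:
  fixes u v c :: real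
  assumes "0 < u" "u < v" "v \<le> 1" "0 \<le> c" "c \<le> 4"
  shows "(1 - v\<^sup>2) * ((1 + c * v\<^sup>2) / (v * (1 + v\<^sup>2))) < (1 - u\<^sup>2) * ((1 + c * u\<^sup>2) / (u * (1 + u\<^sup>2)))"
proof (rule mult_strict_mono)
  have v: "0 < v" using assms by simp
  show "1 - v\<^sup>2 < 1 - u\<^sup>2" using assms by (simp add: power_strict_mono)
  then have "0 < 1 - u\<^sup>2" using assms by (smt (verit) power_le_one v)
  then show "0 < 1 - u\<^sup>2" .
  show "0 \<le> (1 + c * v\<^sup>2) / (v * (1 + v\<^sup>2))" using assms v by (intro divide_nonneg_nonneg) auto
  define y where "y = u * v"
  have y: "0 < y" "y \<le> 1" using assms v by (auto simp: y_def mult_le_one)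
  have "u\<^sup>2 + v\<^sup>2 \<ge> 2 * y" using sum_squares_bound[of u v] by (simp add: y_def)
  moreover have "c * (y * (1 - y)) \<le> 4 * (y * (1 - y))" using assms y by (intro mult_right_mono) auto
  \<comment> \<open>One quarter of the lower bound \<open>1 - y + 4 * y\<^sup>2\<close>; its
    discriminant is negative.\<close>
  moreover have "y\<^sup>2 - y / 4 + 1 / 4 > 0"
    using zero_le_power2[of "y - 1/8"] by (simp add: power2_eq_square algebra_simps)
  ultimately have pos: "1 + u\<^sup>2 + v\<^sup>2 + y - c * y + c * y\<^sup>2 > 0"
    by (simp add: algebra_simps power2_eq_square)
  have "(1 + c * u\<^sup>2) * (v * (1 + v\<^sup>2)) - (1 + c * v\<^sup>2) * (u * (1 + u\<^sup>2))
     = (v - u) * (1 + u\<^sup>2 + v\<^sup>2 + y - c * y + c * y\<^sup>2)"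
    by (simp add: y_def algebra_simps power2_eq_square)
  also have "\<dots> > 0" using assms pos by simp
  finally have "(1 + c * v\<^sup>2) * (u * (1 + u\<^sup>2)) < (1 + c * u\<^sup>2) * (v * (1 + v\<^sup>2))" by simp
  moreover have "u * (1 + u\<^sup>2) > 0" "v * (1 + v\<^sup>2) > 0" using assms v by (simp_all add: add_pos_nonneg)
  ultimately show "(1 + c * v\<^sup>2) / (v * (1 + v\<^sup>2)) < (1 + c * u\<^sup>2) / (u * (1 + u\<^sup>2))"
    by (simp add: frac_less_eq divide_less_eq less_divide_eq mult.commute mult.left_commute field_simps)
qed

text \<open>Since \<open>u / (1 + u\<^sup>2)\<close> increases on the unit interval,
  \<open>T\<close> and \<open>u1 < u2\<close> force \<open>s1 < s2\<close>. Then both factors in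
  \<open>Q\<close> are smaller at the second point: the power of \<open>s\<close> because
  \<open>1 - k < 0\<close>, the other by \<open>ratio_strict_decreasing\<close>.\<close>

lemma scalar_injective_aux:
  fixes s1 s2 u1 u2 c k :: real
  assumes s: "s1 > 0" "s2 > 0" and u: "0 < u1" "u1 < u2" "u2 \<le> 1" and c: "0 \<le> c" "c \<le> 4" and k: "k > 1"
    and T: "s1 powr (-k) * (u1 / (1 + u1\<^sup>2)) = s2 powr (-k) * (u2 / (1 + u2\<^sup>2))"
    and Q: "s1 powr (1 - k) * ((1 - u1\<^sup>2) * ((1 + c * u1\<^sup>2) / (u1 * (1 + u1\<^sup>2))))
        = s2 powr (1 - k) * ((1 - u2\<^sup>2) * ((1 + c * u2\<^sup>2) / (u2 * (1 + u2\<^sup>2))))"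
  shows False
proof -
  have "u1 * (1 + u2\<^sup>2) < u2 * (1 + u1\<^sup>2)"
  proof -
    have "u1 * u2 < 1" using u mult_strict_mono[of u1 1 u2 1] by (cases "u2 = 1") auto
    then have "(u2 - u1) * (1 - u1 * u2) > 0" using u by simp
    then show ?thesis by (simp add: algebra_simps power2_eq_square)
  qed
  then have "u1 / (1 + u1\<^sup>2) < u2 / (1 + u2\<^sup>2)"
    by (simp add: divide_less_eq less_divide_eq add_pos_nonneg)
  moreover have "s2 powr (-k) > 0" "u1 / (1 + u1\<^sup>2) > 0" using s u by (auto simp: add_pos_nonneg)
  ultimately have "s2 powr (-k) * (u1 / (1 + u1\<^sup>2)) < s1 powr (-k) * (u1 / (1 + u1\<^sup>2))"
    unfolding T by (intro mult_strict_left_mono)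
  then have "s2 powr (-k) < s1 powr (-k)"
    by (rule mult_right_less_imp_less) (use u in \<open>auto simp: add_pos_nonneg\<close>)
  then have "s1 < s2" using s k powr_mono2'[of "-k" s2 s1] by (meson linorder_not_less neg_less_0_iff_less zero_less_one order.strict_trans less_imp_le neg_le_0_iff_le)
  then have "s2 powr (1 - k) < s1 powr (1 - k)" using s k by (intro powr_less_mono2_neg) auto
  moreover note ratio_strict_decreasing[OF u c]
  moreover have "(1 - u2\<^sup>2) * ((1 + c * u2\<^sup>2) / (u2 * (1 + u2\<^sup>2))) \<ge> 0"
    using u c by (intro mult_nonneg_nonneg divide_nonneg_nonneg) (auto simp: power_le_one)
  ultimately have "s2 powr (1 - k) * ((1 - u2\<^sup>2) * ((1 + c * u2\<^sup>2) / (u2 * (1 + u2\<^sup>2))))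
     < s1 powr (1 - k) * ((1 - u1\<^sup>2) * ((1 + c * u1\<^sup>2) / (u1 * (1 + u1\<^sup>2))))"
    using s by (intro mult_strict_mono[of "s2 powr (1 - k)" "s1 powr (1 - k)"]) simp_all
  with Q show False by simp
qed

text \<open>
  Here \<open>s\<close>, \<open>A\<close>, \<open>t\<close> and \<open>m\<close> stand for \<open>sq_rho\<close>, \<open>sq_x\<close>, the central coordinate and \<open>grad_coeff\<close>;
  \<open>T\<close> and \<open>Q\<close> compare the central components of \<open>frame_grad\<close> and the norms of its horizontal ones.
\<close>

lemma scalar_injective:
  fixes s1 s2 t1 t2 A1 A2 a b k :: real
  assumes b: "b \<noteq> 0" and ab: "a\<^sup>2 / b\<^sup>2 \<le> 1" and k: "k > 1"
    and s: "s1 > 0" "s2 > 0" and A: "A1 \<ge> 0" "A2 \<ge> 0"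
    and e: "s1\<^sup>2 = A1 * s1 + b\<^sup>2 * t1\<^sup>2" "s2\<^sup>2 = A2 * s2 + b\<^sup>2 * t2\<^sup>2"
    and m: "m1 = s1 powr (-k) / (2 * s1 - A1)" "m2 = s2 powr (-k) / (2 * s2 - A2)"
    and T: "m1 * t1 = m2 * t2"
    and Q: "m1\<^sup>2 * (A1 * (s1\<^sup>2 + 4 * a\<^sup>2 * t1\<^sup>2)) = m2\<^sup>2 * (A2 * (s2\<^sup>2 + 4 * a\<^sup>2 * t2\<^sup>2))"
  shows "s1 = s2" "t1 = t2"
proof -
  define c where "c = 4 * a\<^sup>2 / b\<^sup>2"
  have c: "0 \<le> c" "c \<le> 4" using ab by (auto simp: c_def)
  have sA: "A \<le> s \<and> 2 * s - A > 0" if "s > 0" "s\<^sup>2 = A * s + b\<^sup>2 * t\<^sup>2" for s A t :: real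
  proof -
    have "s * (s - A) = b\<^sup>2 * t\<^sup>2" using that(2) by (simp add: algebra_simps power2_eq_square)
    then have "s * (s - A) \<ge> 0" by simp
    then have "s - A \<ge> 0" using that(1) by (simp add: zero_le_mult_iff)
    then show ?thesis using that(1) by linarith
  qed
  have m_pos: "m1 > 0" "m2 > 0" using sA[OF s(1) e(1)] sA[OF s(2) e(2)] s by (simp_all add: m)
  \<comment> \<open>In the variables \<open>s\<close> and \<open>u\<close> the quadratic equation
    reads \<open>A = s * (1 - u\<^sup>2)\<close> with \<open>0 \<le> u \<le> 1\<close>. The quantity
    in \<open>T\<close>, and the quotient of those in \<open>Q\<close> and \<open>T\<close>, then
    separate into a power of \<open>s\<close> times a function of \<open>u\<close>.\<close>
  define u1 where "u1 = \<bar>b * t1\<bar> / s1"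
  define u2 where "u2 = \<bar>b * t2\<bar> / s2"
  have form: "A = s * (1 - u\<^sup>2) \<and> 0 \<le> u \<and> u \<le> 1 \<and> s powr (-k) / (2 * s - A) * \<bar>b * t\<bar> = s powr (-k) * (u / (1 + u\<^sup>2))
     \<and> (t \<noteq> 0 \<longrightarrow> s powr (-k) / (2 * s - A) * (A * (s\<^sup>2 + 4 * a\<^sup>2 * t\<^sup>2)) / \<bar>b * t\<bar>
          = s powr (1 - k) * ((1 - u\<^sup>2) * ((1 + c * u\<^sup>2) / (u * (1 + u\<^sup>2)))))"
    if s: "s > 0" and A: "A \<ge> 0" and e: "s\<^sup>2 = A * s + b\<^sup>2 * t\<^sup>2" and u: "u = \<bar>b * t\<bar> / s" for s A t u :: real
  proof -
    have u2: "u\<^sup>2 = b\<^sup>2 * t\<^sup>2 / s\<^sup>2" by (simp add: u power_divide power_mult_distrib)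
    have bt: "\<bar>b * t\<bar> = s * u" using s by (simp add: u)
    have "s * A = s * (s * (1 - u\<^sup>2))"
    proof -
      have "u\<^sup>2 * s\<^sup>2 = b\<^sup>2 * t\<^sup>2" using u2 s by simp
      then show ?thesis using e by (simp add: algebra_simps power2_eq_square)
    qed
    then have Au: "A = s * (1 - u\<^sup>2)" using s by simp
    have u0: "0 \<le> u" using s by (simp add: u)
    have "u\<^sup>2 \<le> 1" using A s unfolding Au by (simp add: zero_le_mult_iff)
    then have u1: "u \<le> 1" using u0 by (simp add: power2_le_iff_abs_le abs_square_le_1)
    have den: "2 * s - A = s * (1 + u\<^sup>2)" by (simp add: Au algebra_simps)
    have up: "1 + u\<^sup>2 > 0" by (simp add: add_pos_nonneg)
    have 1: "s powr (-k) / (2 * s - A) * \<bar>b * t\<bar> = s powr (-k) * (u / (1 + u\<^sup>2))"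
    proof -
      have "X / (s * d) * (s * u) = X * (u / d)" for X d :: real using s by simp
      then show ?thesis unfolding den bt .
    qed
    have 2: "s powr (-k) / (2 * s - A) * (A * (s\<^sup>2 + 4 * a\<^sup>2 * t\<^sup>2)) / \<bar>b * t\<bar>
          = s powr (1 - k) * ((1 - u\<^sup>2) * ((1 + c * u\<^sup>2) / (u * (1 + u\<^sup>2))))" if "t \<noteq> 0"
    proof -
      have u: "u > 0" using u0 that b s by (auto simp: u)
      have "4 * a\<^sup>2 * t\<^sup>2 = c * u\<^sup>2 * s\<^sup>2" unfolding c_def u2 using b s by simp
      then have h1: "s\<^sup>2 + 4 * a\<^sup>2 * t\<^sup>2 = s\<^sup>2 * (1 + c * u\<^sup>2)" by (simp add: algebra_simps)
      have h2: "s powr (1 - k) = s * s powr (-k)" using s by (simp add: powr_diff powr_minus field_simps)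
      have h3: "X / (s * d) * (s * p * (s\<^sup>2 * r)) / (s * u) = s * X * (p * (r / (u * d)))"
        for X d p r :: real
        using s u by (cases "d = 0") (simp_all add: field_simps power2_eq_square)
      show ?thesis unfolding den bt unfolding Au h1 h2 by (rule h3)
    qed
    show ?thesis using Au u0 u1 1 2 by blast
  qed
  note f1 = form[OF s(1) A(1) e(1) u1_def] and f2 = form[OF s(2) A(2) e(2) u2_def]
  have Tabs: "m1 * \<bar>b * t1\<bar> = m2 * \<bar>b * t2\<bar>"
  proof -
    have "\<bar>b\<bar> * \<bar>m1 * t1\<bar> = \<bar>b\<bar> * \<bar>m2 * t2\<bar>" using T by simp
    then show ?thesis using m_pos by (simp add: abs_mult algebra_simps)
  qed
  have "s1 = s2 \<and> t1 = t2"
  proof (cases "t1 = 0")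
    case True
    then have t2: "t2 = 0" using T m_pos by simp
    have A: "A1 = s1" "A2 = s2" using f1 f2 True t2 by (auto simp: u1_def u2_def)
    have ev: "m\<^sup>2 * (s * (s\<^sup>2 + 4 * a\<^sup>2 * 0\<^sup>2)) = s powr (1 - 2 * k)"
      if "s > 0" "m = s powr (-k) / (2 * s - s)" for s m :: real
    proof -
      have "m = s powr (-k - 1)" using that by (simp add: powr_diff)
      then have "m\<^sup>2 * (s * (s\<^sup>2 + 4 * a\<^sup>2 * 0\<^sup>2)) = s powr (-k - 1) * s powr (-k - 1) * s powr 3"
        using that(1) by (simp add: power2_eq_square powr_numeral power3_eq_cube)
      also have "\<dots> = s powr ((-k - 1) + (-k - 1) + 3)" by (simp only: powr_add)
      also have "(-k - 1) + (-k - 1) + 3 = 1 - 2 * k" by simp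
      finally show ?thesis .
    qed
    have p: "s1 powr (1 - 2 * k) = s2 powr (1 - 2 * k)"
      using Q ev[OF s(1), of m1] ev[OF s(2), of m2] m A True t2 by simp
    have "s1 = s2"
    proof (rule ccontr)
      assume "s1 \<noteq> s2"
      then consider "s1 < s2" | "s2 < s1" by linarith
      then show False using p s k powr_less_mono2_neg[of "1 - 2 * k" s1 s2] powr_less_mono2_neg[of "1 - 2 * k" s2 s1]
        by cases auto
    qed
    then show ?thesis using True t2 by simp
  next
    case False
    then have t2: "t2 \<noteq> 0" using T m_pos by auto
    have u: "0 < u1" "0 < u2" using False t2 b s by (auto simp: u1_def u2_def)
    have ul: "u1 \<le> 1" "u2 \<le> 1" using f1 f2 by auto
    have T': "s1 powr (-k) * (u1 / (1 + u1\<^sup>2)) = s2 powr (-k) * (u2 / (1 + u2\<^sup>2))"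
    proof -
      have "m1 * \<bar>b * t1\<bar> = s1 powr (-k) * (u1 / (1 + u1\<^sup>2))" unfolding m(1) using f1 by blast
      moreover have "m2 * \<bar>b * t2\<bar> = s2 powr (-k) * (u2 / (1 + u2\<^sup>2))" unfolding m(2) using f2 by blast
      ultimately show ?thesis using Tabs by metis
    qed
    \<comment> \<open>Dividing \<open>Q\<close> by \<open>Tabs\<close> removes one factor
      \<open>m\<close>, which leaves the power \<open>1 - k\<close> of \<open>s\<close>.\<close>
    have Q': "m1 * (A1 * (s1\<^sup>2 + 4 * a\<^sup>2 * t1\<^sup>2)) / \<bar>b * t1\<bar> = m2 * (A2 * (s2\<^sup>2 + 4 * a\<^sup>2 * t2\<^sup>2)) / \<bar>b * t2\<bar>"
    proof -
      have "m1 * (A1 * (s1\<^sup>2 + 4 * a\<^sup>2 * t1\<^sup>2)) / \<bar>b * t1\<bar>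
          = m1\<^sup>2 * (A1 * (s1\<^sup>2 + 4 * a\<^sup>2 * t1\<^sup>2)) / (m1 * \<bar>b * t1\<bar>)"
        using m_pos False b by (simp add: power2_eq_square)
      also have "\<dots> = m2\<^sup>2 * (A2 * (s2\<^sup>2 + 4 * a\<^sup>2 * t2\<^sup>2)) / (m2 * \<bar>b * t2\<bar>)" unfolding Q Tabs ..
      also have "\<dots> = m2 * (A2 * (s2\<^sup>2 + 4 * a\<^sup>2 * t2\<^sup>2)) / \<bar>b * t2\<bar>"
        using m_pos t2 b by (simp add: power2_eq_square)
      finally show ?thesis .
    qed
    have Q'': "s1 powr (1 - k) * ((1 - u1\<^sup>2) * ((1 + c * u1\<^sup>2) / (u1 * (1 + u1\<^sup>2))))
        = s2 powr (1 - k) * ((1 - u2\<^sup>2) * ((1 + c * u2\<^sup>2) / (u2 * (1 + u2\<^sup>2))))"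
    proof -
      have "m1 * (A1 * (s1\<^sup>2 + 4 * a\<^sup>2 * t1\<^sup>2)) / \<bar>b * t1\<bar>
          = s1 powr (1 - k) * ((1 - u1\<^sup>2) * ((1 + c * u1\<^sup>2) / (u1 * (1 + u1\<^sup>2))))"
        unfolding m(1) using f1 False by blast
      moreover have "m2 * (A2 * (s2\<^sup>2 + 4 * a\<^sup>2 * t2\<^sup>2)) / \<bar>b * t2\<bar>
          = s2 powr (1 - k) * ((1 - u2\<^sup>2) * ((1 + c * u2\<^sup>2) / (u2 * (1 + u2\<^sup>2))))"
        unfolding m(2) using f2 t2 by blast
      ultimately show ?thesis using Q' by metis
    qed
    have uu: "u1 = u2"
    proof (rule ccontr)
      assume "u1 \<noteq> u2"
      then consider "u1 < u2" | "u2 < u1" by linarith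
      then show False
        using scalar_injective_aux[OF s u(1) _ ul(2) c k T' Q'']
          scalar_injective_aux[OF s(2,1) u(2) _ ul(1) c k T'[symmetric] Q''[symmetric]] by cases auto
    qed
    have up: "u2 / (1 + u2\<^sup>2) > 0" using u by (simp add: add_pos_nonneg)
    have p: "s1 powr (-k) = s2 powr (-k)" using T' up unfolding uu by (metis less_irrefl mult_right_cancel)
    have ss: "s1 = s2"
    proof (rule ccontr)
      assume "s1 \<noteq> s2"
      then consider "s1 < s2" | "s2 < s1" by linarith
      then show False using p s k powr_less_mono2_neg[of "- k" s1 s2] powr_less_mono2_neg[of "- k" s2 s1]
        by cases auto
    qed
    moreover have "A1 = A2" using f1 f2 uu ss by simp
    ultimately have "m1 = m2" by (simp add: m)
    then show ?thesis using T m_pos ss by simp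
  qed
  then show "s1 = s2" "t1 = t2" by auto
qed

section \<open>The frame gradient and its injectivity\<close>

lemma open_nonzero: "open (- {0 :: 'n::finite heis})"
  by (simp add: open_Compl)

text \<open>The factor common to all partial derivatives of \<open>Phi\<close>: the power comes from
  the outer derivative, the denominator from \<open>sq_rho_dderiv\<close>.\<close>

definition grad_coeff :: "real \<Rightarrow> real \<Rightarrow> 'n::finite heis \<Rightarrow> real" where
  "grad_coeff b \<beta> z = sq_rho b z powr (- (\<beta> / 2 + 1)) / (2 * sq_rho b z - sq_x b z)"

definition Phi :: "real \<Rightarrow> real \<Rightarrow> 'n::finite heis \<Rightarrow> real" where
  "Phi b \<beta> z = sq_rho b z powr (- \<beta> / 2)"

text \<open>Up to the factor \<open>- \<beta> * b\<^sup>2\<close>, the gradient of \<open>Phi\<close> in the frame of left-invariant fields.\<close>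

definition frame_grad :: "real \<Rightarrow> real \<Rightarrow> real \<Rightarrow> 'n::finite heis \<Rightarrow> 'n heis" where
  "frame_grad a b \<beta> z = (grad_coeff b \<beta> z *\<^sub>R (sq_rho b z *\<^sub>R fst z + (2 * a * snd z) *\<^sub>R sympl_J (fst z)), grad_coeff b \<beta> z * snd z)"

context
  fixes a b \<beta> :: real
  assumes b: "b \<noteq> 0" and ab: "a\<^sup>2 / b\<^sup>2 \<le> 1" and \<beta>: "\<beta> > 0"
begin

lemma smooth_on_grad_coeff: "smooth_on (- {0}) (grad_coeff b \<beta>)"
proof -
  have e: "grad_coeff b \<beta> = (\<lambda>z. sq_rho b z powr (- (\<beta> / 2 + 1)) * (2 * sq_rho b z - sq_x b z) powr (- 1))"
  proof
    fix z show "grad_coeff b \<beta> z = sq_rho b z powr (- (\<beta> / 2 + 1)) * (2 * sq_rho b z - sq_x b z) powr (- 1)"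
      unfolding grad_coeff_def using denom_pos[OF b, of z]
      by (cases "z = 0") (auto simp: powr_minus_divide sq_rho_zero[OF b] sq_x_def)
  qed
  show ?thesis unfolding e
    by (intro smooth_on_mult smooth_on_powr smooth_on_diff smooth_on_const smooth_on_sq_rho[OF b]
        smooth_on_sq_x[OF b] open_nonzero) (use sq_rho_pos[OF b] denom_pos[OF b] in auto)
qed

lemma smooth_on_Phi: "smooth_on (- {0}) (Phi b \<beta>)"
  unfolding Phi_def[abs_def]
  by (intro smooth_on_powr smooth_on_sq_rho[OF b] open_nonzero) (use sq_rho_pos[OF b] in auto)

lemma smooth_on_frame_grad: "smooth_on (- {0}) (frame_grad a b \<beta>)"
  unfolding frame_grad_def[abs_def]
  by (intro smooth_on_Pair smooth_on_scaleR smooth_on_add smooth_on_mult smooth_on_const smooth_on_grad_coeff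
      smooth_on_sq_rho[OF b] smooth_on_fst smooth_on_snd smooth_on_sympl_J smooth_on_id open_nonzero)

lemma grad_coeff_pos: "z \<noteq> 0 \<Longrightarrow> grad_coeff b \<beta> z > 0"
  unfolding grad_coeff_def using sq_rho_pos[OF b, of z] denom_pos[OF b, of z] by simp

lemma Phi_dderiv:
  fixes z :: "'n::finite heis"
  assumes z: "z \<noteq> 0"
  shows "dderiv (Phi b \<beta>) h z = - \<beta> * b\<^sup>2 * grad_coeff b \<beta> z * (sq_rho b z * (fst z \<bullet> fst h) + snd z * snd h)"
proof -
  let ?s = "sq_rho b z"
  have s: "?s > 0" and den: "2 * ?s - sq_x b z > 0" using sq_rho_pos[OF b z] denom_pos[OF b z] by auto
  have "((\<lambda>x. x powr (- \<beta> / 2)) has_derivative (\<lambda>v. ((- \<beta> / 2) * ?s powr (- \<beta> / 2 - 1)) * v)) (at ?s)"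
    using has_real_derivative_powr[OF s, of "- \<beta> / 2"] unfolding has_field_derivative_def .
  from has_derivative_compose[OF has_dderiv[OF sq_rho_differentiable[OF b z]] this]
  have "(Phi b \<beta> has_derivative (\<lambda>h. ((- \<beta> / 2) * ?s powr (- \<beta> / 2 - 1)) * dderiv (sq_rho b) h z)) (at z)"
    unfolding Phi_def[abs_def] .
  then have 1: "dderiv (Phi b \<beta>) h z = ((- \<beta> / 2) * ?s powr (- \<beta> / 2 - 1)) * dderiv (sq_rho b) h z"
    by (rule dderiv_eq)
  have 2: "dderiv (sq_rho b) h z = 2 * b\<^sup>2 * (?s * (fst z \<bullet> fst h) + snd z * snd h) / (2 * ?s - sq_x b z)"
    using sq_rho_dderiv[OF b z, of h] den by (simp add: field_simps)
  have 3: "- \<beta> / 2 - 1 = - (\<beta> / 2 + 1)" by simp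
  show ?thesis unfolding 1 2 3 grad_coeff_def by simp
qed

text \<open>The direction is the value at \<open>z\<close> of the left-invariant field that equals
  \<open>(\<xi>, \<tau>)\<close> at the origin, that is, the derivative at \<open>r = 0\<close> of
  the product of \<open>z\<close> with \<open>(r *\<^sub>R \<xi>, r * \<tau>)\<close>.\<close>

lemma Phi_dderiv_frame:
  fixes z :: "'n::finite heis"
  assumes z: "z \<noteq> 0"
  shows "dderiv (Phi b \<beta>) (\<xi>, \<tau> - 2 * a * (fst z \<bullet> sympl_J \<xi>)) z = - \<beta> * b\<^sup>2 * (frame_grad a b \<beta> z \<bullet> (\<xi>, \<tau>))"
  unfolding Phi_dderiv[OF z] frame_grad_def
  by (simp add: inner_sympl_J[of "fst z" \<xi>] inner_add_left algebra_simps)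

text \<open>\<open>sympl_J\<close> is an isometry and \<open>sympl_J x\<close> is orthogonal to
  \<open>x\<close>, so the direction of the horizontal coordinate drops out. This reduces
  injectivity to the scalar equations of \<open>scalar_injective\<close>.\<close>

lemma norm_fst_frame_grad:
  fixes z :: "'n::finite heis"
  shows "b\<^sup>2 * (fst (frame_grad a b \<beta> z) \<bullet> fst (frame_grad a b \<beta> z))
    = (grad_coeff b \<beta> z)\<^sup>2 * (sq_x b z * ((sq_rho b z)\<^sup>2 + 4 * a\<^sup>2 * (snd z)\<^sup>2))"
proof -
  have "sympl_J x \<bullet> sympl_J x = x \<bullet> x" for x :: "(real^'n) \<times> (real^'n)"
    by (metis norm_sympl_J power2_norm_eq_inner)
  moreover have "sympl_J x \<bullet> x = 0" for x :: "(real^'n) \<times> (real^'n)" by (simp add: inner_commute)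
  ultimately show ?thesis
    by (simp add: frame_grad_def inner_add_left inner_add_right sq_x_def power2_eq_square algebra_simps)
qed

lemma rotation_injective:
  fixes d :: "(real^'n::finite) \<times> (real^'n)"
  assumes "s *\<^sub>R d + r *\<^sub>R sympl_J d = 0" "s \<noteq> 0"
  shows "d = 0"
proof -
  have "d \<bullet> (s *\<^sub>R d + r *\<^sub>R sympl_J d) = 0" using assms by simp
  then have "s * (d \<bullet> d) = 0" by (simp add: inner_add_right)
  then show ?thesis using assms by simp
qed

text \<open>The central component and the horizontal norm determine \<open>sq_rho\<close> and the
  central coordinate, hence also \<open>grad_coeff\<close>; the horizontal coordinate is then
  recovered by inverting the scaled rotation.\<close>

lemma frame_grad_injective:
  fixes y z :: "'n::finite heis"
  assumes y: "y \<noteq> 0" and z: "z \<noteq> 0" and e: "frame_grad a b \<beta> y = frame_grad a b \<beta> z"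
  shows "y = z"
proof -
  have T: "grad_coeff b \<beta> y * snd y = grad_coeff b \<beta> z * snd z"
    using arg_cong[OF e, of snd] by (simp add: frame_grad_def)
  have Q: "(grad_coeff b \<beta> y)\<^sup>2 * (sq_x b y * ((sq_rho b y)\<^sup>2 + 4 * a\<^sup>2 * (snd y)\<^sup>2))
     = (grad_coeff b \<beta> z)\<^sup>2 * (sq_x b z * ((sq_rho b z)\<^sup>2 + 4 * a\<^sup>2 * (snd z)\<^sup>2))"
    unfolding norm_fst_frame_grad[symmetric] e ..
  have k: "\<beta> / 2 + 1 > 1" using \<beta> by simp
  have st: "sq_rho b y = sq_rho b z" "snd y = snd z"
    using scalar_injective[OF b ab k sq_rho_pos[OF b y] sq_rho_pos[OF b z] sq_x_nonneg[OF b] sq_x_nonneg[OF b]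
        sq_rho_eq[OF b] sq_rho_eq[OF b] grad_coeff_def grad_coeff_def T Q] by auto
  have "sq_x b y = sq_x b z"
    using sq_rho_eq[OF b, of y] sq_rho_eq[OF b, of z] st sq_rho_pos[OF b z] by simp
  then have m: "grad_coeff b \<beta> y = grad_coeff b \<beta> z" by (simp add: grad_coeff_def st)
  have "grad_coeff b \<beta> z *\<^sub>R (sq_rho b z *\<^sub>R fst y + (2 * a * snd z) *\<^sub>R sympl_J (fst y))
     = grad_coeff b \<beta> z *\<^sub>R (sq_rho b z *\<^sub>R fst z + (2 * a * snd z) *\<^sub>R sympl_J (fst z))"
    using arg_cong[OF e, of fst] by (simp add: frame_grad_def st m)
  then have "sq_rho b z *\<^sub>R fst y + (2 * a * snd z) *\<^sub>R sympl_J (fst y)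
     = sq_rho b z *\<^sub>R fst z + (2 * a * snd z) *\<^sub>R sympl_J (fst z)"
    using grad_coeff_pos[OF z] by simp
  then have "sq_rho b z *\<^sub>R (fst y - fst z) + (2 * a * snd z) *\<^sub>R sympl_J (fst y - fst z) = 0"
    by (simp only: sympl_J_diff scaleR_diff_right add_diff_add[symmetric] diff_self)
  then have "fst y - fst z = 0" using rotation_injective sq_rho_pos[OF b z] by fastforce
  then show ?thesis using st by (simp add: prod_eq_iff)
qed

text \<open>The infinitesimal counterpart of \<open>frame_grad_injective\<close>, required because
  injectivity alone gives no linear lower bound near the diagonal. The derivatives of the central
  component (\<open>E2\<close>) and of the horizontal norm (\<open>E3\<close>), of the quadratic
  equation (\<open>E1\<close>) and of the definition of \<open>grad_coeff\<close>
  (\<open>E4\<close>) form a homogeneous linear system, whose determinant is nonzero.\<close>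

lemma frame_grad_deriv_injective:
  fixes z h :: "'n::finite heis"
  assumes z: "z \<noteq> 0" and D: "dderiv (frame_grad a b \<beta>) h z = 0"
  shows "h = 0"
proof -
  have zS: "z \<in> - {0}" using z by simp
  define s m A t where "s = sq_rho b z" and "m = grad_coeff b \<beta> z" and "A = sq_x b z" and "t = snd z"
  define s' m' A' t' where "s' = dderiv (sq_rho b) h z" and "m' = dderiv (grad_coeff b \<beta>) h z"
    and "A' = 2 * b\<^sup>2 * (fst z \<bullet> fst h)" and "t' = snd h"
  define k where "k = \<beta> / 2 + 1"
  have pos: "s > 0" "m > 0" "2 * s - A > 0" "A \<ge> 0"
    using sq_rho_pos[OF b z] grad_coeff_pos[OF z] denom_pos[OF b z] sq_x_nonneg[OF b, of z]
    by (auto simp: s_def m_def A_def)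
  have eq: "s\<^sup>2 = A * s + b\<^sup>2 * t\<^sup>2" using sq_rho_eq[OF b, of z] by (simp add: s_def A_def t_def)
  have ds: "(sq_rho b has_derivative (\<lambda>h. dderiv (sq_rho b) h z)) (at z)"
    by (rule has_dderiv[OF sq_rho_differentiable[OF b z]])
  have dm: "(grad_coeff b \<beta> has_derivative (\<lambda>h. dderiv (grad_coeff b \<beta>) h z)) (at z)"
    by (rule has_dderiv[OF smooth_on_differentiable[OF smooth_on_grad_coeff zS]])
  have dV: "(frame_grad a b \<beta> has_derivative (\<lambda>h. dderiv (frame_grad a b \<beta>) h z)) (at z)"
    by (rule has_dderiv[OF smooth_on_differentiable[OF smooth_on_frame_grad zS]])
  have dA: "(sq_x b has_derivative (\<lambda>h. 2 * b\<^sup>2 * (fst z \<bullet> fst h))) (at z)" by (rule sq_x_deriv[OF b])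
  have dt: "(snd has_derivative snd) (at z)" by (rule has_derivative_snd[OF has_derivative_ident])
  have E1: "(2 * s - A) * s' = A' * s + 2 * b\<^sup>2 * (t * t')"
    using sq_rho_dderiv[OF b z, of h] by (simp add: s_def A_def s'_def A'_def t_def t'_def algebra_simps)
  have E2: "m' * t + m * t' = 0"
  proof -
    have "((\<lambda>z. snd (frame_grad a b \<beta> z)) has_derivative (\<lambda>h. snd (dderiv (frame_grad a b \<beta>) h z))) (at z)"
      by (rule has_derivative_snd[OF dV])
    moreover have "((\<lambda>z. snd (frame_grad a b \<beta> z)) has_derivative
        (\<lambda>h. grad_coeff b \<beta> z * snd h + dderiv (grad_coeff b \<beta>) h z * snd z)) (at z)"
      unfolding frame_grad_def snd_conv by (rule has_derivative_mult[OF dm dt])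
    ultimately have "(\<lambda>h. snd (dderiv (frame_grad a b \<beta>) h z)) = (\<lambda>h. grad_coeff b \<beta> z * snd h + dderiv (grad_coeff b \<beta>) h z * snd z)"
      by (rule has_derivative_unique)
    from fun_cong[OF this, of h] show ?thesis using D by (simp add: m_def m'_def t_def t'_def)
  qed
  have E3: "2 * m * m' * (A * (s\<^sup>2 + 4 * a\<^sup>2 * t\<^sup>2))
      + m\<^sup>2 * (A' * (s\<^sup>2 + 4 * a\<^sup>2 * t\<^sup>2) + A * (2 * s * s' + 4 * a\<^sup>2 * (2 * t * t'))) = 0"
  proof -
    have "((\<lambda>z. b\<^sup>2 * (fst (frame_grad a b \<beta> z) \<bullet> fst (frame_grad a b \<beta> z))) has_derivative
       (\<lambda>h. b\<^sup>2 * (fst (frame_grad a b \<beta> z) \<bullet> fst (dderiv (frame_grad a b \<beta>) h z)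
          + fst (dderiv (frame_grad a b \<beta>) h z) \<bullet> fst (frame_grad a b \<beta> z)))) (at z)"
      by (intro has_derivative_mult_right has_derivative_inner has_derivative_fst[OF dV])
    moreover have "((\<lambda>z. b\<^sup>2 * (fst (frame_grad a b \<beta> z) \<bullet> fst (frame_grad a b \<beta> z))) has_derivative
       (\<lambda>h. m\<^sup>2 * (A * (2 * s * dderiv (sq_rho b) h z + 4 * a\<^sup>2 * (2 * t * snd h))
            + 2 * b\<^sup>2 * (fst z \<bullet> fst h) * (s\<^sup>2 + 4 * a\<^sup>2 * t\<^sup>2))
          + 2 * m * dderiv (grad_coeff b \<beta>) h z * (A * (s\<^sup>2 + 4 * a\<^sup>2 * t\<^sup>2)))) (at z)"
      unfolding norm_fst_frame_grad
      by (rule has_derivative_eq_rhs,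
          rule has_derivative_mult[OF has_derivative_power[OF dm] has_derivative_mult[OF dA
            has_derivative_add[OF has_derivative_power[OF ds] has_derivative_mult_right[OF has_derivative_power[OF dt]]]]])
        (auto simp: s_def m_def A_def t_def)
    ultimately have "(\<lambda>h. b\<^sup>2 * (fst (frame_grad a b \<beta> z) \<bullet> fst (dderiv (frame_grad a b \<beta>) h z)
          + fst (dderiv (frame_grad a b \<beta>) h z) \<bullet> fst (frame_grad a b \<beta> z)))
       = (\<lambda>h. m\<^sup>2 * (A * (2 * s * dderiv (sq_rho b) h z + 4 * a\<^sup>2 * (2 * t * snd h))
            + 2 * b\<^sup>2 * (fst z \<bullet> fst h) * (s\<^sup>2 + 4 * a\<^sup>2 * t\<^sup>2))
          + 2 * m * dderiv (grad_coeff b \<beta>) h z * (A * (s\<^sup>2 + 4 * a\<^sup>2 * t\<^sup>2)))"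
      by (rule has_derivative_unique)
    from fun_cong[OF this, of h] show ?thesis using D
      by (simp add: s'_def m'_def A'_def t'_def algebra_simps)
  qed
  have E4: "m' * (2 * s - A) + m * (2 * s' - A') = - k * (m * (2 * s - A)) * s' / s"
  proof -
    have "((\<lambda>z. grad_coeff b \<beta> z * (2 * sq_rho b z - sq_x b z)) has_derivative
       (\<lambda>h. m * (2 * dderiv (sq_rho b) h z - 2 * b\<^sup>2 * (fst z \<bullet> fst h)) + dderiv (grad_coeff b \<beta>) h z * (2 * s - A))) (at z)"
      unfolding m_def s_def A_def
      by (rule has_derivative_mult[OF dm has_derivative_diff[OF has_derivative_mult_right[OF ds] dA]])
    then have 1: "dderiv (\<lambda>z. grad_coeff b \<beta> z * (2 * sq_rho b z - sq_x b z)) h z = m * (2 * s' - A') + m' * (2 * s - A)"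
      by (subst dderiv_eq, assumption) (simp add: s'_def A'_def m'_def)
    have "((\<lambda>x. x powr (- k)) has_derivative (\<lambda>v. (- k * s powr (- k - 1)) * v)) (at (sq_rho b z))"
      using has_real_derivative_powr[OF pos(1), of "- k"] unfolding has_field_derivative_def s_def .
    from has_derivative_compose[OF ds this]
    have 2: "dderiv (\<lambda>z. sq_rho b z powr (- k)) h z = (- k * s powr (- k - 1)) * s'"
      unfolding s'_def by (rule dderiv_eq)
    have "grad_coeff b \<beta> y * (2 * sq_rho b y - sq_x b y) = sq_rho b y powr (- k)" if "y \<in> - {0}" for y :: "'n heis"
      using denom_pos[OF b, of y] that by (simp add: grad_coeff_def k_def)
    then have "dderiv (\<lambda>z. grad_coeff b \<beta> z * (2 * sq_rho b z - sq_x b z)) h z = dderiv (\<lambda>z. sq_rho b z powr (- k)) h z"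
      by (subst frechet_derivative_cong_open[OF open_nonzero zS]) auto
    moreover have "m * (2 * s - A) = s powr (- k)"
      using pos by (simp add: m_def grad_coeff_def s_def A_def k_def)
    moreover have "s powr (- k - 1) = s powr (- k) / s" using pos by (simp add: powr_diff)
    ultimately show ?thesis using 1 2 by simp
  qed
  \<comment> \<open>In logarithmic derivatives all powers of \<open>s\<close> and \<open>m\<close>
    cancel from the equations, and the coefficients depend on \<open>w\<close>, \<open>c\<close> and
    \<open>k\<close> alone.\<close>
  define w c \<sigma> \<mu> \<alpha> where "w = b\<^sup>2 * t\<^sup>2 / s\<^sup>2" and "c = 4 * a\<^sup>2 / b\<^sup>2" and "\<sigma> = s' / s" and "\<mu> = m' / m" and "\<alpha> = A' / s"
  have r: "s' = s * \<sigma>" "m' = m * \<mu>" "A' = s * \<alpha>" using pos by (auto simp: \<sigma>_def \<mu>_def \<alpha>_def)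
  have bt: "b\<^sup>2 * t\<^sup>2 = w * s\<^sup>2" using pos by (simp add: w_def)
  have at: "4 * a\<^sup>2 * t\<^sup>2 = c * w * s\<^sup>2" using pos b by (simp add: w_def c_def)
  have A: "A = s * (1 - w)"
  proof -
    have "s * A = s * (s * (1 - w))" using eq unfolding bt by (simp add: algebra_simps power2_eq_square)
    then show ?thesis using pos by simp
  qed
  have "s * (1 - w) \<ge> 0" using pos(4) unfolding A .
  then have w: "0 \<le> w" "w \<le> 1" using pos(1) by (simp_all add: zero_le_mult_iff) (simp add: w_def)
  have c: "0 \<le> c" "c \<le> 4" using ab by (auto simp: c_def)
  have t': "t' = - t * \<mu>"
  proof -
    have "m * (t' + t * \<mu>) = 0" using E2 unfolding r by (simp add: algebra_simps)
    then show ?thesis using pos by simp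
  qed
  have "s\<^sup>2 * ((1 + w) * \<sigma>) = s\<^sup>2 * (\<alpha> - 2 * w * \<mu>)"
  proof -
    have "2 * b\<^sup>2 * (t * t') = - 2 * \<mu> * (b\<^sup>2 * t\<^sup>2)" by (simp add: t' power2_eq_square algebra_simps)
    then show ?thesis using E1 unfolding bt A r by (simp add: algebra_simps power2_eq_square)
  qed
  then have F1: "\<alpha> = (1 + w) * \<sigma> + 2 * w * \<mu>" using pos by simp
  have "(m * s) * (\<mu> * (1 + w) + 2 * \<sigma> - \<alpha> + k * (1 + w) * \<sigma>) = 0"
  proof -
    have "- k * (m * (2 * s - A)) * s' / s = - k * (m * (2 * s - A)) * \<sigma>" by (simp add: \<sigma>_def)
    then have "m' * (2 * s - A) + m * (2 * s' - A') = - k * (m * (2 * s - A)) * \<sigma>" using E4 by simp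
    then show ?thesis unfolding A r by (simp add: algebra_simps)
  qed
  then have "\<mu> * (1 + w) + 2 * \<sigma> - \<alpha> + k * (1 + w) * \<sigma> = 0" using pos by simp
  then have F4: "\<mu> * (1 - w) + \<sigma> * (1 - w + k * (1 + w)) = 0"
    unfolding F1 by (simp add: algebra_simps)
  have "(m\<^sup>2 * s ^ 3) * (2 * \<mu> * (1 - w) * (1 + c * w) + \<alpha> * (1 + c * w) + (1 - w) * (2 * \<sigma> - 2 * c * w * \<mu>)) = 0"
  proof -
    have tt: "4 * a\<^sup>2 * (2 * t * t') = - 2 * \<mu> * (c * w * s\<^sup>2)"
      unfolding at[symmetric] by (simp add: t' power2_eq_square algebra_simps)
    show ?thesis using E3 unfolding tt at A r by (simp add: algebra_simps power2_eq_square power3_eq_cube)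
  qed
  then have "2 * \<mu> * (1 - w) * (1 + c * w) + \<alpha> * (1 + c * w) + (1 - w) * (2 * \<sigma> - 2 * c * w * \<mu>) = 0"
    using pos by simp
  then have F3: "\<mu> * (2 + 2 * c * w\<^sup>2) + \<sigma> * (3 - w + c * w + c * w\<^sup>2) = 0"
    unfolding F1 by (simp add: algebra_simps power2_eq_square)
  define det where "det = (1 - w) * (3 - w + c * w + c * w\<^sup>2) - (2 + 2 * c * w\<^sup>2) * (1 - w + k * (1 + w))"
  have det: "det < 0" unfolding det_def using determinant_neg[OF w c] \<beta> by (simp add: k_def)
  \<comment> \<open>Elimination of \<sigma> from \<open>F4\<close> and \<open>F3\<close>.\<close>
  have "\<mu> * det = (\<mu> * (1 - w) + \<sigma> * (1 - w + k * (1 + w))) * (3 - w + c * w + c * w\<^sup>2)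
      - (\<mu> * (2 + 2 * c * w\<^sup>2) + \<sigma> * (3 - w + c * w + c * w\<^sup>2)) * (1 - w + k * (1 + w))"
    unfolding det_def by (simp add: algebra_simps)
  then have \<mu>0: "\<mu> = 0" using det unfolding F3 F4 by simp
  have "3 - w + c * w + c * w\<^sup>2 > 0" using w c by (intro add_pos_nonneg) auto
  then have \<sigma>0: "\<sigma> = 0" using F3 \<mu>0 by simp
  have zero: "s' = 0" "m' = 0" "t' = 0" using \<mu>0 \<sigma>0 r t' by auto
  have "fst h = 0"
  proof -
    let ?W = "\<lambda>z::'n heis. sq_rho b z *\<^sub>R fst z + (2 * a * snd z) *\<^sub>R sympl_J (fst z)"
    have dfst: "(fst has_derivative fst) (at z)" by (rule has_derivative_fst[OF has_derivative_ident])
    have dJ: "((\<lambda>z. sympl_J (fst z)) has_derivative (\<lambda>h. sympl_J (fst h))) (at z)"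
      by (rule bounded_linear.has_derivative[OF bounded_linear_sympl_J dfst])
    have dW: "(?W has_derivative (\<lambda>h. (sq_rho b z *\<^sub>R fst h + dderiv (sq_rho b) h z *\<^sub>R fst z)
        + ((2 * a * snd z) *\<^sub>R sympl_J (fst h) + (2 * a * snd h) *\<^sub>R sympl_J (fst z)))) (at z)"
      by (intro has_derivative_add has_derivative_scaleR ds dfst dJ has_derivative_mult_right dt)
    have "((\<lambda>z. fst (frame_grad a b \<beta> z)) has_derivative (\<lambda>h. grad_coeff b \<beta> z *\<^sub>R
        ((sq_rho b z *\<^sub>R fst h + dderiv (sq_rho b) h z *\<^sub>R fst z)
        + ((2 * a * snd z) *\<^sub>R sympl_J (fst h) + (2 * a * snd h) *\<^sub>R sympl_J (fst z)))
        + dderiv (grad_coeff b \<beta>) h z *\<^sub>R ?W z)) (at z)"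
      unfolding frame_grad_def fst_conv by (rule has_derivative_scaleR[OF dm dW])
    from fun_cong[OF has_derivative_unique[OF has_derivative_fst[OF dV] this], of h]
    have "m *\<^sub>R (s *\<^sub>R fst h + (2 * a * t) *\<^sub>R sympl_J (fst h)) = 0"
      using D zero unfolding s'_def m'_def t'_def by (simp add: m_def s_def t_def)
    then show ?thesis using pos rotation_injective[of s "fst h" "2 * a * t"] by simp
  qed
  with zero show ?thesis by (simp add: t'_def prod_eq_iff)
qed

end

text \<open>Cauchy-Schwarz. It allows a lower bound for the gradient to be read off from one well
  chosen direction.\<close>

lemma dderiv_le_grad:
  fixes f :: "'a::euclidean_space \<Rightarrow> real"
  assumes "f differentiable (at z)"
  shows "(dderiv f v z)\<^sup>2 \<le> (norm v)\<^sup>2 * (\<Sum>b\<in>Basis. (dderiv f b z)\<^sup>2)"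
proof -
  have "dderiv f v z = (\<Sum>b\<in>Basis. (v \<bullet> b) * dderiv f b z)"
    using dderiv_representation[OF assms, of v] by simp
  then have "(dderiv f v z)\<^sup>2 \<le> (\<Sum>b\<in>Basis. (v \<bullet> b)\<^sup>2) * (\<Sum>b\<in>Basis. (dderiv f b z)\<^sup>2)"
    using Cauchy_Schwarz_ineq_sum[of "\<lambda>b. v \<bullet> b" "\<lambda>b. dderiv f b z" Basis] by simp
  moreover have "(\<Sum>b\<in>Basis. (v \<bullet> b)\<^sup>2) = (norm v)\<^sup>2"
  proof -
    have "(norm v)\<^sup>2 = (\<Sum>b\<in>Basis. (v \<bullet> b) * (v \<bullet> b))"
      unfolding power2_norm_eq_inner by (rule euclidean_inner)
    then show ?thesis by (simp only: power2_eq_square)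
  qed
  ultimately show ?thesis by simp
qed

lemma has_derivative_left_mult:
  "(heis_mult a u has_derivative (\<lambda>h. (fst h, snd h - 2 * a * (fst u \<bullet> sympl_J (fst h))))) (at z)"
proof -
  have J: "((\<lambda>z. sympl_J (fst z)) has_derivative (\<lambda>h. sympl_J (fst h))) (at z)" for z :: "'n::finite heis"
    by (rule bounded_linear.has_derivative[OF bounded_linear_sympl_J has_derivative_fst[OF has_derivative_ident]])
  show ?thesis unfolding heis_mult_def[abs_def]
    by (rule has_derivative_eq_rhs, (rule has_derivative_Pair has_derivative_add has_derivative_diff
        has_derivative_mult_right has_derivative_inner_right has_derivative_const
        has_derivative_fst has_derivative_snd has_derivative_ident J)+) auto
qed

section \<open>Lower bounds for the gradient of the phase\<close>

context
  fixes a b \<beta> :: real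
  assumes b: "b \<noteq> 0" and ab: "a\<^sup>2 / b\<^sup>2 \<le> 1" and \<beta>: "\<beta> > 0"
begin

text \<open>Compactness of \<open>D \<times> D\<close>. Away from the diagonal, injectivity keeps
  the two values apart; at the diagonal, the injective derivative is bounded below, and strict
  differentiability carries that bound over to pairs of nearby points.\<close>

lemma frame_grad_lower_Lipschitz:
  fixes D :: "'n::finite heis set"
  assumes D: "compact D" "D \<subseteq> - {0}"
  obtains c where "c > 0" "\<And>y z. y \<in> D \<Longrightarrow> z \<in> D \<Longrightarrow> c * norm (y - z) \<le> norm (frame_grad a b \<beta> y - frame_grad a b \<beta> z)"
proof -
  let ?V = "frame_grad a b \<beta> :: 'n heis \<Rightarrow> 'n heis"
  note V = smooth_on_frame_grad[OF b ab \<beta>]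
  have loc: "\<exists>U B. open U \<and> x \<in> U \<and> (\<forall>y\<in>U \<inter> D \<times> D. norm (fst y - snd y) \<le> B * norm (?V (fst y) - ?V (snd y)))"
    if x: "x \<in> D \<times> D" for x
  proof (cases "fst x = snd x")
    case False
    define \<phi> where "\<phi> p = norm (?V (fst p) - ?V (snd p))" for p
    define O' where "O' = (- {0 :: 'n heis}) \<times> (- {0 :: 'n heis})"
    have O': "open O'" unfolding O'_def by (intro open_Times open_Compl closed_singleton)
    have cV: "continuous_on (- {0}) ?V" by (rule smooth_on_continuous[OF V])
    have "continuous_on O' \<phi>"
      unfolding \<phi>_def O'_def
      by (intro continuous_intros continuous_on_compose2[OF cV]) auto
    moreover have xO: "x \<in> O'" using x D by (auto simp: O'_def)
    have d: "\<phi> x > 0"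
      using False frame_grad_injective[OF b ab \<beta>, of "fst x" "snd x"] xO by (auto simp: \<phi>_def O'_def)
    ultimately have "open (O' \<inter> \<phi> -` {\<phi> x / 2<..})" using O' by (intro continuous_open_preimage) auto
    moreover have "open {p :: 'n heis \<times> 'n heis. norm (fst p - snd p) < norm (fst x - snd x) + 1}"
      by (intro open_Collect_less continuous_intros)
    ultimately have oU: "open ((O' \<inter> \<phi> -` {\<phi> x / 2<..}) \<inter> {p. norm (fst p - snd p) < norm (fst x - snd x) + 1})"
      by (rule open_Int)
    have bd: "norm (fst y - snd y) \<le> (norm (fst x - snd x) + 1) / (\<phi> x / 2) * norm (?V (fst y) - ?V (snd y))"
      if "y \<in> (O' \<inter> \<phi> -` {\<phi> x / 2<..}) \<inter> {p. norm (fst p - snd p) < norm (fst x - snd x) + 1}" for y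
    proof -
      have "norm (fst y - snd y) \<le> (norm (fst x - snd x) + 1) / (\<phi> x / 2) * (\<phi> x / 2)" using that d by simp
      also have "\<dots> \<le> (norm (fst x - snd x) + 1) / (\<phi> x / 2) * \<phi> y"
        using that d by (intro mult_left_mono) auto
      finally show ?thesis by (simp add: \<phi>_def)
    qed
    have "x \<in> (O' \<inter> \<phi> -` {\<phi> x / 2<..}) \<inter> {p. norm (fst p - snd p) < norm (fst x - snd x) + 1}"
      using xO d by simp
    with oU bd show ?thesis by blast
  next
    case True
    define z where "z = fst x"
    have z: "z \<in> - {0}" using x D by (auto simp: z_def)
    have lin: "linear (\<lambda>h. dderiv ?V h z)"
      by (rule has_derivative_linear[OF has_dderiv[OF smooth_on_differentiable[OF V z]]])
    have "inj (\<lambda>h. dderiv ?V h z)"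
      using frame_grad_deriv_injective[OF b ab \<beta>, of z] z by (auto simp: linear_injective_0[OF lin])
    then obtain k where k: "k > 0" "\<And>h. k * norm h \<le> norm (dderiv ?V h z)"
      using linear_inj_bounded_below_pos[OF lin] by metis
    \<comment> \<open>Half of the lower bound \<open>k\<close> is given up to absorb the error of
      linearisation.\<close>
    have "k / 2 > 0" using k(1) by simp
    then obtain e where e: "e > 0" "ball z e \<subseteq> - {0}" "\<And>y w. y \<in> ball z e \<Longrightarrow> w \<in> ball z e \<Longrightarrow>
        norm (?V y - ?V w - dderiv ?V (y - w) z) \<le> (k / 2) * norm (y - w)"
      using strict_differentiability[OF open_nonzero V z] by metis
    have "norm (y - w) \<le> 2 / k * norm (?V y - ?V w)" if "y \<in> ball z e" "w \<in> ball z e" for y w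
    proof -
      have "k * norm (y - w) \<le> norm (?V y - ?V w) + k / 2 * norm (y - w)"
        using k(2)[of "y - w"] e(3)[OF that] norm_triangle_ineq4[of "?V y - ?V w" "?V y - ?V w - dderiv ?V (y - w) z"]
        by simp
      then show ?thesis using k(1) by (simp add: field_simps)
    qed
    moreover have "x \<in> ball z e \<times> ball z e" using True e by (auto simp: z_def mem_Times_iff)
    ultimately show ?thesis
      by (intro exI[of _ "ball z e \<times> ball z e"] exI[of _ "2 / k"]) (auto intro!: open_Times)
  qed
  obtain B where B: "B > 0" "\<And>x. x \<in> D \<times> D \<Longrightarrow> norm (fst x - snd x) \<le> B * norm (?V (fst x) - ?V (snd x))"
    by (rule compact_local_bound[OF compact_Times[OF D(1) D(1)] _ loc]) auto
  show ?thesis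
  proof
    show "1 / B > 0" using B by simp
    fix y z assume "y \<in> D" "z \<in> D"
    then show "1 / B * norm (y - z) \<le> norm (?V y - ?V z)" using B(2)[of "(y, z)"] B(1) by (simp add: field_simps)
  qed
qed

lemma Phi_differentiable: "z \<noteq> 0 \<Longrightarrow> Phi b \<beta> differentiable (at z)"
  by (rule smooth_on_differentiable[OF smooth_on_Phi[OF b ab \<beta>]]) simp

text \<open>The derivative in the direction \<open>z\<close> itself is nonzero, being a nonzero
  multiple of \<open>sq_rho b z * (fst z \<bullet> fst z) + snd z * snd z\<close>.\<close>

lemma Phi_grad_pos:
  fixes z :: "'n::finite heis"
  assumes z: "z \<noteq> 0"
  shows "0 < (\<Sum>e\<in>Basis. (dderiv (Phi b \<beta>) e z)\<^sup>2)"
proof -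
  have "sq_rho b z * (fst z \<bullet> fst z) + snd z * snd z > 0"
  proof (cases "fst z = 0")
    case True
    then have "snd z \<noteq> 0" using z by (metis prod.collapse zero_prod_def)
    then have "(snd z)\<^sup>2 > 0" by simp
    then show ?thesis using True by (simp add: power2_eq_square)
  next
    case False
    then show ?thesis using sq_rho_pos[OF b z] by (intro add_pos_nonneg) auto
  qed
  then have "dderiv (Phi b \<beta>) z z \<noteq> 0"
    using Phi_dderiv[OF b ab \<beta> z, of z] grad_coeff_pos[OF b ab \<beta> z] b \<beta> by simp
  then have "0 < (dderiv (Phi b \<beta>) z z)\<^sup>2" by simp
  also have "\<dots> \<le> (norm z)\<^sup>2 * (\<Sum>e\<in>Basis. (dderiv (Phi b \<beta>) e z)\<^sup>2)"
    by (rule dderiv_le_grad[OF Phi_differentiable[OF z]])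
  finally show ?thesis using z by (simp add: zero_less_mult_iff)
qed

lemma phase_difference_differentiable:
  assumes "z \<noteq> 0" "heis_mult a u z \<noteq> 0"
  shows "((\<lambda>z. Phi b \<beta> (heis_mult a u z) - Phi b \<beta> z) has_derivative
     (\<lambda>h. dderiv (Phi b \<beta>) (fst h, snd h - 2 * a * (fst u \<bullet> sympl_J (fst h))) (heis_mult a u z) - dderiv (Phi b \<beta>) h z)) (at z)"
  by (rule has_derivative_diff[OF has_derivative_compose[OF has_derivative_left_mult
        has_dderiv[OF Phi_differentiable[OF assms(2)]]] has_dderiv[OF Phi_differentiable[OF assms(1)]]])

text \<open>One direction is tested: \<open>v\<close> is the value at \<open>z\<close> of the
  left-invariant field with coefficients \<open>d\<close>, the difference of the two frame
  gradients. Left translation by \<open>u\<close> carries it to the same field at the translated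
  point, so the derivative of the phase along \<open>v\<close> is
  \<open>- \<beta> * b\<^sup>2 * (d \<bullet> d)\<close>. It remains to compare the sizes of
  \<open>v\<close>, \<open>d\<close> and \<open>u\<close>.\<close>

lemma phase_difference_grad:
  fixes D :: "'n::finite heis set"
  assumes D: "compact D" "D \<subseteq> - {0}"
  obtains c where "c > 0" "\<And>u z. z \<in> D \<Longrightarrow> heis_mult a u z \<in> D \<Longrightarrow>
    c * (norm u)\<^sup>2 \<le> (\<Sum>e\<in>Basis. (dderiv (\<lambda>z. Phi b \<beta> (heis_mult a u z) - Phi b \<beta> z) e z)\<^sup>2)"
proof -
  let ?V = "frame_grad a b \<beta> :: 'n heis \<Rightarrow> 'n heis"
  obtain c where c: "c > 0" "\<And>y z. y \<in> D \<Longrightarrow> z \<in> D \<Longrightarrow> c * norm (y - z) \<le> norm (?V y - ?V z)"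
    using frame_grad_lower_Lipschitz[OF D] by blast
  obtain M where M: "\<And>z. z \<in> D \<Longrightarrow> norm z \<le> M" "M > 0"
    using compact_imp_bounded[OF D(1)] unfolding bounded_pos by auto
  \<comment> \<open>One constant for two estimates: \<open>norm v\<close> by \<open>norm d\<close>,
    and \<open>norm u\<close> by the distance between \<open>z\<close> and its translate. In both
    the term with \<open>a\<close> stems from the group law.\<close>
  define L where "L = 2 + 2 * \<bar>a\<bar> * M"
  have L: "L > 0" using M by (simp add: L_def add_pos_nonneg)
  show ?thesis
  proof
    show "(\<beta> * b\<^sup>2 * c / L\<^sup>2)\<^sup>2 > 0" using c L b \<beta> by simp
    fix u z assume z: "z \<in> D" and uz: "heis_mult a u z \<in> D"
    have z0: "z \<noteq> 0" and uz0: "heis_mult a u z \<noteq> 0" using z uz D by auto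
    have xM: "norm (fst z) \<le> M" using norm_fst_le[of "fst z" "snd z"] M(1)[OF z] by simp
    let ?F = "\<lambda>z. Phi b \<beta> (heis_mult a u z) - Phi b \<beta> z"
    define G where "G = (\<Sum>e\<in>Basis. (dderiv ?F e z)\<^sup>2)"
    note dF = phase_difference_differentiable[OF z0 uz0]
    define d where "d = ?V (heis_mult a u z) - ?V z"
    define v where "v = (fst d, snd d - 2 * a * (fst z \<bullet> sympl_J (fst d)))"
    have "dderiv ?F v z = dderiv (Phi b \<beta>) (fst v, snd v - 2 * a * (fst u \<bullet> sympl_J (fst v))) (heis_mult a u z)
        - dderiv (Phi b \<beta>) v z"
      by (rule dderiv_eq[OF dF])
    also have "(fst v, snd v - 2 * a * (fst u \<bullet> sympl_J (fst v)))
        = (fst d, snd d - 2 * a * (fst (heis_mult a u z) \<bullet> sympl_J (fst d)))"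
      by (simp add: v_def heis_mult_def inner_add_left algebra_simps)
    finally have e: "dderiv ?F v z = - \<beta> * b\<^sup>2 * (?V (heis_mult a u z) \<bullet> (fst d, snd d)) - (- \<beta> * b\<^sup>2 * (?V z \<bullet> (fst d, snd d)))"
      unfolding v_def using Phi_dderiv_frame[OF b ab \<beta> uz0, of "fst d" "snd d"] Phi_dderiv_frame[OF b ab \<beta> z0, of "fst d" "snd d"]
      by simp
    have "dderiv ?F v z = - \<beta> * b\<^sup>2 * (d \<bullet> d)"
      unfolding e prod.collapse by (simp add: d_def inner_diff_left right_diff_distrib)
    then have 1: "(dderiv ?F v z)\<^sup>2 = (\<beta> * b\<^sup>2 * (norm d)\<^sup>2)\<^sup>2" by (simp add: power2_norm_eq_inner)
    have Jb: "\<bar>x \<bullet> sympl_J y\<bar> \<le> norm x * norm y" for x y :: "(real^'n) \<times> (real^'n)"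
      using Cauchy_Schwarz_ineq2[of x "sympl_J y"] by simp
    have "norm v \<le> norm (fst d) + (norm (snd d) + 2 * \<bar>a\<bar> * (M * norm d))"
    proof -
      have "norm v \<le> norm (fst d) + norm (snd d - 2 * a * (fst z \<bullet> sympl_J (fst d)))"
        unfolding v_def by (rule norm_Pair_le)
      also have "norm (snd d - 2 * a * (fst z \<bullet> sympl_J (fst d))) \<le> norm (snd d) + 2 * \<bar>a\<bar> * \<bar>fst z \<bullet> sympl_J (fst d)\<bar>"
        using norm_triangle_ineq4[of "snd d" "2 * a * (fst z \<bullet> sympl_J (fst d))"] by (simp add: abs_mult)
      also have "\<bar>fst z \<bullet> sympl_J (fst d)\<bar> \<le> M * norm d"
      proof (rule order_trans[OF Jb mult_mono])
        show "norm (fst d) \<le> norm d" by (metis norm_fst_le prod.collapse)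
      qed (use xM M in auto)
      finally show ?thesis by (simp add: mult_left_mono)
    qed
    moreover have "norm (fst d) \<le> norm d" "norm (snd d) \<le> norm d"
      by (metis norm_fst_le prod.collapse, metis norm_snd_le prod.collapse)
    ultimately have vb: "norm v \<le> L * norm d" by (simp add: L_def algebra_simps)
    have "norm u \<le> L * norm (heis_mult a u z - z)"
    proof -
      let ?w = "heis_mult a u z - z"
      have w: "?w = (fst u, snd u - 2 * a * (fst u \<bullet> sympl_J (fst z)))" by (simp add: heis_mult_def prod_eq_iff)
      have w1: "norm (fst u) \<le> norm ?w" unfolding w by (rule norm_fst_le)
      have w2: "norm (snd u - 2 * a * (fst u \<bullet> sympl_J (fst z))) \<le> norm ?w" unfolding w by (rule norm_snd_le)
      have "\<bar>fst u \<bullet> sympl_J (fst z)\<bar> \<le> norm ?w * M"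
        by (rule order_trans[OF Jb mult_mono]) (use w1 xM in auto)
      then have "\<bar>2 * a * (fst u \<bullet> sympl_J (fst z))\<bar> \<le> 2 * \<bar>a\<bar> * (norm ?w * M)"
        by (simp add: abs_mult mult_left_mono)
      then have "norm (snd u) \<le> norm ?w + 2 * \<bar>a\<bar> * (norm ?w * M)" using w2 by simp
      moreover have "norm u \<le> norm (fst u) + norm (snd u)" using norm_Pair_le[of "fst u" "snd u"] by simp
      ultimately show ?thesis using w1 by (simp add: L_def algebra_simps)
    qed
    also have "\<dots> \<le> L * (norm d / c)"
      using c(2)[OF uz z] c(1) L by (intro mult_left_mono) (auto simp: d_def field_simps)
    finally have ub: "c * norm u \<le> L * norm d" using c(1) by (simp add: field_simps)
    have "(\<beta> * b\<^sup>2 * (norm d)\<^sup>2)\<^sup>2 \<le> (norm v)\<^sup>2 * G"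
    proof -
      have "?F differentiable (at z)" using dF unfolding differentiable_def by blast
      from dderiv_le_grad[OF this, of v] show ?thesis unfolding 1 G_def .
    qed
    also have "\<dots> \<le> (L * norm d)\<^sup>2 * G"
      using vb by (intro mult_right_mono power_mono) (auto simp: G_def sum_nonneg)
    finally have main: "(norm d)\<^sup>2 * ((\<beta> * b\<^sup>2 * norm d)\<^sup>2) \<le> (norm d)\<^sup>2 * (L\<^sup>2 * G)"
      by (simp add: power_mult_distrib power2_eq_square mult_ac)
    have G0: "G \<ge> 0" by (simp add: G_def sum_nonneg)
    have "(\<beta> * b\<^sup>2 * norm d)\<^sup>2 \<le> L\<^sup>2 * G"
      using main G0 by (cases "d = 0") (auto simp: mult_le_cancel_left)
    moreover have "(\<beta> * b\<^sup>2 * (c * norm u))\<^sup>2 \<le> (\<beta> * b\<^sup>2 * (L * norm d))\<^sup>2"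
      using ub \<beta> c by (intro power_mono mult_left_mono) auto
    ultimately have "(\<beta> * b\<^sup>2 * (c * norm u))\<^sup>2 \<le> L\<^sup>2 * (L\<^sup>2 * G)"
      using mult_left_mono[of "(\<beta> * b\<^sup>2 * norm d)\<^sup>2" "L\<^sup>2 * G" "L\<^sup>2"]
      by (simp add: power_mult_distrib mult_ac)
    then show "(\<beta> * b\<^sup>2 * c / L\<^sup>2)\<^sup>2 * (norm u)\<^sup>2 \<le> (\<Sum>e\<in>Basis. (dderiv ?F e z)\<^sup>2)"
      unfolding G_def[symmetric] using L by (simp add: power_divide power_mult_distrib field_simps flip: power_add)
  qed
qed

end

section \<open>Oscillatory integrals on the annulus\<close>

lemma slice_dderiv:
  fixes H :: "'a::euclidean_space \<times> 'q::euclidean_space \<Rightarrow> 'b::real_normed_vector"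
  assumes "H differentiable (at (z, p))"
  shows "((\<lambda>z. H (z, p)) has_derivative (\<lambda>v. dderiv H (v, 0) (z, p))) (at z)"
proof -
  have "((\<lambda>z. (z, p)) has_derivative (\<lambda>v. (v, 0))) (at z)" by (auto intro!: derivative_eq_intros)
  from has_derivative_compose[OF this has_dderiv[OF assms]] show ?thesis .
qed

text \<open>With the parameter as an additional coordinate, every \<open>z\<close>-derivative is
  again a jointly smooth function, so a bound for all such functions bounds all derivatives.
  \<open>Z\<close> is a property inherited by \<open>z\<close>-derivatives; it makes room for
  functions vanishing at \<open>u = 0\<close>.\<close>

lemma (in family) scale_Ck_joint:
  fixes H :: "'a \<times> 'q::euclidean_space \<Rightarrow> 'b::real_normed_vector" and \<pi> :: "'p \<Rightarrow> 'q" and w :: "'p \<Rightarrow> real"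
  assumes \<Omega>: "open \<Omega>" and S: "\<And>p. p \<in> P \<Longrightarrow> S p = {z. (z, \<pi> p) \<in> \<Omega>}"
    and Z: "\<And>H :: 'a \<times> 'q \<Rightarrow> 'b. smooth_on \<Omega> H \<Longrightarrow> Z H \<Longrightarrow> scale_bounded w (\<lambda>p z. H (z, \<pi> p))"
      "\<And>H :: 'a \<times> 'q \<Rightarrow> 'b. \<And>v. smooth_on \<Omega> H \<Longrightarrow> Z H \<Longrightarrow> Z (dderiv H (v, 0))"
    and H: "smooth_on \<Omega> H" "Z H"
  shows "scale_Ck k w (\<lambda>p z. H (z, \<pi> p))"
  using H
proof (induction k arbitrary: H)
  case 0
  have "continuous_on (S p) (\<lambda>z. H (z, \<pi> p))" if "p \<in> P" for p
    by (rule continuous_on_compose2[OF smooth_on_continuous[OF 0(1)]])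
      (use S[OF that] in \<open>auto intro!: continuous_intros\<close>)
  then show ?case using Z(1)[OF 0] by simp
next
  case (Suc k)
  have d: "((\<lambda>z. H (z, \<pi> p)) has_derivative (\<lambda>v. dderiv H (v, 0) (z, \<pi> p))) (at z)" if "p \<in> P" "z \<in> S p" for p z
    using S[OF that(1)] that(2) by (intro slice_dderiv smooth_on_differentiable[OF Suc.prems(1)]) auto
  have "scale_Ck k w (\<lambda>p. dderiv (\<lambda>z. H (z, \<pi> p)) v)" for v
  proof (subst scale_Ck_cong[OF dderiv_eq[OF d] refl])
    show "scale_Ck k w (\<lambda>p z. dderiv H (v, 0) (z, \<pi> p))"
      by (rule Suc.IH[OF smooth_on_dderiv[OF Suc.prems(1)] Z(2)[OF Suc.prems]])
  qed
  then show ?case using d Z(1)[OF Suc.prems] by (auto simp: differentiable_def)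
qed

lemma (in family) scale_Ck_joint_bounded:
  fixes H :: "'a \<times> 'q::euclidean_space \<Rightarrow> 'b::real_normed_vector"
  assumes "open \<Omega>" "\<And>p. p \<in> P \<Longrightarrow> S p = {z. (z, \<pi> p) \<in> \<Omega>}" and C: "compact C" "C \<subseteq> \<Omega>"
    and K: "\<And>p z. p \<in> P \<Longrightarrow> z \<in> K p \<Longrightarrow> (z, \<pi> p) \<in> C" and H: "smooth_on \<Omega> H"
  shows "scale_Ck k (\<lambda>_. 1) (\<lambda>p z. H (z, \<pi> p))"
proof (rule scale_Ck_joint[OF assms(1,2), where Z = "\<lambda>_. True"])
  fix H :: "'a \<times> 'q \<Rightarrow> 'b" assume "smooth_on \<Omega> H"
  then have "bounded (H ` C)"
    by (intro compact_imp_bounded compact_continuous_image C continuous_on_subset[OF smooth_on_continuous]) (use C in auto)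
  then obtain M where "\<And>x. x \<in> C \<Longrightarrow> norm (H x) \<le> M" unfolding bounded_iff by auto
  then show "scale_bounded (\<lambda>_. 1) (\<lambda>p z. H (z, \<pi> p))" unfolding scale_bounded_def using K by (intro exI[of _ M]) auto
qed (use H in auto)

text \<open>Near a point with \<open>u = 0\<close>, the value is compared with the one where
  \<open>u\<close> is replaced by 0, through a local Lipschitz bound; elsewhere
  \<open>norm u\<close> is locally bounded below. Working locally keeps the comparison point inside
  \<open>\<Omega>\<close>.\<close>

lemma vanishing_bound:
  fixes H :: "'a::euclidean_space \<times> 'u::euclidean_space \<times> 'e::euclidean_space \<Rightarrow> 'b::real_normed_vector"
  assumes \<Omega>: "open \<Omega>" and C: "compact C" "C \<subseteq> \<Omega>" and H: "smooth_on \<Omega> H"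
    and 0: "\<And>z e. (z, 0, e) \<in> \<Omega> \<Longrightarrow> H (z, 0, e) = 0"
  obtains B where "\<And>z u e. (z, u, e) \<in> C \<Longrightarrow> norm (H (z, u, e)) \<le> B * norm u"
proof -
  have loc: "\<exists>U B. open U \<and> x \<in> U \<and> (\<forall>y\<in>U \<inter> C. norm (H y) \<le> B * norm (fst (snd y)))" if x: "x \<in> C" for x
  proof (cases "fst (snd x) = 0")
    case False
    have "continuous_on \<Omega> (\<lambda>y. norm (H y))" using smooth_on_continuous[OF H] by (intro continuous_intros)
    then have o1: "open (\<Omega> \<inter> (\<lambda>y. norm (H y)) -` {..<norm (H x) + 1})"
      using \<Omega> by (intro continuous_open_preimage) auto
    have "open {y :: 'a \<times> 'u \<times> 'e. norm (fst (snd x)) / 2 < norm (fst (snd y))}"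
      by (intro open_Collect_less continuous_intros)
    with o1 have oU: "open ((\<Omega> \<inter> (\<lambda>y. norm (H y)) -` {..<norm (H x) + 1}) \<inter> {y. norm (fst (snd x)) / 2 < norm (fst (snd y))})"
      by (rule open_Int)
    have bd: "norm (H y) \<le> (norm (H x) + 1) / (norm (fst (snd x)) / 2) * norm (fst (snd y))"
      if "y \<in> (\<Omega> \<inter> (\<lambda>y. norm (H y)) -` {..<norm (H x) + 1}) \<inter> {y. norm (fst (snd x)) / 2 < norm (fst (snd y))}" for y
    proof -
      have "norm (H y) \<le> (norm (H x) + 1) / (norm (fst (snd x)) / 2) * (norm (fst (snd x)) / 2)" using that False by simp
      also have "\<dots> \<le> (norm (H x) + 1) / (norm (fst (snd x)) / 2) * norm (fst (snd y))"
        using that by (intro mult_left_mono) auto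
      finally show ?thesis .
    qed
    have "x \<in> (\<Omega> \<inter> (\<lambda>y. norm (H y)) -` {..<norm (H x) + 1}) \<inter> {y. norm (fst (snd x)) / 2 < norm (fst (snd y))}"
      using x C False by auto
    with oU bd show ?thesis by blast
  next
    case True
    obtain e L where e: "e > 0" "ball x e \<subseteq> \<Omega>" "L \<ge> 0"
      "\<And>y z. y \<in> ball x e \<Longrightarrow> z \<in> ball x e \<Longrightarrow> norm (H y - H z) \<le> L * norm (y - z)"
      using smooth_on_locally_Lipschitz[OF \<Omega> H, of x] x C by blast
    have "norm (H y) \<le> L * norm (fst (snd y))" if y: "y \<in> ball x e" for y
    proof -
      \<comment> \<open>As \<open>x\<close> itself has \<open>u = 0\<close>, this projection does
        not increase the distance to \<open>x\<close> and stays in the ball.\<close>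
      define y' where "y' = (fst y, 0 :: 'u, snd (snd y))"
      have "norm (x - y') \<le> norm (x - y)"
        using True unfolding y'_def norm_prod_def by (simp add: fst_diff snd_diff)
      then have y': "y' \<in> ball x e" using y by (simp add: dist_norm)
      have "H y' = 0" unfolding y'_def by (rule 0) (use y' e(2) in \<open>auto simp: y'_def\<close>)
      then have "norm (H y) \<le> L * norm (y - y')" using e(4)[OF y y'] by simp
      also have "norm (y - y') = norm (fst (snd y))" by (simp add: y'_def norm_prod_def)
      finally show ?thesis .
    qed
    then show ?thesis using e(1) by (intro exI[of _ "ball x e"] exI[of _ L]) auto
  qed
  obtain B where "\<And>x. x \<in> C \<Longrightarrow> norm (H x) \<le> B * norm (fst (snd x))"
    by (rule compact_local_bound[OF C(1) _ loc]) auto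
  then show ?thesis by (intro that[of B]) force
qed

text \<open>Vanishing on \<open>u = 0\<close> is inherited by \<open>z\<close>-derivatives, which
  are taken along that set. Hence all derivatives are O(\<open>norm u\<close>), which supplies the
  scale of the diagonal phase.\<close>

lemma (in family) scale_Ck_joint_vanishing:
  fixes H :: "'a \<times> 'u::euclidean_space \<times> 'e::euclidean_space \<Rightarrow> 'b::real_normed_vector"
  assumes \<Omega>: "open \<Omega>" "\<And>p. p \<in> P \<Longrightarrow> S p = {z. (z, \<pi> p) \<in> \<Omega>}" and C: "compact C" "C \<subseteq> \<Omega>"
    and K: "\<And>p z. p \<in> P \<Longrightarrow> z \<in> K p \<Longrightarrow> (z, \<pi> p) \<in> C" and H: "smooth_on \<Omega> H"
    and 0: "\<And>z e. (z, 0, e) \<in> \<Omega> \<Longrightarrow> H (z, 0, e) = 0"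
  shows "scale_Ck k (\<lambda>p. norm (fst (\<pi> p))) (\<lambda>p z. H (z, \<pi> p))"
proof (rule scale_Ck_joint[OF \<Omega>, where Z = "\<lambda>H. \<forall>z e. (z, 0, e) \<in> \<Omega> \<longrightarrow> H (z, 0, e) = 0"])
  fix H :: "'a \<times> 'u \<times> 'e \<Rightarrow> 'b" assume H: "smooth_on \<Omega> H" and 0: "\<forall>z e. (z, 0, e) \<in> \<Omega> \<longrightarrow> H (z, 0, e) = 0"
  obtain B where "\<And>z u e. (z, u, e) \<in> C \<Longrightarrow> norm (H (z, u, e)) \<le> B * norm u"
    using vanishing_bound[OF \<Omega>(1) C H] 0 by blast
  then show "scale_bounded (\<lambda>p. norm (fst (\<pi> p))) (\<lambda>p z. H (z, \<pi> p))"
    unfolding scale_bounded_def using K by (intro exI[of _ B]) (metis prod.collapse)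
  show "\<forall>z e. (z, 0, e) \<in> \<Omega> \<longrightarrow> dderiv H (v, 0) (z, 0, e) = 0" for v
  proof (intro allI impI)
    fix z e assume z: "(z, 0, e) \<in> \<Omega>"
    define U where "U = (\<lambda>z. (z, 0 :: 'u, e)) -` \<Omega>"
    have U: "open U" unfolding U_def by (rule open_vimage[OF \<Omega>(1)]) (intro continuous_intros)
    have "((\<lambda>z. H (z, 0, e)) has_derivative (\<lambda>v. dderiv H (v, 0) (z, 0, e))) (at z)"
      using slice_dderiv[OF smooth_on_differentiable[OF H z]] .
    then have "dderiv H (v, 0) (z, 0, e) = dderiv (\<lambda>z. H (z, 0, e)) v z" by (rule dderiv_eq[symmetric])
    also have "\<dots> = dderiv (\<lambda>z. 0) v z"
      using frechet_derivative_cong_open[OF U, of z "\<lambda>z. H (z, 0, e)" "\<lambda>z. 0"] 0 z by (simp add: U_def)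
    finally show "dderiv H (v, 0) (z, 0, e) = 0" by (simp add: frechet_derivative_const)
  qed
qed (use H 0 in auto)

text \<open>Compactness is asked of \<open>C\<close>, not of \<open>P\<close>. In the diagonal case
  \<open>P\<close> excludes \<open>u = 0\<close>, where the scale \<open>w\<close> degenerates,
  while the bounds for the derivatives come from a compact set that includes it.\<close>

lemma uniform_nonstationary_phase:
  fixes \<Omega> C :: "('a::euclidean_space \<times> 'q::euclidean_space) set" and H :: "'a \<times> 'q \<Rightarrow> real" and G :: "'a \<times> 'q \<Rightarrow> complex"
    and P :: "'q set" and w :: "'q \<Rightarrow> real"
  assumes \<Omega>: "open \<Omega>" and C: "compact C" "C \<subseteq> \<Omega>" and H: "smooth_on \<Omega> H" and G: "smooth_on \<Omega> G"
    and G0: "\<And>p z. p \<in> P \<Longrightarrow> (z, p) \<notin> C \<Longrightarrow> G (z, p) = 0"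
    and scale_Ck: "\<And>k. family P (\<lambda>p. {z. (z, p) \<in> \<Omega>}) (\<lambda>p. {z. (z, p) \<in> C}) \<Longrightarrow>
        family.scale_Ck P (\<lambda>p. {z. (z, p) \<in> \<Omega>}) (\<lambda>p. {z. (z, p) \<in> C}) k w (\<lambda>p z. H (z, p))"
    and w: "\<And>p. p \<in> P \<Longrightarrow> w p > 0" and c: "c > 0"
    and lower: "\<And>p z. p \<in> P \<Longrightarrow> (z, p) \<in> C \<Longrightarrow> c * (w p)\<^sup>2 \<le> (\<Sum>e\<in>Basis. (dderiv (\<lambda>z. H (z, p)) e z)\<^sup>2)"
  obtains B where "B > 0" "\<And>p l. p \<in> P \<Longrightarrow> l > 0 \<Longrightarrow>
    norm (LINT z|lborel. G (z, p) * cis (l * H (z, p))) \<le> B / (l * w p) ^ N"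
proof -
  let ?S = "\<lambda>p. {z. (z, p) \<in> \<Omega>}" and ?K = "\<lambda>p. {z. (z, p) \<in> C}"
  have K: "compact (?K p)" "?K p \<subseteq> fst ` C" for p
  proof -
    have cl: "closed ((\<lambda>z. (z, p)) -` C)"
      by (rule closed_vimage[OF compact_imp_closed[OF C(1)]]) (intro continuous_intros)
    show sub: "?K p \<subseteq> fst ` C" by force
    have "compact (fst ` C)" by (rule compact_continuous_image[OF continuous_on_fst[OF continuous_on_id] C(1)])
    from compact_Int_closed[OF this cl] show "compact (?K p)"
      using sub by (simp add: vimage_def Int_absorb1)
  qed
  interpret family P ?S ?K
  proof
    fix p assume "p \<in> P"
    show "open (?S p)" using open_vimage[OF \<Omega>, of "\<lambda>z. (z, p)"] by (simp add: vimage_def continuous_on_Pair)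
    show "?K p \<subseteq> ?S p" using C by auto
    show "compact (?K p)" by (rule K)
  qed
  have fam: "family P ?S ?K" by unfold_locales
  have FG: "scale_Ck k (\<lambda>_. 1) (\<lambda>p z. G (z, p))" for k
    by (rule scale_Ck_joint_bounded[where \<pi> = "\<lambda>p. p", OF \<Omega> _ C _ G]) auto
  interpret phase P ?S ?K "\<lambda>p z. H (z, p)" "\<lambda>p z. G (z, p)" w c "measure lborel (fst ` C)"
  proof
    show "scale_Ck k w (\<lambda>p. dderiv (\<lambda>z. H (z, p)) b)" if "b \<in> Basis" for k b
      by (rule scale_Ck_dderiv[OF scale_Ck[OF fam] that])
    show "scale_Ck k (\<lambda>_. 1) (\<lambda>p z. G (z, p))" for k by (rule FG)
    show "c > 0" by (rule c)
  next
    fix p z assume p: "p \<in> P"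
    show "(\<lambda>z. H (z, p)) differentiable (at z)" if "z \<in> ?S p"
      by (rule scale_Ck_differentiable[OF scale_Ck[OF fam] p that])
    show "G (z, p) = 0" if "z \<notin> ?K p" using G0[OF p] that by simp
    show "w p > 0" by (rule w[OF p])
    show "c * (w p)\<^sup>2 \<le> (\<Sum>e\<in>Basis. (dderiv (\<lambda>z. H (z, p)) e z)\<^sup>2)" if "z \<in> ?K p"
      using lower[OF p] that by simp
    have cC: "compact (fst ` C)" by (rule compact_continuous_image[OF continuous_on_fst[OF continuous_on_id] C(1)])
    show "measure lborel (?K p) \<le> measure lborel (fst ` C)"
      by (rule measure_mono_fmeasurable[OF K(2)])
        (use K(1) cC in \<open>auto intro!: fmeasurableI borel_closed compact_imp_closed emeasure_compact_finite\<close>)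
  qed
  show ?thesis using nonstationary_phase[of N] that by blast
qed

lemma compact_positive_lower_bound:
  fixes f :: "'a::topological_space \<Rightarrow> real"
  assumes "compact C" "continuous_on C f" "\<And>x. x \<in> C \<Longrightarrow> f x > 0"
  obtains c where "c > 0" "\<And>x. x \<in> C \<Longrightarrow> c \<le> f x"
proof (cases "C = {}")
  case True
  then show ?thesis by (intro that[of 1]) auto
next
  case False
  obtain x where "x \<in> C" "\<And>y. y \<in> C \<Longrightarrow> f x \<le> f y"
    using continuous_attains_inf[OF assms(1) False assms(2)] by blast
  then show ?thesis using assms(3) by (intro that[of "f x"]) auto
qed

text \<open>The automorphic dilations of the group. The value \<open>\<mu> = 0\<close> is allowed,
  so that the limit of widely separated scales is itself a member of the family.\<close>

definition del :: "real \<Rightarrow> 'n::finite heis \<Rightarrow> 'n heis" where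
  "del \<mu> z = (\<mu> *\<^sub>R fst z, \<mu>\<^sup>2 * snd z)"

lemma del_0 [simp]: "del 0 z = 0"
  by (simp add: del_def zero_prod_def)

lemma del_1 [simp]: "del 1 z = z"
  by (simp add: del_def)

lemma del_del: "del \<mu> (del \<nu> z) = del (\<mu> * \<nu>) z"
  by (simp add: del_def power_mult_distrib)

lemma sympl_J_scaleR: "sympl_J (r *\<^sub>R x) = r *\<^sub>R sympl_J x"
  by (simp add: sympl_J_def)

lemma heis_mult_del: "heis_mult a (del \<mu> u) (del \<mu> z) = del \<mu> (heis_mult a u z)"
  by (simp add: del_def heis_mult_def sympl_J_scaleR scaleR_right_distrib algebra_simps power2_eq_square)

lemma sq_rho_del: "\<mu> \<ge> 0 \<Longrightarrow> sq_rho b (del \<mu> z) = \<mu>\<^sup>2 * sq_rho b z"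
proof -
  have x: "sq_x b (del \<mu> z) = \<mu>\<^sup>2 * sq_x b z" by (simp add: sq_x_def del_def power2_eq_square)
  have "(\<mu>\<^sup>2 * sq_x b z)\<^sup>2 + 4 * b\<^sup>2 * (\<mu>\<^sup>2 * snd z)\<^sup>2 = (\<mu>\<^sup>2)\<^sup>2 * ((sq_x b z)\<^sup>2 + 4 * b\<^sup>2 * (snd z)\<^sup>2)"
    by (simp add: power2_eq_square algebra_simps)
  then have "sqrt ((\<mu>\<^sup>2 * sq_x b z)\<^sup>2 + 4 * b\<^sup>2 * (\<mu>\<^sup>2 * snd z)\<^sup>2) = \<mu>\<^sup>2 * sqrt ((sq_x b z)\<^sup>2 + 4 * b\<^sup>2 * (snd z)\<^sup>2)"
    by (simp only: real_sqrt_mult real_sqrt_abs abs_power2)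
  moreover have "snd (del \<mu> z) = \<mu>\<^sup>2 * snd z" by (simp add: del_def)
  ultimately show ?thesis by (simp only: sq_rho_def x powr_half_sqrt add_nonneg_nonneg zero_le_power2
        mult_nonneg_nonneg zero_le_numeral distrib_left times_divide_eq_right)
qed

lemma sq_rho_inv [simp]: "sq_rho b (heis_inv z) = sq_rho b z"
  by (simp add: sq_rho_def sq_x_def heis_inv_def)

lemma continuous_on_del [continuous_intros]:
  "continuous_on S f \<Longrightarrow> continuous_on S g \<Longrightarrow> continuous_on S (\<lambda>x. del (f x) (g x))"
  unfolding del_def by (intro continuous_intros)

lemma smooth_on_del:
  "open S \<Longrightarrow> smooth_on S f \<Longrightarrow> smooth_on S g \<Longrightarrow> smooth_on S (\<lambda>x. del (f x) (g x))"
  unfolding del_def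
  by (intro smooth_on_Pair smooth_on_scaleR smooth_on_mult smooth_on_power smooth_on_fst smooth_on_snd)

section \<open>The rescaled amplitude and its oscillatory integrals\<close>

locale amplitude =
  fixes a b \<beta> \<gamma> :: real and \<psi> \<theta> :: "real \<Rightarrow> complex" and n :: "'n::finite itself"
  assumes b: "b \<noteq> 0" and ab: "a\<^sup>2 / b\<^sup>2 \<le> 1" and \<beta>: "\<beta> > 0"
    and \<psi>: "smooth_on UNIV \<psi>" and \<theta>: "smooth_on UNIV \<theta>"
    and \<theta>_support: "\<theta> r \<noteq> 0 \<Longrightarrow> 1/2 \<le> r \<and> r \<le> 2"
begin

text \<open>The non-oscillating factor of a dyadic piece, moved to the annulus. As
  \<open>sq_rho\<close> is the square of the gauge, \<open>\<gamma>\<close> is half the exponent of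
  the gauge. \<open>\<epsilon>\<close> stands for \<open>2 powr (- j)\<close>; as a parameter in a
  compact interval it makes the estimates uniform in \<open>j\<close>.\<close>

definition amp :: "real \<Rightarrow> 'n heis \<Rightarrow> complex" where
  "amp \<epsilon> z = of_real (sq_rho b z powr \<gamma>) * \<theta> (sq_rho b z powr (1/2)) * \<psi> (\<epsilon> * sq_rho b z powr (1/2))"

definition D :: "'n heis set" where
  "D = {z. 1/4 \<le> sq_rho b z \<and> sq_rho b z \<le> 4}"

lemma D_nonzero: "D \<subseteq> - {0}"
  by (auto simp: D_def sq_rho_zero[OF b])

lemma amp_eq_0: "z \<notin> D \<Longrightarrow> amp \<epsilon> z = 0"
proof (rule ccontr)
  assume z: "z \<notin> D" and "amp \<epsilon> z \<noteq> 0"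
  then have "\<theta> (sq_rho b z powr (1/2)) \<noteq> 0" by (auto simp: amp_def)
  note r0 = \<theta>_support[OF this]
  have s0: "sq_rho b z \<ge> 0" using sq_rho_pos[OF b, of z] by (cases "z = 0") (auto simp: sq_rho_zero[OF b])
  then have r: "1/2 \<le> sqrt (sq_rho b z)" "sqrt (sq_rho b z) \<le> 2"
    using r0 by (simp_all add: powr_half_sqrt)
  have "sq_rho b z = (sqrt (sq_rho b z))\<^sup>2" using s0 by simp
  moreover have "(1/2)\<^sup>2 \<le> (sqrt (sq_rho b z))\<^sup>2" using r by (intro power_mono) auto
  moreover have "(sqrt (sq_rho b z))\<^sup>2 \<le> 2\<^sup>2" using r s0 by (intro power_mono) auto
  ultimately have "z \<in> D" by (simp add: D_def power2_eq_square)
  with z show False by simp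
qed

lemma compact_D: "compact D"
proof -
  have "closed D" unfolding D_def
    by (intro closed_Collect_conj closed_Collect_le continuous_intros continuous_on_sq_rho[OF b])
  moreover have "bounded D"
  proof (rule boundedI)
    fix z assume z: "z \<in> D"
    let ?s = "sq_rho b z"
    have s: "0 < ?s" "?s \<le> 4" using z by (auto simp: D_def)
    have e: "?s * (?s - sq_x b z) = b\<^sup>2 * (snd z)\<^sup>2" using sq_rho_eq[OF b, of z] by (simp add: algebra_simps power2_eq_square)
    then have "?s * (?s - sq_x b z) \<ge> 0" by simp
    then have d: "?s - sq_x b z \<ge> 0" using s by (simp add: zero_le_mult_iff)
    then have x: "sq_x b z \<le> 4" using s by simp
    have "?s * (?s - sq_x b z) \<le> 4 * 4" using s d sq_x_nonneg[OF b, of z] by (intro mult_mono) auto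
    then have "(\<bar>b\<bar> * \<bar>snd z\<bar>)\<^sup>2 \<le> 4\<^sup>2" unfolding e by (simp add: power_mult_distrib)
    then have t: "\<bar>b\<bar> * \<bar>snd z\<bar> \<le> 4" by (rule power2_le_imp_le) simp
    have "(\<bar>b\<bar> * norm (fst z))\<^sup>2 \<le> 2\<^sup>2" using x by (simp add: sq_x_def power_mult_distrib power2_norm_eq_inner)
    then have "\<bar>b\<bar> * norm (fst z) \<le> 2" by (rule power2_le_imp_le) simp
    with t have "\<bar>b\<bar> * (norm (fst z) + \<bar>snd z\<bar>) \<le> 6" by (simp add: distrib_left)
    then have "norm (fst z) + \<bar>snd z\<bar> \<le> 6 / \<bar>b\<bar>" using b by (simp add: field_simps)
    moreover have "norm z \<le> norm (fst z) + \<bar>snd z\<bar>" using norm_Pair_le[of "fst z" "snd z"] by simp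
    ultimately show "norm z \<le> 6 / \<bar>b\<bar>" by linarith
  qed
  ultimately show ?thesis by (simp add: compact_eq_bounded_closed)
qed

lemma smooth_on_amp:
  assumes S: "open S" and e: "smooth_on S e" and f: "smooth_on S f" "\<And>x. x \<in> S \<Longrightarrow> f x \<noteq> 0"
  shows "smooth_on S (\<lambda>x. amp (e x) (f x))"
proof -
  have s: "smooth_on S (\<lambda>x. sq_rho b (f x))"
    by (rule smooth_on_compose[OF S open_nonzero smooth_on_sq_rho[OF b] f(1)]) (use f(2) in auto)
  have p: "smooth_on S (\<lambda>x. sq_rho b (f x) powr k)" for k
    by (rule smooth_on_powr[OF S s]) (rule sq_rho_pos[OF b f(2)])
  have t: "smooth_on S (\<lambda>x. \<theta> (sq_rho b (f x) powr (1/2)))"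
    by (rule smooth_on_compose[OF S open_UNIV \<theta> p]) auto
  have q: "smooth_on S (\<lambda>x. \<psi> (e x * sq_rho b (f x) powr (1/2)))"
    by (rule smooth_on_compose[OF S open_UNIV \<psi> smooth_on_mult[OF S e p]]) auto
  show ?thesis unfolding amp_def
    by (rule smooth_on_mult[OF S smooth_on_mult[OF S smooth_on_of_real[OF S p] t] q])
qed

lemma smooth_on_Phi_comp:
  assumes "open S" "smooth_on S f" "\<And>x. x \<in> S \<Longrightarrow> f x \<noteq> 0"
  shows "smooth_on S (\<lambda>x. Phi b \<beta> (f x))"
  by (rule smooth_on_compose[OF assms(1) open_nonzero smooth_on_Phi[OF b ab \<beta>] assms(2)]) (use assms(3) in auto)

text \<open>The scale of this family is \<open>norm u\<close>: from below by
  \<open>phase_difference_grad\<close>, from above because the phase vanishes at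
  \<open>u = 0\<close>. For compactness \<open>C\<close> contains parameters with
  \<open>u = 0\<close>, while \<open>P\<close> does not.\<close>

lemma diagonal_estimate:
  obtains B where "B > 0" "\<And>u \<epsilon> l. u \<noteq> 0 \<Longrightarrow> 0 \<le> \<epsilon> \<Longrightarrow> \<epsilon> \<le> 1 \<Longrightarrow> l > 0 \<Longrightarrow>
    norm (LINT z|lborel. cnj (amp \<epsilon> z) * amp \<epsilon> (heis_mult a u z) * cis (l * (Phi b \<beta> (heis_mult a u z) - Phi b \<beta> z)))
      \<le> B / (l * norm u) ^ N"
proof -
  define \<Omega> where "\<Omega> = {x :: 'n heis \<times> 'n heis \<times> real. fst x \<noteq> 0 \<and> heis_mult a (fst (snd x)) (fst x) \<noteq> 0}"
  define C where "C = {x :: 'n heis \<times> 'n heis \<times> real. fst x \<in> D \<and> heis_mult a (fst (snd x)) (fst x) \<in> D \<and> snd (snd x) \<in> {0..1}}"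
  define P where "P = {p :: 'n heis \<times> real. fst p \<noteq> 0 \<and> snd p \<in> {0..1}}"
  define H where "H x = Phi b \<beta> (heis_mult a (fst (snd x)) (fst x)) - Phi b \<beta> (fst x)" for x :: "'n heis \<times> 'n heis \<times> real"
  define G where "G x = cnj (amp (snd (snd x)) (fst x)) * amp (snd (snd x)) (heis_mult a (fst (snd x)) (fst x))"
    for x :: "'n heis \<times> 'n heis \<times> real"
  have \<Omega>: "open \<Omega>" unfolding \<Omega>_def
    by (intro open_Collect_conj open_Collect_neq continuous_intros)
  \<comment> \<open>\<open>u\<close> is recovered from \<open>z\<close> and its translate, so
    \<open>C\<close> is a continuous image of a compact product.\<close>
  have "C = (\<lambda>x. (fst x, heis_mult a (fst (snd x)) (heis_inv (fst x)), snd (snd x))) ` (D \<times> D \<times> {0..1})"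
  proof (intro set_eqI iffI)
    fix x assume x: "x \<in> C"
    show "x \<in> (\<lambda>x. (fst x, heis_mult a (fst (snd x)) (heis_inv (fst x)), snd (snd x))) ` (D \<times> D \<times> {0..1})"
      by (rule image_eqI[where x = "(fst x, heis_mult a (fst (snd x)) (fst x), snd (snd x))"])
        (use x in \<open>auto simp: C_def\<close>)
  qed (auto simp: C_def)
  then have C: "compact C"
    by (simp only:) (intro compact_continuous_image continuous_intros compact_Times compact_D compact_Icc)
  have C\<Omega>: "C \<subseteq> \<Omega>" using D_nonzero by (auto simp: C_def \<Omega>_def)
  have z: "smooth_on \<Omega> fst" "smooth_on \<Omega> (\<lambda>x. snd (snd x))" "smooth_on \<Omega> (\<lambda>x. heis_mult a (fst (snd x)) (fst x))"
    by (intro smooth_on_fst smooth_on_snd smooth_on_heis_mult smooth_on_id \<Omega>)+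
  have H: "smooth_on \<Omega> H" unfolding H_def[abs_def]
    by (intro smooth_on_diff smooth_on_Phi_comp z \<Omega>) (auto simp: \<Omega>_def)
  have G: "smooth_on \<Omega> G" unfolding G_def[abs_def]
    by (intro smooth_on_mult smooth_on_cnj smooth_on_amp z \<Omega>) (auto simp: \<Omega>_def)
  obtain c where c: "c > 0" "\<And>u z. z \<in> D \<Longrightarrow> heis_mult a u z \<in> D \<Longrightarrow>
    c * (norm u)\<^sup>2 \<le> (\<Sum>e\<in>Basis. (dderiv (\<lambda>z. Phi b \<beta> (heis_mult a u z) - Phi b \<beta> z) e z)\<^sup>2)"
    using phase_difference_grad[OF b ab \<beta> compact_D D_nonzero] by blast
  have "\<exists>B>0. \<forall>p\<in>P. \<forall>l>0. norm (LINT z|lborel. G (z, p) * cis (l * H (z, p))) \<le> B / (l * norm (fst p)) ^ N"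
  proof (rule uniform_nonstationary_phase[OF \<Omega> C C\<Omega> H G, of P "\<lambda>p. norm (fst p)" c N])
    show "G (z, p) = 0" if "p \<in> P" "(z, p) \<notin> C" for p z
      using that by (auto simp: P_def C_def G_def amp_eq_0)
    show "c * (norm (fst p))\<^sup>2 \<le> (\<Sum>e\<in>Basis. (dderiv (\<lambda>z. H (z, p)) e z)\<^sup>2)" if "p \<in> P" "(z, p) \<in> C" for p z
      using that c(2)[of z "fst p"] by (simp add: H_def C_def)
    show "family.scale_Ck P (\<lambda>p. {z. (z, p) \<in> \<Omega>}) (\<lambda>p. {z. (z, p) \<in> C}) k (\<lambda>p. norm (fst p)) (\<lambda>p z. H (z, p))"
      if "family P (\<lambda>p. {z. (z, p) \<in> \<Omega>}) (\<lambda>p. {z. (z, p) \<in> C})" for k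
      by (rule family.scale_Ck_joint_vanishing[OF that \<Omega>, where \<pi> = "\<lambda>p. p", OF _ C C\<Omega> _ H])
        (auto simp: H_def)
  qed (use c in \<open>auto simp: P_def\<close>)
  then obtain B where "B > 0" "\<And>p l. p \<in> P \<Longrightarrow> l > 0 \<Longrightarrow>
    norm (LINT z|lborel. G (z, p) * cis (l * H (z, p))) \<le> B / (l * norm (fst p)) ^ N" by blast
  then show ?thesis by (intro that[of B]) (fastforce simp: P_def G_def H_def)+
qed

text \<open>At \<open>\<mu> = 0\<close> the phase is
  \<open>\<kappa> * Phi b \<beta> u - Phi b \<beta> z\<close>, whose gradient in \<open>z\<close>
  never vanishes, and compactness preserves this for small \<open>\<mu>\<close>. The factor
  \<open>\<kappa>\<close> stands for \<open>\<mu> powr \<beta>\<close>, but is an independent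
  parameter because that power need not be smooth at \<open>\<mu> = 0\<close>.\<close>

lemma off_diagonal_estimate:
  obtains B \<mu>0 R where "B > 0" "\<mu>0 > 0" "R > 0" "\<And>u \<mu> \<kappa> e1 e2 l. 0 \<le> \<mu> \<Longrightarrow> \<mu> \<le> \<mu>0 \<Longrightarrow> \<mu> \<le> 1 \<Longrightarrow>
    0 \<le> \<kappa> \<Longrightarrow> \<kappa> \<le> 1 \<Longrightarrow> 0 \<le> e1 \<Longrightarrow> e1 \<le> 1 \<Longrightarrow> 0 \<le> e2 \<Longrightarrow> e2 \<le> 1 \<Longrightarrow> l > 0 \<Longrightarrow>
    norm (LINT z|lborel. cnj (amp e1 z) * amp e2 (heis_mult a u (del \<mu> z))
        * cis (l * (\<kappa> * Phi b \<beta> (heis_mult a u (del \<mu> z)) - Phi b \<beta> z))) \<le> B / l ^ N"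
    "\<And>u \<mu> z. 0 \<le> \<mu> \<Longrightarrow> \<mu> \<le> 1 \<Longrightarrow> z \<in> D \<Longrightarrow> heis_mult a u (del \<mu> z) \<in> D \<Longrightarrow> norm u \<le> R"
proof -
  define pu p\<mu> p\<kappa> p1 p2 where "pu = (fst \<circ> snd :: 'n heis \<times> 'n heis \<times> real \<times> real \<times> real \<times> real \<Rightarrow> _)"
    and "p\<mu> = (fst \<circ> snd \<circ> snd :: 'n heis \<times> 'n heis \<times> real \<times> real \<times> real \<times> real \<Rightarrow> _)"
    and "p\<kappa> = (fst \<circ> snd \<circ> snd \<circ> snd :: 'n heis \<times> 'n heis \<times> real \<times> real \<times> real \<times> real \<Rightarrow> _)"
    and "p1 = (fst \<circ> snd \<circ> snd \<circ> snd \<circ> snd :: 'n heis \<times> 'n heis \<times> real \<times> real \<times> real \<times> real \<Rightarrow> _)"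
    and "p2 = (snd \<circ> snd \<circ> snd \<circ> snd \<circ> snd :: 'n heis \<times> 'n heis \<times> real \<times> real \<times> real \<times> real \<Rightarrow> _)"
  note pd = pu_def p\<mu>_def p\<kappa>_def p1_def p2_def
  define m where "m x = heis_mult a (pu x) (del (p\<mu> x) (fst x))" for x
  define \<Omega> where "\<Omega> = {x. fst x \<noteq> 0 \<and> m x \<noteq> 0}"
  define C where "C = {x. fst x \<in> D \<and> m x \<in> D \<and> p\<mu> x \<in> {0..1} \<and> p\<kappa> x \<in> {0..1} \<and> p1 x \<in> {0..1} \<and> p2 x \<in> {0..1}}"
  define H where "H x = p\<kappa> x * Phi b \<beta> (m x) - Phi b \<beta> (fst x)" for x
  define G where "G x = cnj (amp (p1 x) (fst x)) * amp (p2 x) (m x)" for x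
  have cont: "continuous_on S pu" "continuous_on S p\<mu>" "continuous_on S p\<kappa>" "continuous_on S p1" "continuous_on S p2" for S
    unfolding pd comp_def by (intro continuous_intros)+
  have cm: "continuous_on S m" for S
    unfolding m_def[abs_def] by (intro continuous_intros cont)
  have \<Omega>: "open \<Omega>" unfolding \<Omega>_def
    by (intro open_Collect_conj open_Collect_neq cm continuous_intros)
  define im where "im x = (fst x, heis_mult a (pu x) (heis_inv (del (p\<mu> x) (fst x))), snd (snd x))" for x
  have "C = im ` (D \<times> D \<times> {0..1} \<times> {0..1} \<times> {0..1} \<times> {0..1})"
  proof (intro set_eqI iffI)
    fix x assume x: "x \<in> C"
    show "x \<in> im ` (D \<times> D \<times> {0..1} \<times> {0..1} \<times> {0..1} \<times> {0..1})"
      by (rule image_eqI[where x = "(fst x, m x, snd (snd x))"])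
        (use x in \<open>auto simp: C_def im_def m_def pd mem_Times_iff\<close>)
  qed (auto simp: C_def im_def m_def pd)
  moreover have "continuous_on S im" for S unfolding im_def[abs_def] by (intro continuous_intros cont)
  ultimately have C: "compact C"
    by (simp only:) (intro compact_continuous_image compact_Times compact_D compact_Icc)
  have C\<Omega>: "C \<subseteq> \<Omega>" using D_nonzero by (auto simp: C_def \<Omega>_def)
  have sm: "smooth_on \<Omega> fst" "smooth_on \<Omega> pu" "smooth_on \<Omega> p\<mu>" "smooth_on \<Omega> p\<kappa>" "smooth_on \<Omega> p1" "smooth_on \<Omega> p2"
    unfolding pd comp_def by (intro smooth_on_fst smooth_on_snd smooth_on_id \<Omega>)+
  have smm: "smooth_on \<Omega> m" unfolding m_def[abs_def]
    by (intro smooth_on_heis_mult smooth_on_del sm \<Omega>)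
  have H: "smooth_on \<Omega> H" unfolding H_def[abs_def]
    by (intro smooth_on_diff smooth_on_mult smooth_on_Phi_comp sm smm \<Omega>) (auto simp: \<Omega>_def)
  have G: "smooth_on \<Omega> G" unfolding G_def[abs_def]
    by (intro smooth_on_mult smooth_on_cnj smooth_on_amp sm smm \<Omega>) (auto simp: \<Omega>_def)
  define W where "W x = (\<Sum>e\<in>Basis. (dderiv H (e, 0) x)\<^sup>2)" for x
  have slice: "dderiv (\<lambda>z. H (z, p)) e z = dderiv H (e, 0) (z, p)" if "(z, p) \<in> \<Omega>" for z p e
    by (rule dderiv_eq[OF slice_dderiv[OF smooth_on_differentiable[OF H that]]])
  \<comment> \<open>The sum is positive on all of \<open>C\<close> and so has a positive lower bound
    \<open>c\<close>; for \<open>\<mu> \<le> c / 2\<close> the squared gradient \<open>W\<close> is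
    then at least \<open>c / 2\<close>. This is the origin of the threshold.\<close>
  have "continuous_on C (\<lambda>x. W x + p\<mu> x)" unfolding W_def
    by (intro continuous_intros cont continuous_on_subset[OF smooth_on_continuous[OF smooth_on_dderiv[OF H]] C\<Omega>])
  moreover have "W x + p\<mu> x > 0" if x: "x \<in> C" for x
  proof (cases "p\<mu> x = 0")
    case False
    then have "p\<mu> x > 0" using x by (auto simp: C_def)
    then show ?thesis by (simp add: W_def add_nonneg_pos sum_nonneg)
  next
    case True
    obtain z p where xe: "x = (z, p)" by (cases x)
    have z0: "z \<noteq> 0" using x D_nonzero by (auto simp: C_def xe)
    have dP: "(Phi b \<beta> has_derivative (\<lambda>v. dderiv (Phi b \<beta>) v z)) (at z)"
      by (rule has_dderiv[OF Phi_differentiable[OF b ab \<beta> z0]])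
    have "H (y, p) = p\<kappa> x * Phi b \<beta> (pu x) - Phi b \<beta> y" for y
      using True by (simp add: H_def m_def xe pd)
    then have Heq: "(\<lambda>y. H (y, p)) = (\<lambda>y. p\<kappa> x * Phi b \<beta> (pu x) - Phi b \<beta> y)" by (rule ext)
    have "dderiv (\<lambda>y. H (y, p)) e z = 0 - dderiv (Phi b \<beta>) e z" for e
      unfolding Heq by (rule dderiv_eq[OF has_derivative_diff[OF has_derivative_const dP]])
    then have "W x = (\<Sum>e\<in>Basis. (dderiv (Phi b \<beta>) e z)\<^sup>2)"
      using x C\<Omega> unfolding W_def xe by (subst slice[symmetric]) auto
    then show ?thesis using Phi_grad_pos[OF b ab \<beta> z0] True by simp
  qed
  ultimately obtain c where c: "c > 0" "\<And>x. x \<in> C \<Longrightarrow> c \<le> W x + p\<mu> x"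
    using compact_positive_lower_bound[OF C, of "\<lambda>x. W x + p\<mu> x"] by blast
  define P where "P = {p :: 'n heis \<times> real \<times> real \<times> real \<times> real. fst (snd p) \<in> {0..1} \<and> fst (snd p) \<le> c / 2 \<and> fst (snd (snd p)) \<in> {0..1}
      \<and> fst (snd (snd (snd p))) \<in> {0..1} \<and> snd (snd (snd (snd p))) \<in> {0..(1::real)}}"
  have "\<exists>B>0. \<forall>p\<in>P. \<forall>l>0. norm (LINT z|lborel. G (z, p) * cis (l * H (z, p))) \<le> B / (l * 1) ^ N"
  proof (rule uniform_nonstationary_phase[OF \<Omega> C C\<Omega> H G, of P "\<lambda>p. 1" "c / 2" N])
    show "G (z, p) = 0" if "p \<in> P" "(z, p) \<notin> C" for p z
      using that by (auto simp: P_def C_def G_def pd amp_eq_0)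
    show "c / 2 * 1\<^sup>2 \<le> (\<Sum>e\<in>Basis. (dderiv (\<lambda>z. H (z, p)) e z)\<^sup>2)" if "p \<in> P" "(z, p) \<in> C" for p z
    proof -
      have "(\<Sum>e\<in>Basis. (dderiv (\<lambda>z. H (z, p)) e z)\<^sup>2) = W (z, p)"
        using slice[of z p] that C\<Omega> unfolding W_def by (intro sum.cong) auto
      then show ?thesis using that c(2)[of "(z, p)"] by (simp add: P_def pd)
    qed
    show "family.scale_Ck P (\<lambda>p. {z. (z, p) \<in> \<Omega>}) (\<lambda>p. {z. (z, p) \<in> C}) k (\<lambda>p. 1) (\<lambda>p z. H (z, p))"
      if "family P (\<lambda>p. {z. (z, p) \<in> \<Omega>}) (\<lambda>p. {z. (z, p) \<in> C})" for k
      by (rule family.scale_Ck_joint_bounded[OF that \<Omega>, where \<pi> = "\<lambda>p. p", OF _ C C\<Omega> _ H]) auto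
  qed (use c in auto)
  then obtain B where B: "B > 0" "\<And>p l. p \<in> P \<Longrightarrow> l > 0 \<Longrightarrow>
    norm (LINT z|lborel. G (z, p) * cis (l * H (z, p))) \<le> B / l ^ N" by auto
  obtain R where R: "R > 0" "\<And>x. x \<in> C \<Longrightarrow> norm x \<le> R"
    using compact_imp_bounded[OF C] unfolding bounded_pos by auto
  show ?thesis
  proof (rule that[of B "c / 2" R])
    fix u :: "'n heis" and \<mu> \<kappa> e1 e2 l :: real
    assume "0 \<le> \<mu>" "\<mu> \<le> c / 2" "\<mu> \<le> 1" "0 \<le> \<kappa>" "\<kappa> \<le> 1" "0 \<le> e1" "e1 \<le> 1" "0 \<le> e2" "e2 \<le> 1" "(l::real) > 0"
    then show "norm (LINT z|lborel. cnj (amp e1 z) * amp e2 (heis_mult a u (del \<mu> z))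
        * cis (l * (\<kappa> * Phi b \<beta> (heis_mult a u (del \<mu> z)) - Phi b \<beta> z))) \<le> B / l ^ N"
      using B(2)[of "(u, \<mu>, \<kappa>, e1, e2)" l] by (simp add: P_def G_def H_def m_def pd)
  next
    fix u z :: "'n heis" and \<mu> :: real assume "0 \<le> \<mu>" "\<mu> \<le> (1::real)" "z \<in> D" "heis_mult a u (del \<mu> z) \<in> D"
    then have "(z, u, \<mu>, 0, 0, 0) \<in> C" by (simp add: C_def m_def pd)
    then have "norm (z, u, \<mu>, 0 :: real, 0 :: real, 0 :: real) \<le> R" by (rule R)
    moreover have "norm u \<le> norm (z, u, \<mu>, 0 :: real, 0 :: real, 0 :: real)"
      by (rule order_trans[OF norm_fst_le norm_snd_le])
    ultimately show "norm u \<le> R" by simp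
  qed (use B c R in auto)
qed

text \<open>The counterpart with a fixed smooth function seen at scale \<open>\<epsilon>\<close> in
  place of the second piece. The phase is \<open>Phi\<close> alone, with nonvanishing gradient on
  the annulus. The estimate yields convergence of the truncated kernels on test functions.\<close>

lemma pointwise_estimate:
  fixes f :: "'n heis \<Rightarrow> complex"
  assumes f: "smooth_on UNIV f"
  obtains B where "B > 0" "\<And>\<epsilon> l. 0 \<le> \<epsilon> \<Longrightarrow> \<epsilon> \<le> 1 \<Longrightarrow> l > 0 \<Longrightarrow>
    norm (LINT z|lborel. amp \<epsilon> z * f (heis_mult a p (heis_inv (del \<epsilon> z))) * cis (l * Phi b \<beta> z)) \<le> B / l ^ N"
proof -
  define \<Omega> where "\<Omega> = {x :: 'n heis \<times> real. fst x \<noteq> 0}"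
  define C where "C = D \<times> {0..1::real}"
  define H where "H x = Phi b \<beta> (fst x)" for x :: "'n heis \<times> real"
  define G where "G x = amp (snd x) (fst x) * f (heis_mult a p (heis_inv (del (snd x) (fst x))))" for x :: "'n heis \<times> real"
  have \<Omega>: "open \<Omega>" unfolding \<Omega>_def by (intro open_Collect_neq continuous_intros)
  have C: "compact C" unfolding C_def by (intro compact_Times compact_D compact_Icc)
  have C\<Omega>: "C \<subseteq> \<Omega>" using D_nonzero by (auto simp: C_def \<Omega>_def)
  have sm: "smooth_on \<Omega> fst" "smooth_on \<Omega> snd" by (intro smooth_on_fst smooth_on_snd smooth_on_id \<Omega>)+
  have H: "smooth_on \<Omega> H" unfolding H_def[abs_def]
    by (intro smooth_on_Phi_comp sm \<Omega>) (auto simp: \<Omega>_def)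
  have "smooth_on \<Omega> (\<lambda>x. f (heis_mult a p (heis_inv (del (snd x) (fst x)))))"
    by (rule smooth_on_compose[OF \<Omega> open_UNIV f smooth_on_heis_mult[OF \<Omega> smooth_on_const
          smooth_on_heis_inv[OF \<Omega> smooth_on_del[OF \<Omega> sm(2,1)]]]]) auto
  moreover have "smooth_on \<Omega> (\<lambda>x. amp (snd x) (fst x))"
    by (rule smooth_on_amp[OF \<Omega> sm(2,1)]) (auto simp: \<Omega>_def)
  ultimately have G: "smooth_on \<Omega> G" unfolding G_def[abs_def] by (intro smooth_on_mult \<Omega>)
  define W where "W z = (\<Sum>e\<in>Basis. (dderiv (Phi b \<beta>) e z)\<^sup>2)" for z :: "'n heis"
  have "continuous_on D W" unfolding W_def
    by (intro continuous_intros continuous_on_subset[OF smooth_on_continuous[OF smooth_on_dderiv[OF smooth_on_Phi[OF b ab \<beta>]]] D_nonzero])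
  moreover have "W z > 0" if "z \<in> D" for z
    unfolding W_def using Phi_grad_pos[OF b ab \<beta>, of z] D_nonzero that by auto
  ultimately obtain c where c: "c > 0" "\<And>z. z \<in> D \<Longrightarrow> c \<le> W z"
    using compact_positive_lower_bound[OF compact_D, of W] by blast
  have "\<exists>B>0. \<forall>p\<in>{0..1}. \<forall>l>0. norm (LINT z|lborel. G (z, p) * cis (l * H (z, p))) \<le> B / (l * 1) ^ N"
  proof (rule uniform_nonstationary_phase[OF \<Omega> C C\<Omega> H G, of "{0..1}" "\<lambda>p. 1" c N])
    show "G (z, p) = 0" if "p \<in> {0..1}" "(z, p) \<notin> C" for p z
      using that by (auto simp: C_def G_def amp_eq_0)
    show "c * 1\<^sup>2 \<le> (\<Sum>e\<in>Basis. (dderiv (\<lambda>z. H (z, p)) e z)\<^sup>2)" if "p \<in> {0..1}" "(z, p) \<in> C" for p z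
      using that c(2)[of z] by (auto simp: W_def H_def C_def)
    show "family.scale_Ck {0..1} (\<lambda>p. {z. (z, p) \<in> \<Omega>}) (\<lambda>p. {z. (z, p) \<in> C}) k (\<lambda>p. 1) (\<lambda>p z. H (z, p))"
      if "family {0..1} (\<lambda>p. {z. (z, p) \<in> \<Omega>}) (\<lambda>p. {z. (z, p) \<in> C})" for k
      by (rule family.scale_Ck_joint_bounded[OF that \<Omega>, where \<pi> = "\<lambda>p. p", OF _ C C\<Omega> _ H]) auto
  qed (use c in auto)
  then obtain B where "B > 0" "\<And>p l. p \<in> {0..1} \<Longrightarrow> l > 0 \<Longrightarrow>
    norm (LINT z|lborel. G (z, p) * cis (l * H (z, p))) \<le> B / l ^ N" by auto
  then show ?thesis by (intro that[of B]) (auto simp: G_def H_def)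
qed

end

section \<open>The dyadic pieces of the kernel\<close>

text \<open>By scaling, the minimum of \<open>B1\<close> and
  \<open>B2 / (L * norm u) ^ (d + 1)\<close> has an integral proportional to \<open>L\<close> to the
  power \<open>- d\<close>, where \<open>d\<close> is the dimension. It is dominated by a series
  over dyadic balls of radius \<open>2 ^ Suc k / L\<close>; the exponent \<open>d + 1\<close> leaves
  a factor \<open>(1/2) ^ k\<close> against their volume.\<close>

lemma decay_nn_integral:
  fixes B1 B2 :: real
  assumes B: "B1 \<ge> 0" "B2 \<ge> 0"
  obtains C where "C \<ge> 0" "\<And>L :: real. \<And>f :: 'a::euclidean_space \<Rightarrow> complex. L > 0 \<Longrightarrow> (\<And>u. u \<noteq> 0 \<Longrightarrow> cmod (f u) \<le> B1) \<Longrightarrow>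
      (\<And>u. u \<noteq> 0 \<Longrightarrow> cmod (f u) \<le> B2 / (L * norm u) ^ (DIM('a) + 1)) \<Longrightarrow>
      (\<integral>\<^sup>+u. ennreal (cmod (f u)) \<partial>lborel) \<le> ennreal (C / L ^ DIM('a))"
proof -
  let ?d = "DIM('a)"
  define V where "V = unit_ball_vol (real ?d)"
  have V: "V \<ge> 0" by (simp add: V_def)
  define C where "C = (B1 + B2) * V * 2 ^ ?d * 2"
  show ?thesis
  proof
    show "C \<ge> 0" using B V by (simp add: C_def)
    fix L :: real and f :: "'a \<Rightarrow> complex"
    assume L: "L > 0" and f1: "\<And>u. u \<noteq> 0 \<Longrightarrow> cmod (f u) \<le> B1"
      and f2: "\<And>u. u \<noteq> 0 \<Longrightarrow> cmod (f u) \<le> B2 / (L * norm u) ^ (?d + 1)"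
    define t where "t k u = (B1 + B2) * (1/2) ^ (k * (?d + 1)) * indicator (cball 0 (2 ^ Suc k / L)) u" for k and u :: 'a
    have t0: "t k u \<ge> 0" for k u using B by (simp add: t_def)
    have bound: "ennreal (cmod (f u)) \<le> (\<Sum>k. ennreal (t k u))" if u: "u \<noteq> 0" for u
    proof -
      obtain k where k: "cmod (f u) \<le> t k u"
      proof (cases "L * norm u \<le> 1")
        case True
        then have "norm u \<le> 2 ^ Suc 0 / L" using L by (simp add: field_simps)
        then have "cmod (f u) \<le> t 0 u" using f1[OF u] B by (simp add: t_def)
        then show ?thesis by (rule that)
      next
        case False
        obtain m where m: "L * norm u < 2 ^ m" using real_arch_pow[of 2 "L * norm u"] by auto
        define l where "l = (LEAST m. L * norm u < 2 ^ m)"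
        have l: "L * norm u < 2 ^ l" unfolding l_def by (rule LeastI[of "\<lambda>m. L * norm u < 2 ^ m" m, OF m])
        then obtain k where k: "l = Suc k" using False by (cases l) auto
        have "\<not> L * norm u < 2 ^ k" using not_less_Least[of k "\<lambda>m. L * norm u < 2 ^ m"] k by (simp add: l_def)
        then have lower: "2 ^ k \<le> L * norm u" by simp
        have "cmod (f u) \<le> B2 / (L * norm u) ^ (?d + 1)" by (rule f2[OF u])
        also have "\<dots> \<le> B2 / (2 ^ k) ^ (?d + 1)"
          using B lower by (intro frac_le power_mono) auto
        also have "\<dots> = B2 * (1/2) ^ (k * (?d + 1))"
          by (simp only: power_mult power_divide power_one) simp
        also have "\<dots> \<le> (B1 + B2) * (1/2) ^ (k * (?d + 1))" using B by (intro mult_right_mono) auto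
        also have "\<dots> = t k u"
        proof -
          have "norm u \<le> 2 ^ Suc k / L" using l k L by (simp add: field_simps)
          then show ?thesis by (simp add: t_def)
        qed
        finally show ?thesis by (rule that)
      qed
      then have "ennreal (cmod (f u)) \<le> ennreal (t k u)" by (rule ennreal_leI)
      also have "\<dots> \<le> (\<Sum>k. ennreal (t k u))"
        using sum_le_suminf[of "\<lambda>k. ennreal (t k u)" "{k}"] by simp
      finally show ?thesis .
    qed
    have "AE u in lborel. (u :: 'a) \<noteq> 0" by (rule AE_lborel_singleton)
    then have "(\<integral>\<^sup>+u. ennreal (cmod (f u)) \<partial>lborel) \<le> (\<integral>\<^sup>+u. (\<Sum>k. ennreal (t k u)) \<partial>lborel)"
      by (intro nn_integral_mono_AE) (auto intro: bound elim!: eventually_mono)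
    also have "\<dots> = (\<Sum>k. \<integral>\<^sup>+u. ennreal (t k u) \<partial>lborel)"

    proof (rule nn_integral_suminf)
      show "(\<lambda>u. ennreal (t k u)) \<in> borel_measurable lborel" for k
        unfolding t_def by (intro measurable_compose[OF _ measurable_ennreal] borel_measurable_times
            borel_measurable_const borel_measurable_indicator) simp
    qed
    also have "\<dots> = (\<Sum>k. ennreal (C / 2 / L ^ ?d * (1/2) ^ k))"
    proof (rule suminf_cong)
      fix k
      define A where "A = (B1 + B2) * (1/2) ^ (k * (?d + 1))"
      have A: "A \<ge> 0" using B by (simp add: A_def)
      have "(\<integral>\<^sup>+u. ennreal (t k u) \<partial>lborel) = (\<integral>\<^sup>+u. ennreal A * indicator (cball (0::'a) (2 ^ Suc k / L)) u \<partial>lborel)"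
        by (intro nn_integral_cong) (auto simp: t_def A_def indicator_def)
      also have "\<dots> = ennreal A * emeasure lborel (cball (0::'a) (2 ^ Suc k / L))"
        by (rule nn_integral_cmult_indicator) simp
      also have "\<dots> = ennreal (A * (V * (2 ^ Suc k / L) ^ ?d))"
        using L A V by (subst emeasure_cball) (auto simp: V_def ennreal_mult)
      also have "A * (V * (2 ^ Suc k / L) ^ ?d) = C / 2 / L ^ ?d * (1/2) ^ k"
      proof -
        have "(1/2 :: real) ^ (k * (?d + 1)) * (2 ^ Suc k) ^ ?d = 2 ^ ?d * (1/2) ^ k"
          by (simp add: power_mult[symmetric] power_mult_distrib power_add algebra_simps power_divide)
        moreover have "A * (V * (2 ^ Suc k / L) ^ ?d) = (B1 + B2) * V / L ^ ?d * ((1/2) ^ (k * (?d + 1)) * (2 ^ Suc k) ^ ?d)"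
          by (simp only: A_def power_divide[of "2 ^ Suc k"]) (simp only: times_divide_eq_right times_divide_eq_left mult_ac)
        ultimately have "A * (V * (2 ^ Suc k / L) ^ ?d) = (B1 + B2) * V / L ^ ?d * (2 ^ ?d * (1/2) ^ k)" by (simp only:)
        then show ?thesis by (simp add: C_def)
      qed
      finally show "(\<integral>\<^sup>+u. ennreal (t k u) \<partial>lborel) = ennreal (C / 2 / L ^ ?d * (1/2) ^ k)" .
    qed
    also have "\<dots> = ennreal (\<Sum>k. C / 2 / L ^ ?d * (1/2) ^ k)"
      using B V L by (intro suminf_ennreal2) (auto simp: C_def intro!: summable_mult summable_geometric)
    also have "(\<Sum>k. C / 2 / L ^ ?d * (1/2) ^ k) = C / L ^ ?d"
      by (subst suminf_mult) (auto intro: summable_geometric simp: suminf_geometric)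
    finally show "(\<integral>\<^sup>+u. ennreal (cmod (f u)) \<partial>lborel) \<le> ennreal (C / L ^ ?d)" .
  qed
qed

text \<open>Each horizontal direction contributes \<open>r\<close> to the Jacobian and the central
  one \<open>r\<^sup>2\<close>, whence the homogeneous dimension
  \<open>2 * CARD('n) + 2\<close>.\<close>

lemma lborel_del:
  fixes r :: real
  assumes r: "r > 0"
  shows "(lborel :: 'n::finite heis measure)
    = density (distr lborel borel (del r)) (\<lambda>_. ennreal (r ^ (2 * CARD('n) + 2)))"
proof -
  \<comment> \<open>A basis vector is central exactly when its first component vanishes.\<close>
  define c where "c j = (if fst j = 0 then r\<^sup>2 else r)" for j :: "'n heis"
  have B: "Basis = (\<lambda>u. (u, 0)) ` (Basis :: ((real^'n) \<times> (real^'n)) set) \<union> (\<lambda>v. (0, v)) ` (Basis :: real set)"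
    by (simp add: Basis_prod_def)
  have T: "(\<lambda>x. 0 + (\<Sum>j\<in>Basis. (c j * (x \<bullet> j)) *\<^sub>R j)) = (del r :: 'n heis \<Rightarrow> _)"
  proof
    fix x :: "'n heis"
    show "0 + (\<Sum>j\<in>Basis. (c j * (x \<bullet> j)) *\<^sub>R j) = del r x"
    proof (rule euclidean_eqI)
      fix i :: "'n heis" assume i: "i \<in> Basis"
      have "(\<Sum>j\<in>Basis. (c j * (x \<bullet> j)) *\<^sub>R j) \<bullet> i = (\<Sum>j\<in>Basis. if j = i then c j * (x \<bullet> j) else 0)"
        unfolding inner_sum_left using i by (intro sum.cong) (auto simp: inner_Basis)
      also have "\<dots> = c i * (x \<bullet> i)" using i by simp
      also have "\<dots> = del r x \<bullet> i" using i unfolding B by (auto simp: c_def del_def inner_prod_def distrib_left)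
      finally show "(0 + (\<Sum>j\<in>Basis. (c j * (x \<bullet> j)) *\<^sub>R j)) \<bullet> i = del r x \<bullet> i" by simp
    qed
  qed
  have "(\<Prod>j\<in>Basis. \<bar>c j\<bar>) = (\<Prod>j\<in>(\<lambda>u. (u, 0)) ` (Basis :: ((real^'n) \<times> (real^'n)) set). \<bar>c j\<bar>)
      * (\<Prod>j\<in>(\<lambda>v. (0, v)) ` (Basis :: real set). \<bar>c j\<bar>)"
    unfolding B by (rule prod.union_disjoint) auto
  also have "(\<Prod>j\<in>(\<lambda>u. (u, 0)) ` (Basis :: ((real^'n) \<times> (real^'n)) set). \<bar>c j\<bar>) = (\<Prod>u\<in>(Basis :: ((real^'n) \<times> (real^'n)) set). r)"

  proof (subst prod.reindex)
    show "inj_on (\<lambda>u. (u, 0 :: real)) (Basis :: ((real^'n) \<times> (real^'n)) set)" by (simp add: inj_on_def)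
    show "prod ((\<lambda>j. \<bar>c j\<bar>) \<circ> (\<lambda>u. (u, 0))) Basis = (\<Prod>u\<in>(Basis :: ((real^'n) \<times> (real^'n)) set). r)"
      by (rule prod.cong) (use r in \<open>auto simp: c_def dest: nonzero_Basis\<close>)
  qed
  also have "(\<Prod>j\<in>(\<lambda>v. (0, v)) ` (Basis :: real set). \<bar>c j\<bar>) = r\<^sup>2"
    by (simp add: c_def)
  also have "(\<Prod>u\<in>(Basis :: ((real^'n) \<times> (real^'n)) set). r) * r\<^sup>2 = r ^ (2 * CARD('n) + 2)"
    by (simp add: power_add mult_2 power2_eq_square)
  finally have p: "(\<Prod>j\<in>Basis. \<bar>c j\<bar>) = r ^ (2 * CARD('n) + 2)" .
  have "c j \<noteq> 0" for j using r by (simp add: c_def)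
  from lborel_affine_euclidean[of c 0, OF this] show ?thesis unfolding T p .
qed

lemma measurable_del [measurable]: "del r \<in> borel_measurable borel"
  by (intro borel_measurable_continuous_onI continuous_intros)

lemma nn_integral_del:
  fixes f :: "'n::finite heis \<Rightarrow> ennreal"
  assumes "r > 0" and [measurable]: "f \<in> borel_measurable borel"
  shows "(\<integral>\<^sup>+z. f z \<partial>lborel) = ennreal (r ^ (2 * CARD('n) + 2)) * (\<integral>\<^sup>+z. f (del r z) \<partial>lborel)"
proof -
  have "(\<integral>\<^sup>+z. f z \<partial>lborel) = (\<integral>\<^sup>+z. f z \<partial>density (distr lborel borel (del r)) (\<lambda>_. ennreal (r ^ (2 * CARD('n) + 2))))"
    using lborel_del[OF assms(1), where 'n = 'n] by simp
  also have "\<dots> = (\<integral>\<^sup>+z. ennreal (r ^ (2 * CARD('n) + 2)) * f z \<partial>distr lborel borel (del r))"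
    by (rule nn_integral_density) simp_all
  also have "\<dots> = (\<integral>\<^sup>+z. ennreal (r ^ (2 * CARD('n) + 2)) * f (del r z) \<partial>lborel)"
    by (rule nn_integral_distr) simp_all
  also have "\<dots> = ennreal (r ^ (2 * CARD('n) + 2)) * (\<integral>\<^sup>+z. f (del r z) \<partial>lborel)"
    by (rule nn_integral_cmult) simp
  finally show ?thesis .
qed

lemma integral_del:
  fixes f :: "'n::finite heis \<Rightarrow> complex"
  assumes r: "r > 0" and [measurable]: "f \<in> borel_measurable borel"
  shows "(LINT z|lborel. f z) = of_real (r ^ (2 * CARD('n) + 2)) * (LINT z|lborel. f (del r z))"
proof -
  have "(LINT z|lborel. f z) = (LINT z|density (distr lborel borel (del r)) (\<lambda>_. ennreal (r ^ (2 * CARD('n) + 2))). f z)"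
    using lborel_del[OF assms(1), where 'n = 'n] by simp
  also have "\<dots> = (LINT z|distr lborel borel (del r). (r ^ (2 * CARD('n) + 2)) *\<^sub>R f z)"
    using r by (intro integral_density) simp_all
  also have "\<dots> = (LINT z|lborel. (r ^ (2 * CARD('n) + 2)) *\<^sub>R f (del r z))"
    by (rule integral_distr) simp_all
  also have "\<dots> = of_real (r ^ (2 * CARD('n) + 2)) * (LINT z|lborel. f (del r z))"
    by (simp add: scaleR_conv_of_real)
  finally show ?thesis .
qed

lemma continuous_compact_support:
  fixes f :: "'a::euclidean_space \<Rightarrow> complex"
  assumes "compact C" "continuous_on C f" "\<And>z. z \<notin> C \<Longrightarrow> f z = 0"
  shows "integrable lborel f" "f \<in> L2"
proof -
  have "integrable lborel (\<lambda>z. indicator C z *\<^sub>R f z)" by (rule borel_integrable_compact[OF assms(1,2)])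
  also have "(\<lambda>z. indicator C z *\<^sub>R f z) = f" using assms(3) by (auto simp: fun_eq_iff indicator_def)
  finally show i: "integrable lborel f" .
  have "integrable lborel (\<lambda>z. indicator C z *\<^sub>R (cmod (f z))\<^sup>2)"
    by (rule borel_integrable_compact[OF assms(1)]) (intro continuous_intros assms(2))
  also have "(\<lambda>z. indicator C z *\<^sub>R (cmod (f z))\<^sup>2) = (\<lambda>z. (cmod (f z))\<^sup>2)"
    using assms(3) by (auto simp: fun_eq_iff indicator_def)
  finally show "f \<in> L2" using i by (simp add: L2_def)
qed

text \<open>The kernels are even under inversion, so the adjoint has kernel
  \<open>cnj (K j z)\<close>. Its correlations are the complex conjugates of those of
  \<open>K\<close>, and one set of L1 bounds yields both orthogonality relations. Near pairs receive
  \<open>B\<close> as the product of two operator bounds \<open>sqrt B\<close>.\<close>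

lemma almost_orthogonal_conv:
  fixes K :: "nat \<Rightarrow> 'n::finite heis \<Rightarrow> complex"
  assumes K: "\<And>j. integrable lborel (K j)" "\<And>j. K j \<in> L2" and even: "\<And>j z. K j (heis_inv z) = K j z"
    and diag: "\<And>j. (\<integral>\<^sup>+u. ennreal (cmod (LINT z|lborel. cnj (K j z) * K j (heis_mult a u z))) \<partial>lborel) \<le> ennreal B"
    and off: "\<And>j k. k + M \<le> j \<Longrightarrow>
      (\<integral>\<^sup>+u. ennreal (cmod (LINT z|lborel. cnj (K j z) * K k (heis_mult a u z))) \<partial>lborel) \<le> ennreal (B * q ^ (j + k))"
    and B: "B \<ge> 0" and q: "0 < q" "q < 1"
  shows "almost_orthogonal (\<lambda>j. conv a (K j)) (\<lambda>j. conv a (\<lambda>z. cnj (K j z)))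
    (\<lambda>j k. if j + M \<le> k \<or> k + M \<le> j then B * q ^ (j + k) else B) B q M"
proof -
  let ?c = "\<lambda>j k. if j + M \<le> k \<or> k + M \<le> j then B * q ^ (j + k) else B"
  have main: "cmod (ip (conv a (K j) f) (conv a (K k) g)) \<le> ?c j k * (L2_norm f * L2_norm g)"
    if K: "\<And>j. integrable lborel (K j)" "\<And>j. K j \<in> L2"
      and diag: "\<And>j. (\<integral>\<^sup>+u. ennreal (cmod (LINT z|lborel. cnj (K j z) * K j (heis_mult a u z))) \<partial>lborel) \<le> ennreal B"
      and off: "\<And>j k. k + M \<le> j \<Longrightarrow>
        (\<integral>\<^sup>+u. ennreal (cmod (LINT z|lborel. cnj (K j z) * K k (heis_mult a u z))) \<partial>lborel) \<le> ennreal (B * q ^ (j + k))"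
      and f: "f \<in> L2" and g: "g \<in> L2"
    for K :: "nat \<Rightarrow> 'n heis \<Rightarrow> complex" and f g j k
  proof -
    have far: "cmod (ip (conv a (K j) f) (conv a (K k) g)) \<le> B * q ^ (j + k) * (L2_norm f * L2_norm g)"
      if "k + M \<le> j" "f \<in> L2" "g \<in> L2" for j k f g
      by (rule ip_conv_conv[OF K K(1) that(2,3) off[OF that(1)]]) (use B q in auto)
    have one: "L2_norm (conv a (K j) f) \<le> sqrt B * L2_norm f" if f: "f \<in> L2" for j f
    proof -
      have "(L2_norm (conv a (K j) f))\<^sup>2 = cmod (ip (conv a (K j) f) (conv a (K j) f))" by (simp add: ip_self norm_power)
      also have "\<dots> \<le> B * (L2_norm f * L2_norm f)" by (rule ip_conv_conv[OF K K(1) f f diag B])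
      also have "\<dots> = (sqrt B * L2_norm f)\<^sup>2" using B by (simp add: power2_eq_square power_mult_distrib)
      finally show ?thesis by (rule power2_le_imp_le) (use B in simp)
    qed
    consider "k + M \<le> j" | "j + M \<le> k" | "\<not> k + M \<le> j" "\<not> j + M \<le> k" by blast
    then show ?thesis
    proof cases
      case 1
      then show ?thesis using far[OF 1 f g] by simp
    next
      case 2
      have "cmod (ip (conv a (K j) f) (conv a (K k) g)) = cmod (ip (conv a (K k) g) (conv a (K j) f))"
        by (subst ip_commute) simp
      then show ?thesis using far[OF 2 g f] 2 by (simp add: add.commute mult_ac)
    next
      case 3
      have "cmod (ip (conv a (K j) f) (conv a (K k) g)) \<le> L2_norm (conv a (K j) f) * L2_norm (conv a (K k) g)"
        by (intro norm_ip_le conv_L2 K f g)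
      also have "\<dots> \<le> (sqrt B * L2_norm f) * (sqrt B * L2_norm g)"
        by (intro mult_mono one f g) (use B in auto)
      also have "\<dots> = B * (L2_norm f * L2_norm g)" using B by simp
      finally show ?thesis using 3 by simp
    qed
  qed
  have cK: "integrable lborel (\<lambda>z. cnj (K j z))" "(\<lambda>z. cnj (K j z)) \<in> L2" for j
    using K by (auto intro: L2_cnj)
  have cG: "cmod (LINT z|lborel. cnj (cnj (K j z)) * cnj (K k (heis_mult a u z)))
      = cmod (LINT z|lborel. cnj (K j z) * K k (heis_mult a u z))" for j k u
    by (subst complex_mod_cnj[symmetric]) (simp flip: Bochner_Integration.integral_cnj)
  show ?thesis
  proof
    fix f g :: "'n heis \<Rightarrow> complex" and j k :: nat
    assume f: "f \<in> L2"
    show "conv a (K j) f \<in> L2" "conv a (\<lambda>z. cnj (K j z)) f \<in> L2"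
      using conv_L2[OF K(1) f] conv_L2[OF cK(1) f] by auto
    show "conv a (K j) (\<lambda>p. s * f p) p = s * conv a (K j) f p" for s p by (rule conv_scale)
    assume g: "g \<in> L2"
    show "ip (conv a (K j) f) g = ip f (conv a (\<lambda>z. cnj (K j z)) g)"
      using conv_adjoint[OF K(1) f g, of a j] by (simp add: even)
    show "conv a (K j) (\<lambda>p. f p + g p) p = conv a (K j) f p + conv a (K j) g p" for p
      by (rule conv_add[OF K(2) f g])
    show "cmod (ip (conv a (K j) f) (conv a (K k) g)) \<le> ?c j k * (L2_norm f * L2_norm g)"
      by (rule main[OF K diag off f g])
    show "cmod (ip (conv a (\<lambda>z. cnj (K j z)) f) (conv a (\<lambda>z. cnj (K k z)) g)) \<le> ?c j k * (L2_norm f * L2_norm g)"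
      by (rule main[OF cK _ _ f g]) (use diag off in \<open>simp_all only: cG\<close>)
  next
    fix j k :: nat
    show "0 \<le> ?c j k" using B q by simp
    show "?c j k \<le> B" using B q by (auto intro!: mult_left_le power_le_one)
    show "?c j k = ?c k j" by (auto simp: add.commute)
  qed (use q in auto)
qed

section \<open>Rescaled pieces and their correlations\<close>

locale kernel = amplitude a b \<beta> \<gamma> \<psi> \<theta> n
  for a b \<alpha> \<beta> \<gamma> :: real and \<psi> \<theta> :: "real \<Rightarrow> complex" and n :: "'n::finite itself" +
  assumes \<gamma>: "\<gamma> = - (2 * real CARD('n) + 2 + \<alpha>) / 2"
    and \<alpha>: "\<alpha> \<le> (real CARD('n) + 1/2) * \<beta>"
begin

definition \<delta> :: "nat \<Rightarrow> real" where "\<delta> j = (1/2) ^ j"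

definition \<Lambda> :: "nat \<Rightarrow> real" where "\<Lambda> j = 2 powr (real j * \<beta>)"

definition rho :: "'n heis \<Rightarrow> real" where "rho z = sqrt (sq_rho b z)"

definition Kj :: "nat \<Rightarrow> 'n heis \<Rightarrow> complex" where
  "Kj j z = \<theta> (2 ^ j * rho z) * kernel_fun rho \<psi> \<alpha> \<beta> z"

lemma \<delta>: "\<delta> j > 0" "\<delta> j \<ge> 0" "\<delta> j \<le> 1" "2 ^ j * \<delta> j = 1"
  by (simp_all add: \<delta>_def power_le_one power_divide)

lemma \<delta>_powr: "\<delta> j powr x = 2 powr (- (real j * x))"
proof -
  have "\<delta> j = 2 powr (- real j)" by (simp add: \<delta>_def powr_minus powr_realpow power_divide inverse_eq_divide)
  then show ?thesis by (simp add: powr_powr)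
qed

lemma \<delta>_power: "\<delta> j ^ (2 * CARD('n) + 2) = 2 powr (- (real j * (2 * real CARD('n) + 2)))"
  using \<delta>_powr[of j "real (2 * CARD('n) + 2)"] powr_realpow[OF \<delta>(1), of j "2 * CARD('n) + 2"] by (simp add: algebra_simps)

lemma \<Lambda>_pos: "\<Lambda> j > 0"
  by (simp add: \<Lambda>_def)

lemma \<Lambda>_power: "\<Lambda> j ^ N = 2 powr (real j * \<beta> * real N)"
  by (simp add: \<Lambda>_def powr_power mult_ac)

lemma sq_rho_nonneg: "sq_rho b z \<ge> 0" for z :: "'n heis"
  using sq_rho_pos[OF b, of z] by (cases "z = 0") (auto simp: sq_rho_zero[OF b])

text \<open>After rescaling, \<open>j\<close> survives only in the constant, in the frequency
  \<open>\<Lambda> j\<close> and in the parameter \<open>\<delta> j\<close> of the cutoff; the phase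
  function is the same for all pieces.\<close>

lemma Kj_del:
  "Kj j (del (\<delta> j) z) = of_real (2 powr (real j * (2 * real CARD('n) + 2 + \<alpha>))) * (amp (\<delta> j) z * cis (\<Lambda> j * Phi b \<beta> z))"
proof -
  let ?s = "sq_rho b z"
  have s: "?s \<ge> 0" by (rule sq_rho_nonneg)
  have rho: "rho (del (\<delta> j) z) = \<delta> j * ?s powr (1/2)"
    using \<delta>(2)[of j] s by (simp add: rho_def sq_rho_del real_sqrt_mult powr_half_sqrt)
  have p: "(\<delta> j * ?s powr (1/2)) powr x = 2 powr (- (real j * x)) * ?s powr (x / 2)" for x
    using \<delta>(2)[of j] by (simp add: powr_mult \<delta>_powr powr_powr)
  have "\<delta> j * ?s powr (1/2) * 2 ^ j = ?s powr (1/2)" using \<delta>(4)[of j] by (simp add: algebra_simps)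
  then have t: "2 ^ j * (\<delta> j * ?s powr (1/2)) = ?s powr (1/2)" by (simp add: mult.commute)
  have e1: "- (real j * (- 2 * real CARD('n) - 2 - \<alpha>)) = real j * (2 * real CARD('n) + 2 + \<alpha>)"
    by (simp add: algebra_simps)
  have e2: "(- 2 * real CARD('n) - 2 - \<alpha>) / 2 = \<gamma>" by (simp add: \<gamma>)
  show ?thesis
    unfolding Kj_def kernel_fun_def rho p t e1 e2 amp_def
    by (simp add: cis_conv_exp \<Lambda>_def Phi_def mult_ac)
qed

lemma del_\<delta>_inverse: "del (\<delta> j) (del (2 ^ j) z) = z" "del (2 ^ j) (del (\<delta> j) z) = z"
  using \<delta>(4)[of j] by (simp_all add: del_del mult.commute)

lemma Kj_L1_L2: "integrable lborel (Kj j)" "Kj j \<in> L2"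
proof -
  have C: "compact (del (\<delta> j) ` D)"
    by (intro compact_continuous_image continuous_intros compact_D)
  have e: "Kj j z = of_real (2 powr (real j * (2 * real CARD('n) + 2 + \<alpha>)))
      * (amp (\<delta> j) (del (2 ^ j) z) * cis (\<Lambda> j * Phi b \<beta> (del (2 ^ j) z)))" for z
    using Kj_del[of j "del (2 ^ j) z"] by (simp add: del_\<delta>_inverse)
  have sub: "del (2 ^ j) ` (del (\<delta> j) ` D) \<subseteq> - {0}" using D_nonzero by (auto simp: del_\<delta>_inverse)
  have cd: "continuous_on (del (\<delta> j) ` D) (del (2 ^ j))" by (intro continuous_intros)
  have "smooth_on (- {0}) (\<lambda>z. amp (\<delta> j) z)"
    by (rule smooth_on_amp[OF open_nonzero smooth_on_const smooth_on_id]) simp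
  then have cA: "continuous_on (del (\<delta> j) ` D) (\<lambda>z. amp (\<delta> j) (del (2 ^ j) z))"
    by (rule continuous_on_compose2[OF smooth_on_continuous cd sub])
  have cP: "continuous_on (del (\<delta> j) ` D) (\<lambda>z. Phi b \<beta> (del (2 ^ j) z))"
    by (rule continuous_on_compose2[OF smooth_on_continuous[OF smooth_on_Phi[OF b ab \<beta>]] cd sub])
  have cont: "continuous_on (del (\<delta> j) ` D) (Kj j)"
    unfolding e[abs_def] by (intro continuous_intros cA cP)
  have zero: "Kj j z = 0" if "z \<notin> del (\<delta> j) ` D" for z
  proof -
    have "del (2 ^ j) z \<notin> D" using that del_\<delta>_inverse(1)[of j z] by (metis image_eqI)
    then show ?thesis by (simp add: e amp_eq_0)
  qed
  show "integrable lborel (Kj j)" "Kj j \<in> L2" using continuous_compact_support[OF C cont zero] by auto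
qed

lemma Kj_measurable [measurable]: "Kj j \<in> borel_measurable borel"
  using Kj_L1_L2(2) by (rule L2_measurable)

lemma Kj_even: "Kj j (heis_inv z) = Kj j z"
  by (simp add: Kj_def kernel_fun_def rho_def)

definition G :: "nat \<Rightarrow> nat \<Rightarrow> 'n heis \<Rightarrow> complex" where
  "G j k u = (LINT z|lborel. cnj (Kj j z) * Kj k (heis_mult a u z))"

text \<open>For \<open>k \<le> j\<close>, \<open>z\<close> is rescaled by the finer scale
  \<open>\<delta> j\<close> and \<open>u\<close> by the coarser scale \<open>\<delta> k\<close>. The
  other factor then sees \<open>z\<close> through the dilation by
  \<open>\<delta> (j - k) \<le> 1\<close>.\<close>

definition I :: "nat \<Rightarrow> nat \<Rightarrow> 'n heis \<Rightarrow> complex" where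
  "I j k u = (LINT z|lborel. cnj (amp (\<delta> j) z) * amp (\<delta> k) (heis_mult a u (del (\<delta> (j - k)) z))
     * cis (\<Lambda> j * (\<delta> (j - k) powr \<beta> * Phi b \<beta> (heis_mult a u (del (\<delta> (j - k)) z)) - Phi b \<beta> z)))"

lemma G_del:
  assumes "k \<le> j"
  shows "G j k (del (\<delta> k) u) = of_real (2 powr (real j * \<alpha> + real k * (2 * real CARD('n) + 2 + \<alpha>))) * I j k u"
proof -
  have d: "\<delta> j = \<delta> k * \<delta> (j - k)" using assms by (simp add: \<delta>_def flip: power_add)
  have L: "\<Lambda> k = \<Lambda> j * \<delta> (j - k) powr \<beta>"
    using assms by (simp add: \<Lambda>_def \<delta>_powr of_nat_diff algebra_simps flip: powr_add)
  define cj ck where "cj = 2 powr (real j * (2 * real CARD('n) + 2 + \<alpha>))" and "ck = 2 powr (real k * (2 * real CARD('n) + 2 + \<alpha>))"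
  have arg: "heis_mult a (del (\<delta> k) u) (del (\<delta> j) z) = del (\<delta> k) (heis_mult a u (del (\<delta> (j - k)) z))" for z
    unfolding d del_del[symmetric] heis_mult_del ..
  have integrand: "cnj (Kj j (del (\<delta> j) z)) * Kj k (heis_mult a (del (\<delta> k) u) (del (\<delta> j) z))
    = of_real (cj * ck) * (cnj (amp (\<delta> j) z) * amp (\<delta> k) (heis_mult a u (del (\<delta> (j - k)) z))
     * cis (\<Lambda> j * (\<delta> (j - k) powr \<beta> * Phi b \<beta> (heis_mult a u (del (\<delta> (j - k)) z)) - Phi b \<beta> z)))" for z
  proof -
    have e: "cis (\<Lambda> j * (\<delta> (j - k) powr \<beta> * x - y)) = cis (\<Lambda> k * x) * cnj (cis (\<Lambda> j * y))" for x y
      unfolding L cis_cnj cis_mult by (simp add: algebra_simps)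
    show ?thesis unfolding arg Kj_del cj_def[symmetric] ck_def[symmetric] e
      by (simp only: complex_cnj_mult complex_cnj_complex_of_real of_real_mult mult_ac)
  qed
  have "G j k (del (\<delta> k) u) = of_real (\<delta> j ^ (2 * CARD('n) + 2))
      * (LINT z|lborel. cnj (Kj j (del (\<delta> j) z)) * Kj k (heis_mult a (del (\<delta> k) u) (del (\<delta> j) z)))"
    unfolding G_def by (rule integral_del[OF \<delta>(1), where f = "\<lambda>z. cnj (Kj j z) * Kj k (heis_mult a (del (\<delta> k) u) z)"]) measurable
  also have "\<dots> = of_real (\<delta> j ^ (2 * CARD('n) + 2) * (cj * ck)) * I j k u"
    unfolding integrand I_def by simp
  also have "\<delta> j ^ (2 * CARD('n) + 2) * (cj * ck) = 2 powr (real j * \<alpha> + real k * (2 * real CARD('n) + 2 + \<alpha>))"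
    unfolding \<delta>_power cj_def ck_def powr_add[symmetric] by (simp add: algebra_simps)
  finally show ?thesis .
qed

text \<open>The Jacobians of the two rescalings cancel the homogeneous dimension in the constants
  from \<open>Kj_del\<close>, which leaves a loss symmetric in \<open>j\<close> and
  \<open>k\<close>.\<close>

lemma nn_integral_G:
  assumes "k \<le> j"
  shows "(\<integral>\<^sup>+u. ennreal (cmod (G j k u)) \<partial>lborel) = ennreal (2 powr (real (j + k) * \<alpha>)) * (\<integral>\<^sup>+u. ennreal (cmod (I j k u)) \<partial>lborel)"
proof -
  define c where "c = 2 powr (real j * \<alpha> + real k * (2 * real CARD('n) + 2 + \<alpha>))"
  have c: "c > 0" by (simp add: c_def)
  have [measurable]: "G j k \<in> borel_measurable borel"
    unfolding G_def[abs_def] by (rule lborel.borel_measurable_lebesgue_integral) measurable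
  have "(\<lambda>u. G j k (del (\<delta> k) u)) \<in> borel_measurable borel" by measurable
  then have [measurable]: "I j k \<in> borel_measurable borel"
  proof -
    have "(\<lambda>u. inverse (of_real c) * G j k (del (\<delta> k) u)) \<in> borel_measurable borel" by measurable
    also have "(\<lambda>u. inverse (of_real c) * G j k (del (\<delta> k) u)) = I j k"
      unfolding G_del[OF assms] c_def[symmetric] using c by (simp add: fun_eq_iff)
    finally show ?thesis .
  qed
  have "(\<integral>\<^sup>+u. ennreal (cmod (G j k u)) \<partial>lborel)
      = ennreal (\<delta> k ^ (2 * CARD('n) + 2)) * (\<integral>\<^sup>+u. ennreal (cmod (G j k (del (\<delta> k) u))) \<partial>lborel)"
    by (rule nn_integral_del[OF \<delta>(1), where f = "\<lambda>u. ennreal (cmod (G j k u))"]) measurable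
  also have "(\<integral>\<^sup>+u. ennreal (cmod (G j k (del (\<delta> k) u))) \<partial>lborel) = (\<integral>\<^sup>+u. ennreal c * ennreal (cmod (I j k u)) \<partial>lborel)"
    unfolding G_del[OF assms] c_def[symmetric] using c by (simp add: norm_mult ennreal_mult)
  also have "\<dots> = ennreal c * (\<integral>\<^sup>+u. ennreal (cmod (I j k u)) \<partial>lborel)"
    by (rule nn_integral_cmult) measurable
  also have "ennreal (\<delta> k ^ (2 * CARD('n) + 2)) * (ennreal c * (\<integral>\<^sup>+u. ennreal (cmod (I j k u)) \<partial>lborel))
      = ennreal (\<delta> k ^ (2 * CARD('n) + 2) * c) * (\<integral>\<^sup>+u. ennreal (cmod (I j k u)) \<partial>lborel)"
    using c \<delta>(2)[of k] by (simp add: ennreal_mult mult.assoc)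
  also have "\<delta> k ^ (2 * CARD('n) + 2) * c = 2 powr (real (j + k) * \<alpha>)"
    unfolding \<delta>_power c_def powr_add[symmetric] by (simp add: algebra_simps)
  finally show ?thesis .
qed

lemma exponent_le: "real m * \<alpha> \<le> real m * ((real CARD('n) + 1/2) * \<beta>)"
  using \<alpha> by (intro mult_left_mono) auto

text \<open>Two orders of the oscillatory estimate are combined: order 0 is a uniform bound that
  serves near \<open>u = 0\<close>, and one more than the dimension is the least integer order with
  an integrable tail.\<close>

lemma diagonal_bound:
  obtains C where "C \<ge> 0" "\<And>j. (\<integral>\<^sup>+u. ennreal (cmod (G j j u)) \<partial>lborel) \<le> ennreal C"
proof -
  let ?d = "DIM('n heis)"
  have d: "?d = 2 * CARD('n) + 1" by simp
  obtain B1 where B1: "B1 > 0" "\<And>u \<epsilon> l. u \<noteq> 0 \<Longrightarrow> 0 \<le> \<epsilon> \<Longrightarrow> \<epsilon> \<le> 1 \<Longrightarrow> l > 0 \<Longrightarrow>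
    norm (LINT z|lborel. cnj (amp \<epsilon> z) * amp \<epsilon> (heis_mult a u z) * cis (l * (Phi b \<beta> (heis_mult a u z) - Phi b \<beta> z)))
      \<le> B1 / (l * norm u) ^ 0" using diagonal_estimate[of 0] by blast
  obtain B2 where B2: "B2 > 0" "\<And>u \<epsilon> l. u \<noteq> 0 \<Longrightarrow> 0 \<le> \<epsilon> \<Longrightarrow> \<epsilon> \<le> 1 \<Longrightarrow> l > 0 \<Longrightarrow>
    norm (LINT z|lborel. cnj (amp \<epsilon> z) * amp \<epsilon> (heis_mult a u z) * cis (l * (Phi b \<beta> (heis_mult a u z) - Phi b \<beta> z)))
      \<le> B2 / (l * norm u) ^ (?d + 1)" using diagonal_estimate[of "?d + 1"] by blast
  obtain C where C: "C \<ge> 0" "\<And>L :: real. \<And>f :: 'n heis \<Rightarrow> complex. L > 0 \<Longrightarrow> (\<And>u. u \<noteq> 0 \<Longrightarrow> cmod (f u) \<le> B1) \<Longrightarrow>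
      (\<And>u. u \<noteq> 0 \<Longrightarrow> cmod (f u) \<le> B2 / (L * norm u) ^ (?d + 1)) \<Longrightarrow>
      (\<integral>\<^sup>+u. ennreal (cmod (f u)) \<partial>lborel) \<le> ennreal (C / L ^ ?d)"
    using decay_nn_integral[of B1 B2, where 'a = "'n heis"] B1(1) B2(1) by (metis less_imp_le)
  show ?thesis
  proof
    fix j
    have Ijj: "I j j u = (LINT z|lborel. cnj (amp (\<delta> j) z) * amp (\<delta> j) (heis_mult a u z)
        * cis (\<Lambda> j * (Phi b \<beta> (heis_mult a u z) - Phi b \<beta> z)))" for u
      by (simp add: I_def \<delta>_def)
    have "(\<integral>\<^sup>+u. ennreal (cmod (I j j u)) \<partial>lborel) \<le> ennreal (C / \<Lambda> j ^ ?d)"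
    proof (rule C(2)[OF \<Lambda>_pos])
      fix u :: "'n heis" assume u: "u \<noteq> 0"
      show "cmod (I j j u) \<le> B1" unfolding Ijj using B1(2)[OF u \<delta>(2,3) \<Lambda>_pos, of j j] by simp
      show "cmod (I j j u) \<le> B2 / (\<Lambda> j * norm u) ^ (?d + 1)" unfolding Ijj by (rule B2(2)[OF u \<delta>(2,3) \<Lambda>_pos])
    qed
    then have "(\<integral>\<^sup>+u. ennreal (cmod (G j j u)) \<partial>lborel) \<le> ennreal (2 powr (real (j + j) * \<alpha>)) * ennreal (C / \<Lambda> j ^ ?d)"
      unfolding nn_integral_G[OF order_refl] by (rule mult_left_mono) simp
    also have "\<dots> = ennreal (2 powr (real (j + j) * \<alpha>) * (C / \<Lambda> j ^ ?d))"
      using C(1) \<Lambda>_pos[of j] by (intro ennreal_mult[symmetric]) auto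
    also have "\<dots> \<le> ennreal C"
    proof (rule ennreal_leI)
      have "2 powr (real (j + j) * \<alpha>) \<le> 2 powr (real j * \<beta> * real ?d)"
      proof (rule powr_mono)
        have "real (j + j) * \<alpha> \<le> real (j + j) * ((real CARD('n) + 1/2) * \<beta>)" by (rule exponent_le)
        also have "\<dots> = real j * \<beta> * real ?d" unfolding d by (simp add: algebra_simps)
        finally show "real (j + j) * \<alpha> \<le> real j * \<beta> * real ?d" .
      qed simp
      then have "2 powr (real (j + j) * \<alpha>) \<le> \<Lambda> j ^ ?d" unfolding \<Lambda>_power .
      then have "2 powr (real (j + j) * \<alpha>) * C \<le> \<Lambda> j ^ ?d * C" using C(1) by (rule mult_right_mono)
      then show "2 powr (real (j + j) * \<alpha>) * (C / \<Lambda> j ^ ?d) \<le> C"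
        using zero_less_power[OF \<Lambda>_pos, of j ?d] by (simp only: times_divide_eq_right pos_divide_le_eq mult.commute[of C])
    qed
    finally show "(\<integral>\<^sup>+u. ennreal (cmod (G j j u)) \<partial>lborel) \<le> ennreal C" .
  qed (rule C(1))
qed

text \<open>Here \<open>u\<close> is confined to a fixed ball, so all gain comes from the order of
  decay. Order \<open>2 * CARD('n) + 2\<close> exceeds by one what balances the loss at
  \<open>k = j\<close>; since \<open>k \<le> j\<close>, the surplus \<open>\<Lambda> j\<close> is at
  least \<open>2 powr (\<beta> / 2 * (j + k))\<close>.\<close>

lemma off_diagonal_bound:
  obtains C M where "C \<ge> 0" "\<And>j k. k + M \<le> j \<Longrightarrow>
    (\<integral>\<^sup>+u. ennreal (cmod (G j k u)) \<partial>lborel) \<le> ennreal (C * (2 powr (- \<beta> / 2)) ^ (j + k))"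
proof -
  define N where "N = 2 * CARD('n) + 2"
  obtain B \<mu>0 R where B: "B > 0" "\<mu>0 > 0" "R > 0" "\<And>u \<mu> \<kappa> e1 e2 l. 0 \<le> \<mu> \<Longrightarrow> \<mu> \<le> \<mu>0 \<Longrightarrow> \<mu> \<le> 1 \<Longrightarrow>
    0 \<le> \<kappa> \<Longrightarrow> \<kappa> \<le> 1 \<Longrightarrow> 0 \<le> e1 \<Longrightarrow> e1 \<le> 1 \<Longrightarrow> 0 \<le> e2 \<Longrightarrow> e2 \<le> 1 \<Longrightarrow> l > 0 \<Longrightarrow>
    norm (LINT z|lborel. cnj (amp e1 z) * amp e2 (heis_mult a u (del \<mu> z))
        * cis (l * (\<kappa> * Phi b \<beta> (heis_mult a u (del \<mu> z)) - Phi b \<beta> z))) \<le> B / l ^ N"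
    and R: "\<And>u \<mu> z. 0 \<le> \<mu> \<Longrightarrow> \<mu> \<le> 1 \<Longrightarrow> z \<in> D \<Longrightarrow> heis_mult a u (del \<mu> z) \<in> D \<Longrightarrow> norm u \<le> R"
    using off_diagonal_estimate[of N] by blast
  obtain M where "(1/2) ^ M < \<mu>0" using real_arch_pow_inv[OF B(2), of "1/2"] by auto
  then have M: "\<delta> M \<le> \<mu>0" by (simp add: \<delta>_def)
  define V where "V = measure lborel (cball (0 :: 'n heis) R)"
  have V: "V \<ge> 0" "emeasure lborel (cball (0 :: 'n heis) R) = ennreal V"
    unfolding V_def using emeasure_lborel_cball_finite[of "0 :: 'n heis" R] by (auto simp: emeasure_eq_ennreal_measure)
  show ?thesis
  proof
    show "B * V \<ge> 0" using B V by simp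
    fix j k assume jk: "k + M \<le> j"
    then have kj: "k \<le> j" by simp
    have small: "\<delta> (j - k) \<le> \<mu>0"
    proof -
      have "\<delta> (j - k) \<le> \<delta> M" unfolding \<delta>_def using jk by (intro power_decreasing) auto
      with M show ?thesis by simp
    qed
    have \<kappa>: "\<delta> (j - k) powr \<beta> \<le> 1" using \<delta>(2,3)[of "j - k"] \<beta> by (intro powr_le1) auto
    have Ib: "cmod (I j k u) \<le> B / \<Lambda> j ^ N * indicator (cball 0 R) u" for u
    proof (cases "norm u \<le> R")
      case True
      then show ?thesis
        using B(4)[OF \<delta>(2) small \<delta>(3) powr_ge_zero \<kappa> \<delta>(2,3) \<delta>(2,3) \<Lambda>_pos, of j k u j] by (simp add: I_def)
    next
      case False
      have "cnj (amp (\<delta> j) z) * amp (\<delta> k) (heis_mult a u (del (\<delta> (j - k)) z)) = 0" for z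
        using R[OF \<delta>(2,3), of z u "j - k"] False amp_eq_0 by (metis complex_cnj_zero mult_zero_left mult_zero_right)
      then show ?thesis using False unfolding I_def by (simp only: mult_zero_left) simp
    qed
    have "(\<integral>\<^sup>+u. ennreal (cmod (I j k u)) \<partial>lborel) \<le> (\<integral>\<^sup>+u. ennreal (B / \<Lambda> j ^ N) * indicator (cball (0 :: 'n heis) R) u \<partial>lborel)"
    proof (rule nn_integral_mono)
      fix u :: "'n heis"
      have "ennreal (cmod (I j k u)) \<le> ennreal (B / \<Lambda> j ^ N * indicator (cball 0 R) u)" by (rule ennreal_leI[OF Ib])
      then show "ennreal (cmod (I j k u)) \<le> ennreal (B / \<Lambda> j ^ N) * indicator (cball 0 R) u"
        by (auto simp: indicator_def)
    qed
    also have "\<dots> = ennreal (B / \<Lambda> j ^ N) * ennreal V"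
      unfolding V(2)[symmetric] by (rule nn_integral_cmult_indicator) simp
    finally have "(\<integral>\<^sup>+u. ennreal (cmod (G j k u)) \<partial>lborel)
        \<le> ennreal (2 powr (real (j + k) * \<alpha>)) * (ennreal (B / \<Lambda> j ^ N) * ennreal V)"
      unfolding nn_integral_G[OF kj] by (rule mult_left_mono) simp
    also have "\<dots> = ennreal (2 powr (real (j + k) * \<alpha>) * (B / \<Lambda> j ^ N * V))"
      using B(1) V(1) \<Lambda>_pos[of j] by (simp only: ennreal_mult[symmetric] divide_nonneg_nonneg mult_nonneg_nonneg powr_ge_zero less_imp_le zero_le_power)
    also have "\<dots> \<le> ennreal (B * V * (2 powr (- \<beta> / 2)) ^ (j + k))"
    proof (rule ennreal_leI)
      have "2 powr (real (j + k) * \<alpha>) / \<Lambda> j ^ N \<le> (2 powr (- \<beta> / 2)) ^ (j + k)"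
      proof -
        have "2 powr (real (j + k) * \<alpha>) / \<Lambda> j ^ N = 2 powr (real (j + k) * \<alpha> - real j * \<beta> * real N)"
          unfolding \<Lambda>_power powr_diff ..
        also have "\<dots> \<le> 2 powr (- \<beta> / 2 * real (j + k))"
        proof (rule powr_mono)
          have "real (j + k) * \<alpha> \<le> real (j + k) * ((real CARD('n) + 1/2) * \<beta>)" by (rule exponent_le)
          also have "\<dots> = (real (j + k) * (real CARD('n) + 1)) * \<beta> - \<beta> / 2 * real (j + k)" by (simp add: algebra_simps)
          also have "\<dots> \<le> (real (j + j) * (real CARD('n) + 1)) * \<beta> - \<beta> / 2 * real (j + k)"
            using kj \<beta> by (intro diff_right_mono mult_right_mono) auto
          also have "\<dots> = real j * \<beta> * real N - \<beta> / 2 * real (j + k)" by (simp add: N_def algebra_simps)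
          finally show "real (j + k) * \<alpha> - real j * \<beta> * real N \<le> - \<beta> / 2 * real (j + k)" by simp
        qed simp
        also have "\<dots> = (2 powr (- \<beta> / 2)) ^ (j + k)" by (simp add: powr_power mult.commute)
        finally show ?thesis .
      qed
      then have "(B * V) * (2 powr (real (j + k) * \<alpha>) / \<Lambda> j ^ N) \<le> (B * V) * (2 powr (- \<beta> / 2)) ^ (j + k)"
        using B V by (intro mult_left_mono) auto
      then show "2 powr (real (j + k) * \<alpha>) * (B / \<Lambda> j ^ N * V) \<le> B * V * (2 powr (- \<beta> / 2)) ^ (j + k)"
        by (simp add: mult_ac)
    qed
    finally show "(\<integral>\<^sup>+u. ennreal (cmod (G j k u)) \<partial>lborel) \<le> ennreal (B * V * (2 powr (- \<beta> / 2)) ^ (j + k))" .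
  qed
qed

text \<open>The L1 norms of the pieces may grow like \<open>2 powr (j * \<alpha>)\<close>, but
  oscillation against a smooth function gains any power of \<open>\<Lambda> j\<close>; the order
  chosen leaves at most a multiple of \<open>2 powr (- \<beta> * j)\<close>.\<close>

lemma summable_pieces:
  fixes f :: "'n heis \<Rightarrow> complex"
  assumes f: "smooth_on UNIV f"
  shows "summable (\<lambda>j. conv a (Kj j) f p)"
proof -
  define N where "N = 2 * CARD('n) + 2"
  have [measurable]: "f \<in> borel_measurable borel"
    using smooth_on_continuous[OF f] by (rule borel_measurable_continuous_onI)
  obtain B where B: "B > 0" "\<And>\<epsilon> l. 0 \<le> \<epsilon> \<Longrightarrow> \<epsilon> \<le> 1 \<Longrightarrow> l > 0 \<Longrightarrow>
    norm (LINT z|lborel. amp \<epsilon> z * f (heis_mult a p (heis_inv (del \<epsilon> z))) * cis (l * Phi b \<beta> z)) \<le> B / l ^ N"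
    using pointwise_estimate[OF f, where N = N and p = p] by blast
  have bound: "norm (conv a (Kj j) f p) \<le> B * (2 powr (- \<beta>)) ^ j" for j
  proof -
    define c where "c = 2 powr (real j * (2 * real CARD('n) + 2 + \<alpha>))"
    define J where "J = (LINT z|lborel. amp (\<delta> j) z * f (heis_mult a p (heis_inv (del (\<delta> j) z))) * cis (\<Lambda> j * Phi b \<beta> z))"
    have "conv a (Kj j) f p = of_real (\<delta> j ^ (2 * CARD('n) + 2))
        * (LINT z|lborel. Kj j (del (\<delta> j) z) * f (heis_mult a p (heis_inv (del (\<delta> j) z))))"
      unfolding conv_def
      by (rule integral_del[OF \<delta>(1), where f = "\<lambda>z. Kj j z * f (heis_mult a p (heis_inv z))"]) measurable
    also have "(\<lambda>z. Kj j (del (\<delta> j) z) * f (heis_mult a p (heis_inv (del (\<delta> j) z))))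
      = (\<lambda>z. of_real c * (amp (\<delta> j) z * f (heis_mult a p (heis_inv (del (\<delta> j) z))) * cis (\<Lambda> j * Phi b \<beta> z)))"
      unfolding Kj_del c_def by (simp add: mult_ac)
    also have "of_real (\<delta> j ^ (2 * CARD('n) + 2)) * (LINT z|lborel. of_real c *
        (amp (\<delta> j) z * f (heis_mult a p (heis_inv (del (\<delta> j) z))) * cis (\<Lambda> j * Phi b \<beta> z)))
      = of_real (\<delta> j ^ (2 * CARD('n) + 2) * c) * J"
      by (simp add: J_def)
    also have "\<delta> j ^ (2 * CARD('n) + 2) * c = 2 powr (real j * \<alpha>)"
      unfolding \<delta>_power c_def powr_add[symmetric] by (simp add: algebra_simps)
    finally have "norm (conv a (Kj j) f p) = 2 powr (real j * \<alpha>) * norm J" by (simp add: norm_mult)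
    also have "\<dots> \<le> 2 powr (real j * \<alpha>) * (B / \<Lambda> j ^ N)"
      unfolding J_def by (intro mult_left_mono B(2) \<delta> \<Lambda>_pos) simp
    also have "\<dots> = B * (2 powr (real j * \<alpha> - real j * \<beta> * real N))"
      unfolding \<Lambda>_power powr_diff by simp
    also have "\<dots> \<le> B * 2 powr (- \<beta> * real j)"
    proof (intro mult_left_mono powr_mono)
      have "real j * \<alpha> \<le> real j * ((real CARD('n) + 1/2) * \<beta>)" by (rule exponent_le)
      also have "\<dots> \<le> real j * ((2 * real CARD('n) + 1) * \<beta>)"
        using \<beta> by (intro mult_left_mono mult_right_mono) auto
      also have "\<dots> = real j * \<beta> * real N - \<beta> * real j" by (simp add: N_def algebra_simps)
      finally show "real j * \<alpha> - real j * \<beta> * real N \<le> - \<beta> * real j" by simp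
    qed (use B in auto)
    finally show ?thesis by (simp add: powr_power mult.commute)
  qed
  have "2 powr (- \<beta>) < 1" using \<beta> by (simp add: powr_less_one)
  then have "summable (\<lambda>j. B * (2 powr (- \<beta>)) ^ j)" by (intro summable_mult summable_geometric) simp
  then show ?thesis by (rule summable_comparison_test'[where N = 0]) (rule bound)
qed

text \<open>By \<open>summable_pieces\<close> the limit in \<open>kernel_distr\<close> exists for
  the translated reflections of a test function that occur in \<open>heis_conv\<close>. There
  \<open>sing_op\<close> is the pointwise sum of the pieces, which
  \<open>L_eq_pointwise_limit\<close> identifies with the L2 operator.\<close>

lemma extends: "extends_to_bounded_L2_operator (sing_op a rho \<psi> \<theta> \<alpha> \<beta>)"
proof -
  obtain C1 where C1: "C1 \<ge> 0" "\<And>j. (\<integral>\<^sup>+u. ennreal (cmod (G j j u)) \<partial>lborel) \<le> ennreal C1"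
    using diagonal_bound by blast
  obtain C2 M where C2: "C2 \<ge> 0" "\<And>j k. k + M \<le> j \<Longrightarrow>
    (\<integral>\<^sup>+u. ennreal (cmod (G j k u)) \<partial>lborel) \<le> ennreal (C2 * (2 powr (- \<beta> / 2)) ^ (j + k))"
    using off_diagonal_bound by blast
  define q where "q = 2 powr (- \<beta> / 2)"
  have q: "0 < q" "q < 1" using \<beta> by (simp_all add: q_def powr_less_one)
  define B where "B = C1 + C2"
  interpret ao: almost_orthogonal "\<lambda>j. conv a (Kj j)" "\<lambda>j. conv a (\<lambda>z. cnj (Kj j z))"
    "\<lambda>j k. if j + M \<le> k \<or> k + M \<le> j then B * q ^ (j + k) else B" B q M
  proof (rule almost_orthogonal_conv[OF Kj_L1_L2 Kj_even])
    fix j k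
    have "(\<integral>\<^sup>+u. ennreal (cmod (G j j u)) \<partial>lborel) \<le> ennreal B"
      by (rule order_trans[OF C1(2)]) (use C2 in \<open>simp add: B_def ennreal_leI\<close>)
    then show "(\<integral>\<^sup>+u. ennreal (cmod (LINT z|lborel. cnj (Kj j z) * Kj j (heis_mult a u z))) \<partial>lborel) \<le> ennreal B"
      by (simp add: G_def)
    show "(\<integral>\<^sup>+u. ennreal (cmod (LINT z|lborel. cnj (Kj j z) * Kj k (heis_mult a u z))) \<partial>lborel) \<le> ennreal (B * q ^ (j + k))"
      if "k + M \<le> j"
    proof -
      have "(\<integral>\<^sup>+u. ennreal (cmod (G j k u)) \<partial>lborel) \<le> ennreal (B * q ^ (j + k))"
        by (rule order_trans[OF C2(2)[OF that]])
          (unfold q_def[symmetric] B_def, use C1 q in \<open>auto intro!: ennreal_leI mult_right_mono\<close>)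
      then show ?thesis by (simp add: G_def)
    qed
  qed (use C1 C2 q in \<open>auto simp: B_def\<close>)
  show ?thesis unfolding extends_to_bounded_L2_operator_def
  proof (intro exI conjI allI impI)
    show "bounded_L2_operator ao.L" by (rule ao.bounded_L)
    fix f :: "'n heis \<Rightarrow> complex" assume f: "test_function f"
    then have sm: "smooth_on UNIV f" by (simp add: test_function_def smooth_iff_smooth_on)
    have cont: "continuous_on UNIV f" by (rule smooth_on_continuous[OF sm])
    have z: "f x = 0" if "x \<notin> fsupport f" for x
      using that closure_subset[of "{x. f x \<noteq> 0}"] by (auto simp: fsupport_def)
    have fL2: "f \<in> L2"
      using continuous_compact_support(2)[of "fsupport f" f] f z continuous_on_subset[OF cont]
      by (auto simp: test_function_def)
    have lim: "(\<lambda>N. ao.S N f p) \<longlonglongrightarrow> (\<Sum>j. conv a (Kj j) f p)" for p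
      using summable_LIMSEQ'[OF summable_pieces[OF sm]] unfolding ao.S_def .
    have "fun_distr (kernel_trunc rho \<psi> \<theta> \<alpha> \<beta> N) (\<lambda>z. f (heis_mult a p (heis_inv z))) = ao.S N f p" for N p
    proof -
      have "fun_distr (kernel_trunc rho \<psi> \<theta> \<alpha> \<beta> N) (\<lambda>z. f (heis_mult a p (heis_inv z)))
          = (LINT z|lborel. (\<Sum>j\<le>N. Kj j z * f (heis_mult a p (heis_inv z))))"
        unfolding fun_distr_def kernel_trunc_def Kj_def sum_distrib_right ..
      also have "\<dots> = (\<Sum>j\<le>N. conv a (Kj j) f p)"
        unfolding conv_def by (rule Bochner_Integration.integral_sum) (rule conv_integrable[OF Kj_L1_L2(2) fL2])
      finally show ?thesis by (simp add: ao.S_def)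
    qed
    then have "sing_op a rho \<psi> \<theta> \<alpha> \<beta> f p = (\<Sum>j. conv a (Kj j) f p)" for p
      unfolding sing_op_def heis_conv_def kernel_distr_def using limI[OF lim] by simp
    then show "AE p in lborel. ao.L f p = sing_op a rho \<psi> \<theta> \<alpha> \<beta> f p"
      using ao.L_eq_pointwise_limit[OF fL2 lim] by simp
  qed
qed

end

theorem theorem2:
  fixes a b \<alpha> \<beta> :: real
    and \<psi> \<theta> :: "real \<Rightarrow> complex"
    and \<rho> :: "'n::finite heis \<Rightarrow> real"
  assumes "a \<noteq> 0" and "b \<noteq> 0" and "a\<^sup>2 / b\<^sup>2 \<le> 1"
    and "\<beta> > 0"
    and "\<And>x t. \<rho> (x, t) = rho2 (b *\<^sub>R x, b * t)"
    and "test_function \<psi>" and "fsupport \<psi> \<subseteq> {-1..1}"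
    and "test_function \<theta>" and "fsupport \<theta> \<subseteq> {1/2..2}"
    and "\<And>r. 0 < r \<Longrightarrow> r \<le> 1 \<Longrightarrow> (\<lambda>j. \<theta> (2 ^ j * r)) sums 1"
    and "\<alpha> \<le> (real CARD('n) + 1 / 2) * \<beta>"
  shows "extends_to_bounded_L2_operator (sing_op a \<rho> \<psi> \<theta> \<alpha> \<beta>)"
proof -
  interpret kernel a b \<alpha> \<beta> "- (2 * real CARD('n) + 2 + \<alpha>) / 2" \<psi> \<theta> "TYPE('n)"
  proof
    show "smooth_on UNIV \<psi>" "smooth_on UNIV \<theta>"
      using assms(6,8) by (simp_all add: test_function_def smooth_iff_smooth_on)
    show "1/2 \<le> r \<and> r \<le> 2" if "\<theta> r \<noteq> 0" for r
      using that assms(9) closure_subset[of "{r. \<theta> r \<noteq> 0}"] by (auto simp: fsupport_def)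
  qed (use assms in auto)
  have "\<rho> = rho"
  proof
    fix z
    show "\<rho> z = rho z" using assms(5)[of "fst z" "snd z"] rho2_eq[OF assms(2), of z] by (simp add: rho_def)
  qed
  then show ?thesis using extends by simp
qed

end
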